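(* Let $\Phi:D\to\mathbb{R}$ be a warping function with associated weights $w=(\Phi^{-1})'$ and $v$, let $\theta\in\mathbf{L}^2_{\sqrt v}(\mathbb{R})$, $\mathbf{a}=(a_m)_{m\in\mathbb{Z}}\subset\mathbb{R}^+$, and let $\mathcal{G}(\Phi,\theta,\mathbf{a})$ be the corresponding warped filter bank for $\mathcal{F}^{-1}(\mathbf{L}^2(D))$. (i) If $\mathcal{G}(\Phi,\theta,\mathbf{a})$ is a Bessel sequence with bound $B<\infty$, then $$\sum_{m\in\mathbb{Z}}|\theta(\tau-m)|^2\le B<\infty\quad\text{for almost all }\tau\in\mathbb{R}.$$ (ii) If $\mathcal{G}(\Phi,\theta,\mathbf{a})$ is a frame with lower bound $A>0$ and $\sup_{m\in\mathbb{Z}}a_mw(m)<\infty$, then $$0<A\le\sum_{m\in\mathbb{Z}}|\theta(\tau-m)|^2\quad\text{for almost all }\tau\in\mathbb{R}.$$ (iii) Assume that there are constants $c<d$ such that $\operatorname{supp}(\theta)\subseteq[c,d]$ and $a_m^{-1}\ge\Phi^{-1}(d+m)-\Phi^{-1}(c+m)$ for all $m\in\mathbb{Z}$. Then $\mathcal{G}(\Phi,\theta,\mathbf{a})$ forms a frame for $\mathcal{F}^{-1}(\mathbf{L}^2(D))$, with frame bounds $A,B$, if and only if $0<A\le\sum_{m\in\mathbb{Z}}|\mathbf{T}_m\theta|^2\le B<\infty$ almost everywhere. Furthermore, in that case the canonical dual frame for $\mathcal{G}(\Phi,\theta,\mathbf{a})$ is given by $\mathcal{G}(\Phi,\tilde\theta,\mathbf{a})$,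 with $$\tilde\theta=\frac{\theta}{\sum_{l\in\mathbb{Z}}|\mathbf{T}_l\theta|^2}.$$
   Context: Weights are continuous positive functions $\mathbb{R}\to\mathbb{R}^+$. A weight $v$ is submultiplicative if $v(x+y)\le v(x)v(y)$ for all $x,y\in\mathbb{R}$; a weight $w$ is $v$-moderate if $w(x+y)\le v(x)w(y)$ for all $x,y\in\mathbb{R}$. For a weight $u$, $\mathbf{L}^p_u(\mathbb{R})=\{f:\mathbb{R}\to\mathbb{C} : uf\in\mathbf{L}^p(\mathbb{R})\}$. Warping function: for an open interval $D\subseteq\mathbb{R}$, a $\mathcal{C}^1$-diffeomorphism $\Phi:D\to\mathbb{R}$ with $\Phi'>0$ such that there is a submultiplicative weight $v$ for which $w:=(\Phi^{-1})'$ is $v$-moderate. Given $\Phi$, $w$ and $v$ always denote these weights. $\mathbf{L}^2(D)$ denotes the functions in $\mathbf{L}^2(\mathbb{R})$ vanishing almost everywhere outside $D$. The Fourier transform is $\mathcal{F}f(\xi)=\int_{\mathbb{R}} f(t)e^{-2\pi i t\xi}\,dt$, extended to $\mathbf{L}^2(\mathbb{R})$; $\mathcal{F}^{-1}(\mathbf{L}^2(D))\subseteq\mathbf{L}^2(\mathbb{R})$ is the space of functions with Fourier transform in $\mathbf{L}^2(D)$. $\mathbf{T}_xf=f(\cdot-x)$. Warped filter bank: for a warping function $\Phi$, $\theta\in\mathbf{L}^2_{\sqrt v}(\mathbb{R})$ (complex-valued) and $\mathbf{a}=(a_m)_{m\in\mathbb{Z}}\subset\mathbb{R}^+$, $\mathcal{G}(\Phi,\theta,\mathbf{a})=(g_{m,n})_{m,n\in\mathbb{Z}}$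 with $g_{m,n}=\mathbf{T}_{na_m}\mathcal{F}^{-1}(g_m)$, where $g_m(\xi)=\sqrt{a_m}\,\theta(\Phi(\xi)-m)$ for $\xi\in D$ and $g_m(\xi)=0$ otherwise. The system is a frame for $\mathcal{F}^{-1}(\mathbf{L}^2(D))$ with frame bounds $A,B$ ($0<A\le B<\infty$) if $A\|f\|_2^2\le\sum_{m,n}|\langle f,g_{m,n}\rangle|^2\le B\|f\|_2^2$ for all $f\in\mathcal{F}^{-1}(\mathbf{L}^2(D))$ (bounds need not be optimal); it is a Bessel sequence with bound $B$ if the upper inequality holds. The frame operator is $\mathbf{S}f=\sum_{m,n}\langle f,g_{m,n}\rangle g_{m,n}$ on $\mathcal{F}^{-1}(\mathbf{L}^2(D))$, and the canonical dual frame is $(\mathbf{S}^{-1}g_{m,n})_{m,n\in\mathbb{Z}}$. *)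

theory Defs
  imports "HOL-Analysis.Analysis"
begin

text \<open>
  Elements of \<open>L\<^sup>2\<close> are represented by Lebesgue measurable functions; equality in \<open>L\<^sup>2\<close> is equality
  almost everywhere. Operators on \<open>L\<^sup>2\<close> which are only determined up to null sets return some
  representative, chosen by Hilbert's epsilon.
\<close>

subsection \<open>Weights and warping functions\<close>

definition weight :: "(real \<Rightarrow> real) \<Rightarrow> bool" where
  "weight u \<longleftrightarrow> continuous_on UNIV u \<and> (\<forall>x. 0 < u x)"

definition submultiplicative :: "(real \<Rightarrow> real) \<Rightarrow> bool" where
  "submultiplicative v \<longleftrightarrow> weight v \<and> (\<forall>x y. v (x + y) \<le> v x * v y)"

definition moderate :: "(real \<Rightarrow> real) \<Rightarrow> (real \<Rightarrow> real) \<Rightarrow> bool" where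
  "moderate v w \<longleftrightarrow> weight w \<and> (\<forall>x y. w (x + y) \<le> v x * w y)"

definition warp_weight :: "real set \<Rightarrow> (real \<Rightarrow> real) \<Rightarrow> real \<Rightarrow> real" where
  "warp_weight D \<Phi> = deriv (inv_into D \<Phi>)"

definition warping_function :: "real set \<Rightarrow> (real \<Rightarrow> real) \<Rightarrow> (real \<Rightarrow> real) \<Rightarrow> bool" where
  "warping_function D \<Phi> v \<longleftrightarrow>
     open D \<and> is_interval D \<and> bij_betw \<Phi> D UNIV \<and>
     \<Phi> C1_differentiable_on D \<and> inv_into D \<Phi> C1_differentiable_on UNIV \<and>
     (\<forall>x\<in>D. 0 < deriv \<Phi> x) \<and>
     submultiplicative v \<and> moderate v (warp_weight D \<Phi>)"

subsection \<open>Square-integrable functions\<close>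

definition L2 :: "(real \<Rightarrow> complex) set" where
  "L2 = {f. f \<in> borel_measurable lebesgue \<and> integrable lebesgue (\<lambda>x. (cmod (f x))\<^sup>2)}"

definition L2_on :: "real set \<Rightarrow> (real \<Rightarrow> complex) set" where
  "L2_on D = {f \<in> L2. AE x in lebesgue. x \<notin> D \<longrightarrow> f x = 0}"

definition L2_weighted :: "(real \<Rightarrow> real) \<Rightarrow> (real \<Rightarrow> complex) set" where
  "L2_weighted u = {f. (\<lambda>x. complex_of_real (u x) * f x) \<in> L2}"

definition L2_inner :: "(real \<Rightarrow> complex) \<Rightarrow> (real \<Rightarrow> complex) \<Rightarrow> complex" where
  "L2_inner f g = (LINT x|lebesgue. f x * cnj (g x))"

definition L2_norm :: "(real \<Rightarrow> complex) \<Rightarrow> real" where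
  "L2_norm f = sqrt (LINT x|lebesgue. (cmod (f x))\<^sup>2)"

definition L2_tendsto :: "('i \<Rightarrow> real \<Rightarrow> complex) \<Rightarrow> (real \<Rightarrow> complex) \<Rightarrow> 'i filter \<Rightarrow> bool" where
  "L2_tendsto h f F \<longleftrightarrow>
     (\<forall>i. h i \<in> L2) \<and> f \<in> L2 \<and> ((\<lambda>i. L2_norm (\<lambda>x. h i x - f x)) \<longlongrightarrow> 0) F"

text \<open>The essential support: the complement of the largest open set on which \<open>f\<close> vanishes
  almost everywhere.\<close>

definition ess_supp :: "(real \<Rightarrow> complex) \<Rightarrow> real set" where
  "ess_supp f = - \<Union>{U. open U \<and> (AE x in lebesgue. x \<in> U \<longrightarrow> f x = 0)}"

definition translate :: "real \<Rightarrow> (real \<Rightarrow> complex) \<Rightarrow> real \<Rightarrow> complex" where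
  "translate x f = (\<lambda>t. f (t - x))"

subsection \<open>The Fourier transform\<close>

definition fourier :: "(real \<Rightarrow> complex) \<Rightarrow> real \<Rightarrow> complex" where
  "fourier f \<xi> =
     (LINT t|lebesgue. f t * exp (- 2 * complex_of_real pi * \<i> * complex_of_real t * complex_of_real \<xi>))"

text \<open>\<open>has_fourier_L2 f g\<close> says that \<open>g\<close> is (a representative of) the Fourier transform of \<open>f\<close> in
  \<open>L\<^sup>2\<close>: the graph of the continuous extension is the closure of the graph on \<open>L\<^sup>1 \<inter> L\<^sup>2\<close>.\<close>

definition has_fourier_L2 :: "(real \<Rightarrow> complex) \<Rightarrow> (real \<Rightarrow> complex) \<Rightarrow> bool" where
  "has_fourier_L2 f g \<longleftrightarrow>
     (\<exists>h :: nat \<Rightarrow> real \<Rightarrow> complex. (\<forall>k. integrable lebesgue (h k)) \<and>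
        L2_tendsto h f sequentially \<and> L2_tendsto (\<lambda>k. fourier (h k)) g sequentially)"

definition inv_fourier_L2 :: "(real \<Rightarrow> complex) \<Rightarrow> real \<Rightarrow> complex" where
  "inv_fourier_L2 g = (SOME f. has_fourier_L2 f g)"

definition band_space :: "real set \<Rightarrow> (real \<Rightarrow> complex) set" where
  "band_space D = {f \<in> L2. \<exists>g \<in> L2_on D. has_fourier_L2 f g}"

subsection \<open>Frames\<close>

text \<open>The sums of squared coefficients are taken in \<^typ>\<open>ennreal\<close>, where they always exist; an
  upper bound therefore includes convergence.\<close>

definition coeff_sum :: "('i \<Rightarrow> real \<Rightarrow> complex) \<Rightarrow> (real \<Rightarrow> complex) \<Rightarrow> ennreal" where
  "coeff_sum G f = (\<Sum>\<^sub>\<infinity>i. ennreal ((cmod (L2_inner f (G i)))\<^sup>2))"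

definition bessel_sequence ::
    "(real \<Rightarrow> complex) set \<Rightarrow> ('i \<Rightarrow> real \<Rightarrow> complex) \<Rightarrow> real \<Rightarrow> bool" where
  "bessel_sequence H G B \<longleftrightarrow>
     0 \<le> B \<and> (\<forall>f\<in>H. coeff_sum G f \<le> ennreal (B * (L2_norm f)\<^sup>2))"

definition frame ::
    "(real \<Rightarrow> complex) set \<Rightarrow> ('i \<Rightarrow> real \<Rightarrow> complex) \<Rightarrow> real \<Rightarrow> real \<Rightarrow> bool" where
  "frame H G A B \<longleftrightarrow>
     0 < A \<and> A \<le> B \<and>
     (\<forall>f\<in>H. ennreal (A * (L2_norm f)\<^sup>2) \<le> coeff_sum G f \<and>
             coeff_sum G f \<le> ennreal (B * (L2_norm f)\<^sup>2))"

text \<open>The series defining the frame operator converges unconditionally in \<open>L\<^sup>2\<close>.\<close>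

definition frame_operator ::
    "('i \<Rightarrow> real \<Rightarrow> complex) \<Rightarrow> (real \<Rightarrow> complex) \<Rightarrow> real \<Rightarrow> complex" where
  "frame_operator G f =
     (SOME h. L2_tendsto (\<lambda>F x. \<Sum>i\<in>F. L2_inner f (G i) * G i x) h (finite_subsets_at_top UNIV))"

definition inv_frame_operator ::
    "(real \<Rightarrow> complex) set \<Rightarrow> ('i \<Rightarrow> real \<Rightarrow> complex) \<Rightarrow> (real \<Rightarrow> complex) \<Rightarrow> real \<Rightarrow> complex" where
  "inv_frame_operator H G h =
     (SOME f. f \<in> H \<and> (AE x in lebesgue. frame_operator G f x = h x))"

definition canonical_dual ::
    "(real \<Rightarrow> complex) set \<Rightarrow> ('i \<Rightarrow> real \<Rightarrow> complex) \<Rightarrow> 'i \<Rightarrow> real \<Rightarrow> complex" where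
  "canonical_dual H G i = inv_frame_operator H G (G i)"

subsection \<open>Warped filter banks\<close>

definition warped_filter ::
    "real set \<Rightarrow> (real \<Rightarrow> real) \<Rightarrow> (real \<Rightarrow> complex) \<Rightarrow> (int \<Rightarrow> real) \<Rightarrow> int \<Rightarrow> real \<Rightarrow> complex" where
  "warped_filter D \<Phi> \<theta> a m \<xi> =
     (if \<xi> \<in> D then complex_of_real (sqrt (a m)) * \<theta> (\<Phi> \<xi> - of_int m) else 0)"

definition warped_filter_bank ::
    "real set \<Rightarrow> (real \<Rightarrow> real) \<Rightarrow> (real \<Rightarrow> complex) \<Rightarrow> (int \<Rightarrow> real) \<Rightarrow> int \<times> int \<Rightarrow> real \<Rightarrow> complex" where
  "warped_filter_bank D \<Phi> \<theta> a =
     (\<lambda>(m, n). translate (of_int n * a m) (inv_fourier_L2 (warped_filter D \<Phi> \<theta> a m)))"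

definition shift_sum :: "(real \<Rightarrow> complex) \<Rightarrow> real \<Rightarrow> ennreal" where
  "shift_sum \<theta> \<tau> = (\<Sum>\<^sub>\<infinity>m::int. ennreal ((cmod (translate (of_int m) \<theta> \<tau>))\<^sup>2))"

definition dual_prototype :: "(real \<Rightarrow> complex) \<Rightarrow> real \<Rightarrow> complex" where
  "dual_prototype \<theta> \<tau> =
     \<theta> \<tau> / complex_of_real (\<Sum>\<^sub>\<infinity>l::int. (cmod (translate (of_int l) \<theta> \<tau>))\<^sup>2)"

end

theory Submission imports Defs
begin

text \<open>By Plancherel's theorem the coefficient \<open>\<langle>f, g\<^sub>m\<^sub>,\<^sub>n\<rangle>\<close> is the \<open>n\<close>-th Fourier coefficient, at step \<open>a\<^sub>m\<close>, of the
  transform \<open>F\<close> of \<open>f\<close> times the conjugate of \<open>g\<^sub>m\<close>. If this product lives on an interval of length \<open>1 / a\<^sub>m\<close>,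
  Parseval's identity turns the sum over \<open>n\<close> into the integral of \<open>|F(y)|\<^sup>2 |\<theta>(\<Phi>(y) - m)|\<^sup>2\<close>; on an interval of length
  \<open>l\<close> it is still bounded by \<open>1 + l a\<^sub>m\<close> times that integral. Testing the frame inequalities on indicator functions of
  small sets gives (i), and also (ii): after summing over tiles of length \<open>l\<close> the error is \<open>l \<Sum>\<^sub>m a\<^sub>m \<integral> |\<theta>(\<Phi>(y) - m)|\<^sup>2\<close>,
  which is finite because \<open>w\<close> is \<open>v\<close>-moderate, and \<open>l\<close> is arbitrary. In (iii) the identity is exact for every \<open>f\<close>, so the
  frame operator multiplies the transform by \<open>\<Sum>\<^sub>m |\<theta>(\<Phi>(y) - m)|\<^sup>2\<close>; this function is invariant under shifts of
  \<open>\<Phi>(y)\<close> by integers, so that dividing by it amounts to replacing \<open>\<theta>\<close> by the dual prototype.\<close>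

subsection \<open>Square-integrable functions\<close>

text \<open>The filters \<open>g m\<close> are square integrable but possibly unbounded, so the
  product of a general transform \<open>F\<close> with \<open>cnj (g m y)\<close> can fall outside
  \<open>L2\<close>, where Parseval's identity lives. Hence the necessary conditions are tested on
  indicators, whose products are harmless, and in the painless case the pointwise bound on
  \<open>shift_sum\<close> comes before arbitrary \<open>F\<close>. Null sets pass between
  \<open>D\<close> and the line because \<open>\<Phi>\<close> and its inverse are differentiable;
  the weight \<open>w\<close> enters as the Jacobian, when masses of atoms are computed.
  Plancherel's theorem is itself derived from Parseval's identity: applied to all modulations of a
  compactly supported function, it controls the samples of the transform along every shifted
  lattice, and integrating over one lattice cell recovers the full integral. Frame operator and dual
  are chosen by Hilbert's epsilon. They are pinned down on the Fourier side: \<open>L2\<close>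
  limits are unique almost everywhere, and the multiplier is at least \<open>A\<close> on
  \<open>D\<close>, so a preimage under the frame operator is unique as well.\<close>

abbreviation vanishes_off :: "real set \<Rightarrow> (real \<Rightarrow> complex) \<Rightarrow> bool" where
  "vanishes_off S f \<equiv> AE x in lebesgue. x \<notin> S \<longrightarrow> f x = 0"

abbreviation Lmeas :: "(real \<Rightarrow> 'a::topological_space) set" where
  "Lmeas \<equiv> borel_measurable lebesgue"

abbreviation esq :: "complex \<Rightarrow> ennreal" where
  "esq z \<equiv> ennreal ((cmod z)\<^sup>2)"

text \<open>Sums of extended reals as integrals over a counting measure, so that Tonelli's theorem applies.\<close>

abbreviation nn_sum :: "('i \<Rightarrow> ennreal) \<Rightarrow> ennreal" (binder "NNSUM " 10) where
  "nn_sum f \<equiv> integral\<^sup>N (count_space UNIV) f"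

lemma infsum_ennreal_eq_nn_integral:
  fixes f :: "'i::countable \<Rightarrow> ennreal"
  assumes "infinite (UNIV :: 'i set)"
  shows "(\<Sum>\<^sub>\<infinity>i. f i) = (NNSUM i. f i)"
proof -
  have b: "bij_betw (from_nat_into (UNIV :: 'i set)) UNIV UNIV"
    using assms by (intro bij_betw_from_nat_into) auto
  define g where "g n = f (from_nat_into UNIV n)" for n
  have "(\<Sum>\<^sub>\<infinity>i. f i) = (\<Sum>\<^sub>\<infinity>n. g n)"
    unfolding g_def by (rule infsum_reindex_bij_betw[OF b, symmetric])
  also have "\<dots> = (\<Sum>n. g n)"
    by (metis has_sum_imp_sums has_sum_infsum nonneg_summable_on_complete sums_iff zero_le)
  also have "\<dots> = (NNSUM n. g n)"
    by (simp add: nn_integral_count_space_nat)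
  also have "\<dots> = (NNSUM i. f i)"
    unfolding g_def by (rule nn_integral_bij_count_space[OF b])
  finally show ?thesis .
qed

section \<open>Vector space structure, inner product and norm of \<open>L2\<close>\<close>

lemma L2_measurable: "f \<in> L2 \<Longrightarrow> f \<in> Lmeas"
  by (simp add: L2_def)

lemma L2_integrable: "f \<in> L2 \<Longrightarrow> integrable lebesgue (\<lambda>x. (cmod (f x))\<^sup>2)"
  by (simp add: L2_def)

lemma L2_iff_nn:
  "f \<in> L2 \<longleftrightarrow> f \<in> Lmeas \<and> (\<integral>\<^sup>+x. esq (f x) \<partial>lebesgue) < \<infinity>"
  by (auto simp: L2_def integrable_iff_bounded)

abbreviation L2_dist :: "(real \<Rightarrow> complex) \<Rightarrow> (real \<Rightarrow> complex) \<Rightarrow> real" where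
  "L2_dist f g \<equiv> L2_norm (\<lambda>x. f x - g x)"

lemma L2_norm_nonneg: "0 \<le> L2_norm f"
  by (simp add: L2_norm_def)

lemma L2_norm_sq: "(L2_norm f)\<^sup>2 = (LINT x|lebesgue. (cmod (f x))\<^sup>2)"
  by (simp add: L2_norm_def)

lemma nn_eq_L2_norm:
  "f \<in> L2 \<Longrightarrow> (\<integral>\<^sup>+x. esq (f x) \<partial>lebesgue) = ennreal ((L2_norm f)\<^sup>2)"
  by (simp add: L2_norm_sq L2_def nn_integral_eq_integral)

lemma L2_cong_AE:
  assumes "f \<in> L2" "AE x in lebesgue. f x = g x"
  shows "g \<in> L2"
proof -
  have g: "g \<in> Lmeas"
    using borel_measurable_AE[OF L2_measurable[OF assms(1)] assms(2)] .
  have "integrable lebesgue (\<lambda>x. (cmod (g x))\<^sup>2)"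
    by (rule integrable_cong_AE_imp[OF L2_integrable[OF assms(1)]])
       (use g assms(2) in \<open>auto intro: borel_measurable_power borel_measurable_norm\<close>)
  then show ?thesis by (simp add: L2_def g)
qed

lemma L2_norm_cong_AE:
  assumes "f \<in> Lmeas" "AE x in lebesgue. f x = g x"
  shows "L2_norm f = L2_norm g"
proof -
  have g: "g \<in> Lmeas"
    using borel_measurable_AE[OF assms] .
  have "(LINT x|lebesgue. (cmod (f x))\<^sup>2) = (LINT x|lebesgue. (cmod (g x))\<^sup>2)"
    by (rule integral_cong_AE)
       (use g assms in \<open>auto intro: borel_measurable_power borel_measurable_norm\<close>)
  then show ?thesis by (simp add: L2_norm_def)
qed

lemma L2_dominated:
  assumes "f \<in> L2" "g \<in> Lmeas" "AE x in lebesgue. cmod (g x) \<le> C * cmod (f x)"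
  shows "g \<in> L2"
proof -
  have "integrable lebesgue (\<lambda>x. (cmod (g x))\<^sup>2)"
  proof (rule Bochner_Integration.integrable_bound)
    show "integrable lebesgue (\<lambda>x. C\<^sup>2 * (cmod (f x))\<^sup>2)"
      using L2_integrable[OF assms(1)] by simp
    show "(\<lambda>x. (cmod (g x))\<^sup>2) \<in> Lmeas"
      using assms(2) by measurable
    show "AE x in lebesgue. norm ((cmod (g x))\<^sup>2) \<le> norm (C\<^sup>2 * (cmod (f x))\<^sup>2)"
      using assms(3)
    proof eventually_elim
      case (elim x)
      then have "(cmod (g x))\<^sup>2 \<le> (C * cmod (f x))\<^sup>2"
        by (intro power_mono) auto
      then show ?case by (simp add: power_mult_distrib)
    qed
  qed
  then show ?thesis using assms(2) by (simp add: L2_def)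
qed

lemma L2_cmult: "f \<in> L2 \<Longrightarrow> (\<lambda>x. c * f x) \<in> L2"
  by (rule L2_dominated[where f=f and C="cmod c"])
     (auto dest: L2_measurable simp: norm_mult)

lemma L2_bounded_mult:
  assumes "f \<in> L2" "b \<in> Lmeas" "AE x in lebesgue. cmod (b x) \<le> C"
  shows "(\<lambda>x. b x * f x) \<in> L2"
proof (rule L2_dominated[OF assms(1), where C=C])
  show "(\<lambda>x. b x * f x) \<in> Lmeas"
    using assms(2) L2_measurable[OF assms(1)] by measurable
  show "AE x in lebesgue. cmod (b x * f x) \<le> C * cmod (f x)"
    using assms(3) by eventually_elim (simp add: norm_mult mult_right_mono)
qed

lemma L2_cnj: "f \<in> L2 \<Longrightarrow> (\<lambda>x. cnj (f x)) \<in> L2"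
  using measurable_compose[OF L2_measurable borel_measurable_continuous_onI[of cnj]]
  by (auto simp: L2_def continuous_on_cnj)

lemma L2_zero: "(\<lambda>x. 0) \<in> L2"
  by (simp add: L2_def)

lemma cmod_add_sq_le: "(cmod (x + y))\<^sup>2 \<le> 2 * (cmod x)\<^sup>2 + 2 * (cmod y)\<^sup>2"
proof -
  have "(cmod (x + y))\<^sup>2 \<le> (cmod x + cmod y)\<^sup>2"
    by (intro power_mono norm_triangle_ineq) auto
  also have "\<dots> \<le> 2 * (cmod x)\<^sup>2 + 2 * (cmod y)\<^sup>2"
    using sum_squares_bound[of "cmod x" "cmod y"] by (simp add: power2_sum)
  finally show ?thesis .
qed

lemma L2_add:
  assumes "f \<in> L2" "g \<in> L2"
  shows "(\<lambda>x. f x + g x) \<in> L2"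
proof -
  note [measurable] = L2_measurable[OF assms(1)] L2_measurable[OF assms(2)]
  have "integrable lebesgue (\<lambda>x. (cmod (f x + g x))\<^sup>2)"
  proof (rule Bochner_Integration.integrable_bound)
    show "integrable lebesgue (\<lambda>x. 2 * (cmod (f x))\<^sup>2 + 2 * (cmod (g x))\<^sup>2)"
      using L2_integrable[OF assms(1)] L2_integrable[OF assms(2)] by simp
  qed (auto intro!: AE_I2 cmod_add_sq_le)
  then show ?thesis by (simp add: L2_def)
qed

lemma L2_diff: "f \<in> L2 \<Longrightarrow> g \<in> L2 \<Longrightarrow> (\<lambda>x. f x - g x) \<in> L2"
  using L2_add[of f "\<lambda>x. - 1 * g x"] L2_cmult[of g "-1"] by simp

lemma L2_sum: "(\<And>i. i \<in> F \<Longrightarrow> f i \<in> L2) \<Longrightarrow> (\<lambda>x. \<Sum>i\<in>F. f i x) \<in> L2"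
  by (induction F rule: infinite_finite_induct) (auto simp: L2_zero L2_add)

lemma L2_integrable_mult:
  assumes "f \<in> L2" "g \<in> L2"
  shows "integrable lebesgue (\<lambda>x. f x * g x)"
proof (rule Bochner_Integration.integrable_bound)
  note [measurable] = L2_measurable[OF assms(1)] L2_measurable[OF assms(2)]
  show "integrable lebesgue (\<lambda>x. (cmod (f x))\<^sup>2 + (cmod (g x))\<^sup>2)"
    using L2_integrable[OF assms(1)] L2_integrable[OF assms(2)] by simp
  show "(\<lambda>x. f x * g x) \<in> Lmeas" by measurable
  show "AE x in lebesgue. norm (f x * g x) \<le> norm ((cmod (f x))\<^sup>2 + (cmod (g x))\<^sup>2)"
  proof (rule AE_I2)
    fix x
    have "cmod (f x) * cmod (g x) \<le> (cmod (f x))\<^sup>2 + (cmod (g x))\<^sup>2"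
      using sum_squares_bound[of "cmod (f x)" "cmod (g x)"] 
        mult_nonneg_nonneg[OF norm_ge_zero[of "f x"] norm_ge_zero[of "g x"]] by linarith
    then show "norm (f x * g x) \<le> norm ((cmod (f x))\<^sup>2 + (cmod (g x))\<^sup>2)"
      by (simp add: norm_mult)
  qed
qed

lemma L2_integrable_cnj_mult:
  "f \<in> L2 \<Longrightarrow> g \<in> L2 \<Longrightarrow> integrable lebesgue (\<lambda>x. f x * cnj (g x))"
  by (intro L2_integrable_mult L2_cnj)

lemma L2_inner_add_left:
  "f \<in> L2 \<Longrightarrow> g \<in> L2 \<Longrightarrow> h \<in> L2 \<Longrightarrow> L2_inner (\<lambda>x. f x + g x) h = L2_inner f h + L2_inner g h"
  by (simp add: L2_inner_def distrib_right L2_integrable_cnj_mult)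

lemma L2_inner_diff_left:
  "f \<in> L2 \<Longrightarrow> g \<in> L2 \<Longrightarrow> h \<in> L2 \<Longrightarrow> L2_inner (\<lambda>x. f x - g x) h = L2_inner f h - L2_inner g h"
  by (simp add: L2_inner_def left_diff_distrib L2_integrable_cnj_mult)

lemma L2_inner_cmult_left: "L2_inner (\<lambda>x. c * f x) g = c * L2_inner f g"
  by (simp add: L2_inner_def mult.assoc)

lemma L2_inner_cmult_right: "L2_inner f (\<lambda>x. c * g x) = cnj c * L2_inner f g"
  by (simp add: L2_inner_def mult.left_commute)

lemma L2_inner_commute: "L2_inner g f = cnj (L2_inner f g)"
  unfolding L2_inner_def
  by (subst Bochner_Integration.integral_cnj [symmetric]) (simp add: mult.commute)

lemma L2_inner_sum_left:
  assumes "\<And>i. i \<in> F \<Longrightarrow> f i \<in> L2" "g \<in> L2"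
  shows "L2_inner (\<lambda>x. \<Sum>i\<in>F. f i x) g = (\<Sum>i\<in>F. L2_inner (f i) g)"
  using assms(1)
proof (induction F rule: infinite_finite_induct)
  case (insert i F)
  then show ?case by (simp add: L2_inner_add_left L2_sum assms(2))
qed (auto simp: L2_inner_def)

lemma L2_inner_self: "f \<in> L2 \<Longrightarrow> L2_inner f f = of_real ((L2_norm f)\<^sup>2)"
  by (simp add: L2_inner_def L2_norm_sq complex_norm_square del: of_real_power flip: integral_complex_of_real)

text \<open>Expanding a squared distance in this way turns statements about norms into statements
  about inner products; best approximation, the inversion of the transform and Plancherel for inner
  products all rest on it.\<close>

lemma L2_norm_diff_sq:
  assumes "f \<in> L2" "g \<in> L2"
  shows "(L2_dist f g)\<^sup>2 = (L2_norm f)\<^sup>2 - 2 * Re (L2_inner f g) + (L2_norm g)\<^sup>2"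
proof -
  define r where "r x = Re (f x * cnj (g x))" for x
  have e: "(cmod (f x - g x))\<^sup>2 = (cmod (f x))\<^sup>2 - 2 * r x + (cmod (g x))\<^sup>2" for x
    unfolding r_def
    unfolding cmod_power2 by (simp add: power2_eq_square algebra_simps)
  have "Re (L2_inner f g) = (LINT x|lebesgue. r x)"
    unfolding r_def L2_inner_def by (rule integral_Re[OF L2_integrable_cnj_mult[OF assms], symmetric])
  then show ?thesis
    unfolding L2_norm_sq e
    using L2_integrable[OF assms(1)] L2_integrable[OF assms(2)]
      integrable_Re[OF L2_integrable_cnj_mult[OF assms]]
    unfolding r_def[symmetric]
    by simp
qed

lemma L2_Cauchy_Schwarz:
  assumes "f \<in> L2" "g \<in> L2"
  shows "cmod (L2_inner f g) \<le> L2_norm f * L2_norm g"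
proof -
  note [measurable] = L2_measurable[OF assms(1)] L2_measurable[OF assms(2)]
  let ?I = "LINT x|lebesgue. cmod (f x) * cmod (g x)"
  have i: "integrable lebesgue (\<lambda>x. cmod (f x) * cmod (g x))"
    using integrable_norm[OF L2_integrable_cnj_mult[OF assms]] by (simp add: norm_mult)
  have "cmod (L2_inner f g) \<le> ?I"
    unfolding L2_inner_def using integral_norm_bound[of lebesgue "\<lambda>x. f x * cnj (g x)"]
    by (simp add: norm_mult)
  moreover have "?I \<le> L2_norm f * L2_norm g"
  proof (rule power2_le_imp_le)
    have "ennreal (?I\<^sup>2) = (\<integral>\<^sup>+x. ennreal (cmod (f x)) * ennreal (cmod (g x)) \<partial>lebesgue)\<^sup>2"
      using nn_integral_eq_integral[OF i] by (simp add: ennreal_mult ennreal_power)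
    also have "\<dots> \<le> (\<integral>\<^sup>+x. (ennreal (cmod (f x)))\<^sup>2 \<partial>lebesgue) * (\<integral>\<^sup>+x. (ennreal (cmod (g x)))\<^sup>2 \<partial>lebesgue)"
      by (rule Cauchy_Schwarz_nn_integral) measurable
    also have "\<dots> = ennreal ((L2_norm f * L2_norm g)\<^sup>2)"
      using nn_eq_L2_norm[OF assms(1)] nn_eq_L2_norm[OF assms(2)]
      by (simp add: ennreal_power power_mult_distrib ennreal_mult)
    finally show "?I\<^sup>2 \<le> (L2_norm f * L2_norm g)\<^sup>2"
      by (subst (asm) ennreal_le_iff) auto
  qed (simp add: L2_norm_nonneg)
  ultimately show ?thesis by linarith
qed

lemma L2_norm_uminus: "L2_norm (\<lambda>x. - f x) = L2_norm f"
  by (simp add: L2_norm_def)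

lemma L2_norm_minus_commute: "L2_dist f g = L2_dist g f"
  by (simp add: L2_norm_def norm_minus_commute)

lemma L2_norm_cmult: "L2_norm (\<lambda>x. c * f x) = cmod c * L2_norm f"
  by (simp add: L2_norm_def norm_mult power_mult_distrib real_sqrt_mult)

lemma L2_triangle_diff:
  assumes "f \<in> L2" "g \<in> L2"
  shows "L2_dist f g \<le> L2_norm f + L2_norm g"
proof (rule power2_le_imp_le)
  have "- Re (L2_inner f g) \<le> L2_norm f * L2_norm g"
    using L2_Cauchy_Schwarz[OF assms] abs_Re_le_cmod[of "L2_inner f g"] by linarith
  then show "(L2_dist f g)\<^sup>2 \<le> (L2_norm f + L2_norm g)\<^sup>2"
    by (simp add: L2_norm_diff_sq[OF assms] power2_sum)
qed (simp add: L2_norm_nonneg)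

lemma L2_triangle:
  assumes "f \<in> L2" "g \<in> L2"
  shows "L2_norm (\<lambda>x. f x + g x) \<le> L2_norm f + L2_norm g"
  using L2_triangle_diff[OF assms(1) L2_cmult[OF assms(2), of "-1"]]
  by (simp add: L2_norm_uminus)

lemma L2_triangle_dist:
  assumes "f \<in> L2" "g \<in> L2" "h \<in> L2"
  shows "L2_dist f h \<le> L2_dist f g + L2_dist g h"
  using L2_triangle[OF L2_diff[OF assms(1,2)] L2_diff[OF assms(2,3)]] by simp

lemma L2_norm_triangle_abs:
  assumes "f \<in> L2" "g \<in> L2"
  shows "\<bar>L2_norm f - L2_norm g\<bar> \<le> L2_dist f g"
  using L2_triangle[OF L2_diff[OF assms] assms(2)] L2_triangle[OF L2_diff[OF assms(2,1)] assms(1)]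
    L2_norm_minus_commute[of f g] by simp

lemma L2_norm_eq_0:
  assumes "f \<in> L2" "L2_norm f = 0"
  shows "AE x in lebesgue. f x = 0"
proof -
  have "(LINT x|lebesgue. (cmod (f x))\<^sup>2) = 0"
    using assms(2) by (simp flip: L2_norm_sq)
  then show ?thesis
    using integral_nonneg_eq_0_iff_AE[OF L2_integrable[OF assms(1)]] by simp
qed

lemma L2_dist_eq_0_iff:
  assumes "f \<in> L2" "g \<in> L2"
  shows "L2_dist f g = 0 \<longleftrightarrow> (AE x in lebesgue. f x = g x)"
proof
  assume "AE x in lebesgue. f x = g x"
  then have "L2_dist f g = L2_norm (\<lambda>x. 0)"
    using L2_measurable[OF L2_diff[OF assms]] by (intro L2_norm_cong_AE) auto
  then show "L2_dist f g = 0" by (simp add: L2_norm_def)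
qed (use L2_norm_eq_0[OF L2_diff[OF assms]] in simp)

section \<open>Convergence in \<open>L2\<close>, dominated convergence and completeness\<close>

lemma L2_tendstoD:
  assumes "L2_tendsto h f F"
  shows "h i \<in> L2" "f \<in> L2" "((\<lambda>i. L2_dist (h i) f) \<longlongrightarrow> 0) F"
  using assms unfolding L2_tendsto_def by blast+

lemma L2_tendsto_if_dist_le:
  assumes "\<And>i. h i \<in> L2" "f \<in> L2" and b: "(b \<longlongrightarrow> 0) F" and le: "\<forall>\<^sub>F i in F. L2_dist (h i) f \<le> b i"
  shows "L2_tendsto h f F"
proof -
  have "((\<lambda>i. L2_dist (h i) f) \<longlongrightarrow> 0) F"
    by (rule tendsto_sandwich[OF _ le tendsto_const b]) (simp add: L2_norm_nonneg)
  then show ?thesis using assms(1,2) by (simp add: L2_tendsto_def)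
qed

lemma L2_tendsto_norm:
  assumes "L2_tendsto h f F"
  shows "((\<lambda>i. L2_norm (h i)) \<longlongrightarrow> L2_norm f) F"
proof -
  have "((\<lambda>i. \<bar>L2_norm (h i) - L2_norm f\<bar>) \<longlongrightarrow> 0) F"
  proof (rule tendsto_sandwich[OF _ _ tendsto_const L2_tendstoD(3)[OF assms]])
    show "\<forall>\<^sub>F i in F. \<bar>L2_norm (h i) - L2_norm f\<bar> \<le> L2_dist (h i) f"
      by (intro always_eventually allI L2_norm_triangle_abs L2_tendstoD[OF assms])
  qed auto
  then have "((\<lambda>i. L2_norm (h i) - L2_norm f) \<longlongrightarrow> 0) F"
    by (rule tendsto_rabs_zero_cancel)
  then show ?thesis by (rule LIM_zero_cancel)
qed

lemma L2_tendsto_cong_AE: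
  assumes "L2_tendsto h f F" "AE x in lebesgue. f x = g x"
  shows "L2_tendsto h g F"
proof -
  have "L2_dist (h i) f = L2_dist (h i) g" for i
    by (rule L2_norm_cong_AE)
       (use assms(2) L2_measurable[OF L2_diff[OF L2_tendstoD(1,2)[OF assms(1)]]] in auto)
  then show ?thesis
    using assms L2_cong_AE[OF L2_tendstoD(2)[OF assms(1)] assms(2)] by (simp add: L2_tendsto_def)
qed

lemma L2_tendsto_unique:
  assumes "L2_tendsto h f F" "L2_tendsto h g F" "F \<noteq> bot"
  shows "AE x in lebesgue. f x = g x"
proof -
  note D = L2_tendstoD[OF assms(1)] L2_tendstoD[OF assms(2)]
  have "((\<lambda>i. L2_dist (h i) f + L2_dist (h i) g) \<longlongrightarrow> 0 + 0) F"
    by (intro tendsto_intros D)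
  moreover have "\<forall>\<^sub>F i in F. L2_dist f g \<le> L2_dist (h i) f + L2_dist (h i) g"
  proof (intro always_eventually allI)
    show "L2_dist f g \<le> L2_dist (h i) f + L2_dist (h i) g" for i
      using L2_triangle_dist[OF D(2) D(1)[of i] D(5)] L2_norm_minus_commute[of f "h i"] by simp
  qed
  ultimately have "L2_dist f g \<le> 0 + 0"
    by (intro tendsto_lowerbound[OF _ _ assms(3)])
  then have "L2_dist f g = 0"
    using L2_norm_nonneg[of "\<lambda>x. f x - g x"] by linarith
  then show ?thesis using L2_dist_eq_0_iff[OF D(2,5)] by blast
qed

lemma L2_tendsto_add:
  assumes "L2_tendsto h f F" "L2_tendsto k g F"
  shows "L2_tendsto (\<lambda>i x. h i x + k i x) (\<lambda>x. f x + g x) F"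
proof (rule L2_tendsto_if_dist_le)
  note D = L2_tendstoD[OF assms(1)] L2_tendstoD[OF assms(2)]
  show "(\<lambda>x. h i x + k i x) \<in> L2" for i by (rule L2_add[OF D(1,4)])
  show "(\<lambda>x. f x + g x) \<in> L2" by (rule L2_add[OF D(2,5)])
  show "((\<lambda>i. L2_dist (h i) f + L2_dist (k i) g) \<longlongrightarrow> 0) F"
    by (rule tendsto_add_zero[OF D(3,6)])
  have "L2_norm (\<lambda>x. h i x + k i x - (f x + g x)) \<le> L2_dist (h i) f + L2_dist (k i) g" for i
    using L2_triangle[OF L2_diff[OF D(1,2)] L2_diff[OF D(4,5)], of i i] by (simp only: add_diff_add)
  then show "\<forall>\<^sub>F i in F. L2_norm (\<lambda>x. h i x + k i x - (f x + g x)) \<le> L2_dist (h i) f + L2_dist (k i) g"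
    by (rule always_eventually[OF allI])
qed

lemma L2_tendsto_cmult:
  assumes "L2_tendsto h f F"
  shows "L2_tendsto (\<lambda>i x. c * h i x) (\<lambda>x. c * f x) F"
proof -
  note D = L2_tendstoD[OF assms(1)]
  have "((\<lambda>i. cmod c * L2_dist (h i) f) \<longlongrightarrow> cmod c * 0) F"
    by (intro tendsto_intros D)
  then show ?thesis using L2_cmult[OF D(1)] L2_cmult[OF D(2)]
    by (simp add: L2_tendsto_def flip: L2_norm_cmult right_diff_distrib)
qed

lemma L2_tendsto_dominated:
  fixes h :: "nat \<Rightarrow> real \<Rightarrow> complex"
  assumes "\<And>k. h k \<in> Lmeas" "f \<in> Lmeas" "G \<in> L2"
    and "AE x in lebesgue. (\<lambda>k. h k x) \<longlonglongrightarrow> f x"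
    and le: "\<And>k. AE x in lebesgue. cmod (h k x) \<le> cmod (G x)"
  shows "L2_tendsto h f sequentially"
proof -
  note [measurable] = assms(1,2)
  have hL: "h k \<in> L2" for k
    by (rule L2_dominated[OF assms(3) assms(1), where C=1]) (use le in auto)
  have "AE x in lebesgue. \<forall>k. cmod (h k x) \<le> cmod (G x)"
    using le by (simp add: AE_all_countable)
  with assms(4) have fb: "AE x in lebesgue. cmod (f x) \<le> cmod (G x)"
  proof eventually_elim
    case (elim x)
    then show ?case
      by (intro LIMSEQ_le_const2[OF tendsto_norm[OF elim(1)]]) auto
  qed
  have fL: "f \<in> L2"
    by (rule L2_dominated[OF assms(3) assms(2), where C=1]) (use fb in auto)
  have "(\<lambda>k. LINT x|lebesgue. (cmod (h k x - f x))\<^sup>2) \<longlonglongrightarrow> integral\<^sup>L lebesgue (\<lambda>x::real. 0::real)"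
  proof (rule integral_dominated_convergence[where s="\<lambda>k x. (cmod (h k x - f x))\<^sup>2" and f="\<lambda>x. 0" and w="\<lambda>x. 4 * (cmod (G x))\<^sup>2"])
    show "integrable lebesgue (\<lambda>x. 4 * (cmod (G x))\<^sup>2)"
      using L2_integrable[OF assms(3)] by simp
    show "AE x in lebesgue. (\<lambda>k. (cmod (h k x - f x))\<^sup>2) \<longlonglongrightarrow> 0"
      using assms(4)
    proof eventually_elim
      case (elim x)
      have "(\<lambda>k. (cmod (h k x - f x))\<^sup>2) \<longlonglongrightarrow> (cmod (f x - f x))\<^sup>2"
        by (intro tendsto_intros elim)
      then show ?case by simp
    qed
    show "AE x in lebesgue. norm ((cmod (h k x - f x))\<^sup>2) \<le> 4 * (cmod (G x))\<^sup>2" for k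
      using le[of k] fb
    proof eventually_elim
      case (elim x)
      have "cmod (h k x - f x) \<le> 2 * cmod (G x)"
        using elim norm_triangle_ineq4[of "h k x" "f x"] by linarith
      then have "(cmod (h k x - f x))\<^sup>2 \<le> (2 * cmod (G x))\<^sup>2" by (intro power_mono) auto
      then show ?case by (simp add: power_mult_distrib)
    qed
  qed simp_all
  then have "(\<lambda>k. sqrt (LINT x|lebesgue. (cmod (h k x - f x))\<^sup>2)) \<longlonglongrightarrow> sqrt 0"
    by (intro tendsto_real_sqrt) simp
  then show ?thesis by (simp add: L2_tendsto_def hL fL L2_norm_def)
qed

abbreviation trunc :: "nat \<Rightarrow> (real \<Rightarrow> complex) \<Rightarrow> real \<Rightarrow> complex" where
  "trunc k f \<equiv> \<lambda>x. indicator {- real k..real k} x * f x"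

lemma trunc_tendsto: "(\<lambda>k. trunc k f x) \<longlonglongrightarrow> f x"
proof -
  obtain n where "\<bar>x\<bar> \<le> real n" using real_arch_simple by blast
  then have "\<forall>\<^sub>F k in sequentially. f x = trunc k f x"
    by (intro eventually_sequentiallyI[of n]) (auto simp: indicator_def)
  then show ?thesis by (rule Lim_transform_eventually[OF tendsto_const])
qed

lemma L2_truncate:
  assumes "f \<in> L2"
  shows "L2_tendsto (\<lambda>k. trunc k f) f sequentially"
proof (rule L2_tendsto_dominated[OF _ L2_measurable[OF assms] assms])
  note [measurable] = L2_measurable[OF assms]
  show "trunc k f \<in> Lmeas" for k
    by (intro borel_measurable_times borel_measurable_indicator) auto
  show "AE x in lebesgue. (\<lambda>k. trunc k f x) \<longlonglongrightarrow> f x" by (intro AE_I2 trunc_tendsto)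
qed (auto simp: indicator_def)

text \<open>Closed balls of \<open>L2\<close> are stable under pointwise limits, by Fatou's lemma
  for the squared distances to the centre \<open>g\<close>. The bound is needed only from an index
  \<open>N\<close> on, so the sequence is shifted by \<open>N\<close> before the lower limit is
  taken.\<close>

lemma L2_Fatou:
  fixes h :: "nat \<Rightarrow> real \<Rightarrow> complex"
  assumes h: "\<And>k. h k \<in> L2" and f[measurable]: "f \<in> Lmeas" and g: "g \<in> L2"
    and lim: "AE x in lebesgue. (\<lambda>k. h k x) \<longlonglongrightarrow> f x"
    and le: "\<And>k. k \<ge> N \<Longrightarrow> L2_dist (h k) g \<le> c"
  shows "f \<in> L2" "L2_dist f g \<le> c"
proof -
  note [measurable] = L2_measurable[OF h] L2_measurable[OF g]
  have c0: "0 \<le> c" using le[of N] L2_norm_nonneg[of "\<lambda>x. h N x - g x"] by simp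
  have "(\<integral>\<^sup>+x. esq (f x - g x) \<partial>lebesgue)
      = (\<integral>\<^sup>+x. liminf (\<lambda>k. esq (h (k + N) x - g x)) \<partial>lebesgue)"
  proof (rule nn_integral_cong_AE, use lim in eventually_elim)
    case (elim x)
    have "(\<lambda>k. h (k + N) x) \<longlonglongrightarrow> f x" using elim by (rule LIMSEQ_ignore_initial_segment)
    then have "(\<lambda>k. esq (h (k + N) x - g x)) \<longlonglongrightarrow> esq (f x - g x)"
      by (intro tendsto_ennrealI tendsto_power tendsto_norm tendsto_diff tendsto_const)
    then show ?case by (rule lim_imp_Liminf[OF sequentially_bot, symmetric])
  qed
  also have "\<dots> \<le> liminf (\<lambda>k. \<integral>\<^sup>+x. esq (h (k + N) x - g x) \<partial>lebesgue)"
    by (rule nn_integral_liminf) measurable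
  also have "\<dots> \<le> liminf (\<lambda>k. ennreal (c\<^sup>2))"
  proof (rule Liminf_mono, rule always_eventually, rule allI)
    fix k
    have "(L2_norm (\<lambda>x. h (k + N) x - g x))\<^sup>2 \<le> c\<^sup>2"
      by (intro power_mono le L2_norm_nonneg) simp
    then show "(\<integral>\<^sup>+x. esq (h (k + N) x - g x) \<partial>lebesgue) \<le> ennreal (c\<^sup>2)"
      by (simp add: nn_eq_L2_norm L2_diff h g ennreal_leI)
  qed
  also have "\<dots> = ennreal (c\<^sup>2)" by (simp add: Liminf_const)
  finally have *: "(\<integral>\<^sup>+x. esq (f x - g x) \<partial>lebesgue) \<le> ennreal (c\<^sup>2)" .
  then have d: "(\<lambda>x. f x - g x) \<in> L2"
    unfolding L2_iff_nn by (auto intro: le_less_trans[OF _ ennreal_less_top])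
  from L2_add[OF this g] show "f \<in> L2" by simp
  have "(L2_dist f g)\<^sup>2 \<le> c\<^sup>2"
    using * unfolding nn_eq_L2_norm[OF d] by (subst (asm) ennreal_le_iff) auto
  then show "L2_dist f g \<le> c"
    using c0 power2_le_imp_le by blast
qed

text \<open>Summable terms are bounded, so the weight \<open>2 ^ k\<close> forces increments of
  order \<open>(1/2) ^ k\<close> and the telescoping series converges absolutely. The squares fit
  integrals of squared norms, to which monotone summation applies directly.\<close>

lemma convergent_if_weighted_square_summable:
  fixes z :: "nat \<Rightarrow> complex"
  assumes "(\<Sum>k. ennreal ((2 ^ k * cmod (z (Suc k) - z k))\<^sup>2)) \<noteq> \<infinity>"
  shows "convergent z"
proof -
  define t where "t k = (2 ^ k * cmod (z (Suc k) - z k))\<^sup>2" for k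
  have "summable t"
  proof (rule summable_suminf_not_top)
    show "(\<Sum>k. ennreal (t k)) \<noteq> top" using assms by (simp add: t_def)
  qed (simp add: t_def)
  then have "Bseq t" by (rule convergent_imp_Bseq[OF convergentI[OF summable_LIMSEQ_zero]])
  then obtain C where C: "C > 0" "\<And>k. norm (t k) \<le> C" unfolding Bseq_def by blast
  have "cmod (z (Suc k) - z k) \<le> sqrt C * (1/2) ^ k" for k
  proof -
    have "(2 ^ k * cmod (z (Suc k) - z k))\<^sup>2 \<le> C"
      using C(2)[of k] by (simp add: t_def)
    then have "2 ^ k * cmod (z (Suc k) - z k) \<le> sqrt C"
      by (rule real_le_rsqrt)
    then show ?thesis by (simp add: power_one_over pos_le_divide_eq mult.commute)
  qed
  moreover have "summable (\<lambda>k. sqrt C * (1/2) ^ k)"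
    by (intro summable_mult summable_geometric) simp
  ultimately have "summable (\<lambda>k. z (Suc k) - z k)"
    using summable_comparison_test'[of "\<lambda>k. sqrt C * (1/2) ^ k" 0 "\<lambda>k. z (Suc k) - z k"] by blast
  then have "convergent (\<lambda>n. \<Sum>k<n. z (Suc k) - z k)" by (simp add: summable_iff_convergent)
  then have "convergent (\<lambda>n. z n - z 0)" by (simp add: sum_lessThan_telescope)
  then show ?thesis using convergent_add[OF _ convergent_const[of "z 0"], of "\<lambda>n. z n - z 0"] by simp
qed

text \<open>The Riesz-Fischer argument: a rapidly Cauchy subsequence converges almost everywhere,
  and Fatou's lemma shows that its limit is an \<open>L2\<close> limit of the whole
  sequence.\<close>

lemma L2_complete:
  fixes h :: "nat \<Rightarrow> real \<Rightarrow> complex"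
  assumes h: "\<And>k. h k \<in> L2"
    and cau: "\<And>e. 0 < e \<Longrightarrow> \<exists>N. \<forall>m\<ge>N. \<forall>n\<ge>N. L2_dist (h m) (h n) \<le> e"
  shows "\<exists>f. L2_tendsto h f sequentially"
proof -
  note [measurable] = L2_measurable[OF h]
  \<comment> \<open>The rate \<open>1/4\<close> leaves \<open>(1/2) ^ k\<close> after multiplication
    by the weight \<open>2 ^ k\<close>.\<close>
  obtain N where N: "\<And>k m n. m \<ge> N k \<Longrightarrow> n \<ge> N k \<Longrightarrow> L2_dist (h m) (h n) \<le> (1/4) ^ k"
    using cau[of "(1/4) ^ k" for k] by (metis zero_less_power zero_less_divide_1_iff zero_less_numeral)
  \<comment> \<open>The maximum puts \<open>r k\<close> beyond every \<open>N j\<close> with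
    \<open>j \<le> k\<close>, although \<open>N\<close> itself need not be monotone.\<close>
  define r where "r k = Max (N ` {..k}) + k" for k
  have rN: "N j \<le> r k" if "j \<le> k" for j k
    unfolding r_def using Max_ge[of "N ` {..k}" "N j"] that by (intro trans_le_add1) auto
  have rk: "k \<le> r k" for k by (simp add: r_def)
  define d where "d k x = h (r (Suc k)) x - h (r k) x" for k x
  have dL: "d k \<in> L2" for k unfolding d_def by (intro L2_diff h)
  note [measurable] = L2_measurable[OF dL]
  have "(\<integral>\<^sup>+x. (\<Sum>k. ennreal ((2 ^ k * cmod (d k x))\<^sup>2)) \<partial>lebesgue)
      = (\<Sum>k. \<integral>\<^sup>+x. ennreal ((2 ^ k * cmod (d k x))\<^sup>2) \<partial>lebesgue)"
    by (rule nn_integral_suminf) measurable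
  also have "\<dots> \<le> (\<Sum>k. ennreal ((1/2) ^ k))"
  proof (intro suminf_le allI summableI)
    fix k
    have "2 ^ k * L2_norm (d k) \<le> 2 ^ k * (1/4) ^ k"
      unfolding d_def by (intro mult_left_mono N rN) auto
    also have "\<dots> = (1/2) ^ k" by (simp flip: power_mult_distrib)
    finally have "(2 ^ k * L2_norm (d k))\<^sup>2 \<le> ((1/2) ^ k)\<^sup>2"
      by (intro power_mono) (simp_all add: L2_norm_nonneg)
    also have "\<dots> \<le> (1/2) ^ k" by (simp add: power2_eq_square mult_le_one power_le_one mult_left_le)
    finally have "ennreal ((2 ^ k)\<^sup>2) * ennreal ((L2_norm (d k))\<^sup>2) \<le> ennreal ((1/2) ^ k)"
      by (simp add: ennreal_leI power_mult_distrib flip: ennreal_mult)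
    then show "(\<integral>\<^sup>+x. ennreal ((2 ^ k * cmod (d k x))\<^sup>2) \<partial>lebesgue) \<le> ennreal ((1/2) ^ k)"
      by (simp add: power_mult_distrib ennreal_mult nn_integral_cmult nn_eq_L2_norm[OF dL])
  qed
  also have "\<dots> = ennreal (\<Sum>k. (1/2) ^ k)" by (intro suminf_ennreal2) auto
  also have "\<dots> < \<infinity>" by simp
  finally have "AE x in lebesgue. (\<Sum>k. ennreal ((2 ^ k * cmod (d k x))\<^sup>2)) \<noteq> \<infinity>"
    by (intro nn_integral_PInf_AE) auto
  then have conv: "AE x in lebesgue. convergent (\<lambda>k. h (r k) x)"
    by eventually_elim (rule convergent_if_weighted_square_summable, simp add: d_def)
  define f where "f x = lim (\<lambda>k. h (r k) x)" for x
  have f[measurable]: "f \<in> Lmeas"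
    unfolding f_def by (rule borel_measurable_lim_metric) measurable
  have lim: "AE x in lebesgue. (\<lambda>k. h (r k) x) \<longlonglongrightarrow> f x"
    using conv by eventually_elim (simp add: f_def convergent_LIMSEQ_iff)
  \<comment> \<open>Here \<open>n\<close> runs over the full sequence and only the index of the
    other term passes to the limit along \<open>r\<close>; this gives convergence beyond the
    subsequence.\<close>
  have tail: "f \<in> L2 \<and> L2_dist (h n) f \<le> (1/4) ^ k" if n: "n \<ge> N k" for n k
  proof -
    have le: "L2_norm (\<lambda>x. h (r j) x - h n x) \<le> (1/4) ^ k" if "j \<ge> k" for j
      by (intro N n rN that)
    show ?thesis
      using L2_Fatou[where h="\<lambda>k. h (r k)", OF h f h lim le] L2_norm_minus_commute[of f "h n"] by simp
  qed
  have "(\<lambda>n. L2_dist (h n) f) \<longlonglongrightarrow> 0"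
  proof (rule LIMSEQ_I)
    fix e :: real assume "0 < e"
    then obtain k where "(1/4) ^ k < e" using real_arch_pow_inv[of e "1/4"] by auto
    then show "\<exists>n0. \<forall>n\<ge>n0. norm (L2_dist (h n) f - 0) < e"
      using tail[of k] L2_norm_nonneg by (intro exI[of _ "N k"]) (auto intro: le_less_trans)
  qed
  then show ?thesis using tail[of 0] h by (auto simp: L2_tendsto_def)
qed

lemma nn_integral_count_space_ge_sum:
  fixes f :: "'i::countable \<Rightarrow> ennreal"
  assumes "finite S"
  shows "(\<Sum>i\<in>S. f i) \<le> (NNSUM i. f i)"
proof -
  have "(\<Sum>i\<in>S. f i) = (NNSUM i. f i * indicator S i)"
    using assms by (simp add: nn_integral_count_space_finite flip: nn_integral_count_space_indicator)
  also have "\<dots> \<le> (NNSUM i. f i)"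
    by (intro nn_integral_mono) (simp add: indicator_def)
  finally show ?thesis .
qed

lemma nn_integral_count_space_int_le:
  fixes f :: "int \<Rightarrow> ennreal"
  assumes "\<And>S. finite S \<Longrightarrow> (\<Sum>i\<in>S. f i) \<le> C"
  shows "(NNSUM i. f i) \<le> C"
  unfolding infsum_ennreal_eq_nn_integral[OF infinite_UNIV_int, symmetric]
  by (intro infsum_le_finite_sums nonneg_summable_on_complete) (auto intro: assms)

subsection \<open>Parseval's identity for Fourier series\<close>

text \<open>The exponent is positive because translation by \<open>n * a\<close> multiplies a
  transform by \<open>cis (- 2 * pi * n * a * y)\<close>, and the inner product conjugates this
  factor. The characters have the common period \<open>1/a\<close>.\<close>

definition echar :: "real \<Rightarrow> int \<Rightarrow> real \<Rightarrow> complex" where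
  "echar a n x = cis (2 * pi * a * of_int n * x)"

lemma norm_echar [simp]: "cmod (echar a n x) = 1"
  by (simp add: echar_def)

lemma echar_measurable [measurable]: "echar a n \<in> Lmeas"
  unfolding echar_def
  by (intro measurable_completion) (auto intro!: borel_measurable_continuous_onI continuous_intros)

lemma echar_mult: "echar a n x * echar a m x = echar a (n + m) x"
  by (simp add: echar_def cis_mult algebra_simps)

lemma cnj_echar: "cnj (echar a n x) = echar a (- n) x"
  by (simp add: echar_def cis_cnj)

lemma integral_echar:
  assumes a: "a > 0"
  shows "(LINT x|lebesgue. indicator {s..s + 1/a} x * echar a k x) = (if k = 0 then of_real (1/a) else 0)"
proof (cases "k = 0")
  case True
  have "(LINT x|lebesgue. indicator {s..s + 1/a} x * echar a k x)
      = (LINT x|lebesgue. complex_of_real (indicator {s..s + 1/a} x))"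
    using True by (intro Bochner_Integration.integral_cong) (auto simp: echar_def indicator_def)
  also have "\<dots> = of_real (LINT x|lebesgue. indicator {s..s + 1/a} x)"
    by (rule integral_complex_of_real)
  also have "(LINT x|lebesgue. indicator {s..s + 1/a} x) = 1/a" using a by simp
  finally show ?thesis using True by simp
next
  case False
  define c where "c = 2 * pi * a * of_int k"
  have c0: "c \<noteq> 0" using False a by (simp add: c_def)
  define G where "G x = cis (c * x) / (\<i> * of_real c)" for x
  have "has_bochner_integral lborel (\<lambda>x. indicator {s..s + 1/a} x *\<^sub>R echar a k x) (G (s + 1/a) - G s)"
  proof (rule has_bochner_integral_FTC_Icc)
    show "s \<le> s + 1/a" using a by simp
    show "(G has_vector_derivative echar a k x) (at x within {s..s + 1/a})" for x
      unfolding G_def echar_def c_def[symmetric] cis_conv_exp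
      using c0 by (auto intro!: derivative_eq_intros has_vector_derivative_real_field simp: field_simps)
    show "continuous_on {s..s + 1/a} (echar a k)"
      unfolding echar_def by (intro continuous_intros)
  qed
  then have "(LINT x|lborel. indicator {s..s + 1/a} x *\<^sub>R echar a k x) = G (s + 1/a) - G s"
    by (rule has_bochner_integral_integral_eq)
  also have "(LINT x|lborel. indicator {s..s + 1/a} x *\<^sub>R echar a k x)
      = (LINT x|lebesgue. indicator {s..s + 1/a} x *\<^sub>R echar a k x)"
    by (rule integral_completion[symmetric])
       (unfold echar_def measurable_lborel2, intro borel_measurable_scaleR borel_measurable_indicator
         borel_measurable_continuous_onI continuous_intros, simp)
  also have "\<dots> = (LINT x|lebesgue. indicator {s..s + 1/a} x * echar a k x)"
    by (intro Bochner_Integration.integral_cong) (auto simp: indicator_def)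
  also have "G (s + 1/a) - G s = 0"
  proof -
    have "c * (s + 1/a) = c * s + 2 * pi * of_int k" using a by (simp add: c_def field_simps)
    then have "cis (c * (s + 1/a)) = cis (c * s)" by (simp add: cis_mult[symmetric] cis_multiple_2pi)
    then show ?thesis by (simp add: G_def)
  qed
  finally show ?thesis using False by simp
qed

lemma L2_bounded_on_interval:
  assumes "g \<in> Lmeas" "\<And>x. cmod (g x) \<le> M"
  shows "(\<lambda>x. indicator {s..t::real} x * g x) \<in> L2"
proof -
  have i: "indicator {s..t} \<in> L2"
  proof -
    have "(\<lambda>x. (cmod (indicator {s..t} x :: complex))\<^sup>2) = indicator {s..t::real}"
      by (auto simp: indicator_def fun_eq_iff)
    moreover have "integrable lebesgue (indicat_real {s..t})"
      by (rule integrable_real_indicator) (auto simp: emeasure_lborel_Icc_eq)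
    ultimately show ?thesis by (simp add: L2_def borel_measurable_indicator)
  qed
  show ?thesis
    using L2_bounded_mult[OF i assms(1), of M] assms(2) by (simp add: mult.commute)
qed

lemma echar_on_L2: "(\<lambda>x. indicator {s..t} x * echar a n x) \<in> L2"
  by (rule L2_bounded_on_interval[where M=1]) auto

abbreviation cut :: "real \<Rightarrow> real \<Rightarrow> (real \<Rightarrow> complex) \<Rightarrow> real \<Rightarrow> complex" where
  "cut a s f \<equiv> \<lambda>x. indicator {s..s + 1/a} x * f x"

lemma L2_inner_echar:
  assumes "a > 0"
  shows "L2_inner (cut a s (echar a n)) (cut a s (echar a m))
    = (if n = m then of_real (1/a) else 0)"
proof -
  have "L2_inner (cut a s (echar a n)) (cut a s (echar a m))
      = (LINT x|lebesgue. indicator {s..s + 1/a} x * echar a (n - m) x)"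
    unfolding L2_inner_def
    by (intro Bochner_Integration.integral_cong)
       (auto simp: indicator_def cnj_echar echar_mult)
  then show ?thesis using integral_echar[OF assms, of s "n - m"] by simp
qed

text \<open>Completing the square for an orthogonal system whose members have squared norm
  \<open>1/a\<close>. The best coefficients are \<open>a\<close> times the inner products; inserting
  them yields Bessel's inequality, while for arbitrary coefficients the last sum can only increase
  the distance.\<close>

lemma L2_norm_diff_trig_poly:
  fixes s :: real
  assumes a: "a > 0" and F: "F \<in> L2" and S: "finite S"
  defines "E \<equiv> \<lambda>n. cut a s (echar a n)"
  shows "(L2_norm (\<lambda>x. F x - (\<Sum>n\<in>S. p n * E n x)))\<^sup>2
    = (L2_norm F)\<^sup>2 - a * (\<Sum>n\<in>S. (cmod (L2_inner F (E n)))\<^sup>2)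
      + (\<Sum>n\<in>S. (cmod (p n - of_real a * L2_inner F (E n)))\<^sup>2) / a"
proof -
  have E: "E n \<in> L2" for n unfolding E_def by (rule echar_on_L2)
  define T where "T x = (\<Sum>n\<in>S. p n * E n x)" for x
  have pE: "(\<lambda>x. p n * E n x) \<in> L2" for n by (intro L2_cmult E)
  have T: "T \<in> L2" unfolding T_def by (intro L2_sum pE)
  define c where "c n = L2_inner F (E n)" for n
  have TE: "L2_inner T (E m) = (if m \<in> S then p m / of_real a else 0)" for m
  proof -
    have "L2_inner T (E m) = (\<Sum>n\<in>S. p n * L2_inner (E n) (E m))"
      unfolding T_def by (simp add: L2_inner_sum_left[OF pE E] L2_inner_cmult_left)
    also have "\<dots> = (\<Sum>n\<in>S. if n = m then p n / of_real a else 0)"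
      unfolding E_def by (intro sum.cong) (simp_all add: L2_inner_echar[OF a])
    finally show ?thesis using S by simp
  qed
  have inner_T: "L2_inner G T = (\<Sum>n\<in>S. cnj (p n) * L2_inner G (E n))" if G: "G \<in> L2" for G
  proof -
    have "L2_inner T G = (\<Sum>n\<in>S. p n * L2_inner (E n) G)"
      unfolding T_def by (simp add: L2_inner_sum_left[OF pE G] L2_inner_cmult_left)
    then have "cnj (L2_inner T G) = (\<Sum>n\<in>S. cnj (p n) * cnj (L2_inner (E n) G))" by simp
    then show ?thesis by (simp only: L2_inner_commute[symmetric])
  qed
  have "L2_inner T T = (\<Sum>n\<in>S. of_real ((cmod (p n))\<^sup>2 / a))"
    unfolding inner_T[OF T]
    using TE by (intro sum.cong) (simp_all add: complex_norm_square mult.commute del: of_real_power)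
  then have "of_real ((L2_norm T)\<^sup>2) = (of_real (\<Sum>n\<in>S. (cmod (p n))\<^sup>2 / a) :: complex)"
    by (simp only: L2_inner_self[OF T] of_real_sum)
  then have nT: "(L2_norm T)\<^sup>2 = (\<Sum>n\<in>S. (cmod (p n))\<^sup>2 / a)" by (simp only: of_real_eq_iff)
  have "(cmod (p n - of_real a * c n))\<^sup>2 / a
      = (cmod (p n))\<^sup>2 / a - 2 * Re (cnj (p n) * c n) + a * (cmod (c n))\<^sup>2" for n
    unfolding cmod_power2 using a by (simp add: power2_eq_square field_simps)
  then have "(\<Sum>n\<in>S. (cmod (p n - of_real a * c n))\<^sup>2) / a
      = (\<Sum>n\<in>S. (cmod (p n))\<^sup>2 / a) - 2 * Re (\<Sum>n\<in>S. cnj (p n) * c n) + a * (\<Sum>n\<in>S. (cmod (c n))\<^sup>2)"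
    by (simp add: sum_divide_distrib sum.distrib sum_subtractf sum_distrib_left)
  then show ?thesis
    using L2_norm_diff_sq[OF F T] nT inner_T[OF F] unfolding T_def c_def[symmetric] by simp
qed

section \<open>Density of trigonometric polynomials in \<open>L2\<close> of one period\<close>

inductive_set trig_poly :: "real \<Rightarrow> (real \<Rightarrow> complex) set" for a where
  zero: "(\<lambda>x. 0) \<in> trig_poly a"
| add_term: "f \<in> trig_poly a \<Longrightarrow> (\<lambda>x. f x + c * echar a n x) \<in> trig_poly a"

lemma trig_poly_add:
  assumes "f \<in> trig_poly a" "g \<in> trig_poly a"
  shows "(\<lambda>x. f x + g x) \<in> trig_poly a"
  using assms(2)
proof induction
  case (add_term g c n)
  then show ?case using trig_poly.add_term[of "\<lambda>x. f x + g x" a c n] by (simp add: add.assoc)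
qed (simp add: assms)

lemma trig_poly_term: "(\<lambda>x. c * echar a n x) \<in> trig_poly a"
  using trig_poly.add_term[OF trig_poly.zero] by simp

lemma trig_poly_const: "(\<lambda>x. c) \<in> trig_poly a"
  using trig_poly_term[of c a 0] by (simp add: echar_def)

lemma trig_poly_mult_term:
  assumes "f \<in> trig_poly a"
  shows "(\<lambda>x. f x * (c * echar a n x)) \<in> trig_poly a"
  using assms
proof induction
  case (add_term f d m)
  have "(f x + d * echar a m x) * (c * echar a n x) = f x * (c * echar a n x) + d * c * echar a (m + n) x" for x
    by (simp add: algebra_simps flip: echar_mult)
  then show ?case using trig_poly.add_term[OF add_term(2), of "d * c" "m + n"] by simp
qed (simp add: trig_poly.zero)

lemma trig_poly_mult:
  assumes "f \<in> trig_poly a" "g \<in> trig_poly a"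
  shows "(\<lambda>x. f x * g x) \<in> trig_poly a"
  using assms(2)
proof induction
  case (add_term g c n)
  then show ?case
    using trig_poly_add[OF add_term(2) trig_poly_mult_term[OF assms(1), of c n]]
    by (simp add: distrib_left)
qed (simp add: trig_poly.zero)

text \<open>The inductive description makes closure under products a rule induction; here explicit
  coefficients are recovered for Parseval's identity. A frequency may be added repeatedly, so
  \<open>q\<close> accumulates the coefficients.\<close>

lemma trig_poly_sum:
  assumes "f \<in> trig_poly a"
  obtains S p where "finite S" "\<And>x. f x = (\<Sum>n\<in>S. p n * echar a n x)"
proof -
  have "\<exists>S p. finite S \<and> (\<forall>x. f x = (\<Sum>n\<in>S. p n * echar a n x))"
    using assms
  proof induction
    case zero
    show ?case by (rule exI[of _ "{}"]) simp
  next
    case (add_term f c n)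
    then obtain S p where S: "finite S" "\<And>x. f x = (\<Sum>n\<in>S. p n * echar a n x)" by blast
    define q where "q m = (if m \<in> S then p m else 0) + (if m = n then c else 0)" for m
    have "f x + c * echar a n x = (\<Sum>m\<in>insert n S. q m * echar a m x)" for x
    proof -
      have "(\<Sum>m\<in>insert n S. q m * echar a m x)
         = (\<Sum>m\<in>insert n S. (if m \<in> S then p m * echar a m x else 0)) + (\<Sum>m\<in>insert n S. if m = n then c * echar a m x else 0)"
        unfolding q_def by (subst sum.distrib[symmetric]) (intro sum.cong, auto simp: algebra_simps)
      also have "(\<Sum>m\<in>insert n S. (if m \<in> S then p m * echar a m x else 0)) = f x"
        unfolding S(2) using S(1) by (intro sum.mono_neutral_cong_right) auto
      finally show ?thesis using S(1) by simp
    qed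
    then show ?case using S(1) by (intro exI[of _ "insert n S"] exI[of _ q]) auto
  qed
  then show thesis using that by blast
qed

text \<open>A real-linear functional on the complex plane is a combination of \<open>z\<close> and
  \<open>cnj z\<close>, which on the circle are the characters of index 1 and -1 up to the phase
  caused by \<open>s\<close>. Constants, sums and products then follow from the algebra
  structure.\<close>

lemma trig_poly_real_polynomial:
  assumes "real_polynomial_function g"
  shows "(\<lambda>x. complex_of_real (g (cis (2 * pi * a * (x - s))))) \<in> trig_poly a"
  using assms
proof induction
  case (linear f)
  interpret bounded_linear f by fact
  have e: "cis (2 * pi * a * (x - s)) = cis (- 2 * pi * a * s) * echar a 1 x"
    "cnj (cis (2 * pi * a * (x - s))) = cis (2 * pi * a * s) * echar a (-1) x" for x
    by (simp_all add: echar_def cis_mult cis_cnj algebra_simps)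
  have zz: "of_real (f z) = of_real (f 1) * ((z + cnj z) / 2) + of_real (f \<i>) * ((z - cnj z) / (2 * \<i>))" for z
  proof -
    have "f z = f (Re z *\<^sub>R 1 + Im z *\<^sub>R \<i>)"
      by (rule arg_cong[where f=f]) (simp add: complex_eq_iff)
    also have "\<dots> = Re z * f 1 + Im z * f \<i>" by (simp add: add scaleR)
    finally show ?thesis by (simp add: complex_eq_iff)
  qed
  have "complex_of_real (f (cis (2 * pi * a * (x - s)))) =
      ((of_real (f 1) / 2 + of_real (f \<i>) / (2 * \<i>)) * cis (- 2 * pi * a * s)) * echar a 1 x
      + ((of_real (f 1) / 2 - of_real (f \<i>) / (2 * \<i>)) * cis (2 * pi * a * s)) * echar a (-1) x" for x
    by (subst zz, unfold e(2), unfold e(1)) (simp add: algebra_simps add_divide_distrib diff_divide_distrib)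
  then show ?case by (simp only:) (intro trig_poly_add trig_poly_term)
qed (auto intro: trig_poly_const trig_poly_add trig_poly_mult)


text \<open>The Stone-Weierstrass theorem on the unit circle, applied separately to real and
  imaginary part.\<close>

lemma trig_poly_approx_continuous_periodic:
  fixes h :: "complex \<Rightarrow> complex"
  assumes "continuous_on (sphere 0 1) h" "0 < e"
  obtains t where "t \<in> trig_poly a" "\<And>x. cmod (h (cis (2 * pi * a * (x - s))) - t x) < e"
proof -
  obtain g1 where g1: "real_polynomial_function g1" "\<And>z. z \<in> sphere 0 1 \<Longrightarrow> \<bar>Re (h z) - g1 z\<bar> < e / 2"
    using Stone_Weierstrass_real_polynomial_function[of "sphere 0 1" "\<lambda>z. Re (h z)" "e/2"] assms
    by (auto intro: continuous_on_Re)
  obtain g2 where g2: "real_polynomial_function g2" "\<And>z. z \<in> sphere 0 1 \<Longrightarrow> \<bar>Im (h z) - g2 z\<bar> < e / 2"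
    using Stone_Weierstrass_real_polynomial_function[of "sphere 0 1" "\<lambda>z. Im (h z)" "e/2"] assms
    by (auto intro: continuous_on_Im)
  define z where "z x = cis (2 * pi * a * (x - s))" for x
  show thesis
  proof
    show "(\<lambda>x. of_real (g1 (z x)) + \<i> * of_real (g2 (z x))) \<in> trig_poly a"
      unfolding z_def
      by (intro trig_poly_add trig_poly_mult trig_poly_const trig_poly_real_polynomial g1 g2)
    fix x
    have zs: "z x \<in> sphere 0 1" by (simp add: z_def)
    let ?d = "h (z x) - (of_real (g1 (z x)) + \<i> * of_real (g2 (z x)))"
    have "cmod ?d \<le> \<bar>Re ?d\<bar> + \<bar>Im ?d\<bar>" by (rule cmod_le)
    also have "\<dots> < e / 2 + e / 2" using g1(2)[OF zs] g2(2)[OF zs] by (intro add_strict_mono) auto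
    finally show "cmod (h (cis (2 * pi * a * (x - s))) - (of_real (g1 (z x)) + \<i> * of_real (g2 (z x)))) < e"
      by (simp add: z_def)
  qed
qed

lemma abs_min_1_le: "\<bar>min 1 y\<bar> \<le> \<bar>y\<bar>" for y :: real
  by (auto simp: min_def)

text \<open>Wrapping an interval around the circle glues its endpoints at 1, where
  \<open>Arg2pi\<close> jumps and \<open>g\<close> may take two different values. The cutoff factor
  vanishes at 1, and with \<open>g\<close> bounded this restores continuity there.\<close>

lemma continuous_on_circle_cutoff:
  fixes g :: "real \<Rightarrow> complex"
  assumes g: "continuous_on UNIV g" and M: "\<And>x. cmod (g x) \<le> M"
  shows "continuous_on (sphere 0 1) (\<lambda>z. of_real (min 1 (k * cmod (z - 1))) * g (s + b * Arg2pi z))"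
    (is "continuous_on _ ?h")
  unfolding continuous_on_eq_continuous_within
proof
  fix z :: complex assume z: "z \<in> sphere 0 1"
  show "continuous (at z within sphere 0 1) ?h"
  proof (cases "z = 1")
    case True
    have "(?h \<longlongrightarrow> 0) (at 1)"
    proof (rule tendsto_0_le[where K=1])
      have "((\<lambda>z. \<bar>k\<bar> * cmod (z - 1) * M) \<longlongrightarrow> \<bar>k\<bar> * cmod (1 - 1) * M) (at 1)"
        by (intro tendsto_intros)
      then show "((\<lambda>z. \<bar>k\<bar> * cmod (z - 1) * M) \<longlongrightarrow> 0) (at 1)" by simp
      have "norm (?h z) \<le> norm (\<bar>k\<bar> * cmod (z - 1) * M) * 1" for z
      proof -
        have "\<bar>min 1 (k * cmod (z - 1))\<bar> \<le> \<bar>k\<bar> * cmod (z - 1)"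
          using abs_min_1_le[of "k * cmod (z - 1)"] by (simp add: abs_mult)
        then have "\<bar>min 1 (k * cmod (z - 1))\<bar> * cmod (g (s + b * Arg2pi z)) \<le> \<bar>k\<bar> * cmod (z - 1) * M"
          by (intro mult_mono M) auto
        then show ?thesis by (simp add: norm_mult)
      qed
      then show "\<forall>\<^sub>F z in at 1. norm (?h z) \<le> norm (\<bar>k\<bar> * cmod (z - 1) * M) * 1"
        by (intro always_eventually allI)
    qed
    then have "continuous (at 1) ?h" by (simp add: continuous_at)
    then show ?thesis unfolding True by (rule continuous_at_imp_continuous_at_within)
  next
    case False
    have "z \<notin> \<real>\<^sub>\<ge>\<^sub>0"
      using False z by (auto simp: nonneg_Reals_def)
    then have A: "isCont Arg2pi z" by (rule continuous_at_Arg2pi)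
    have "isCont (\<lambda>z. g (s + b * Arg2pi z)) z"
      by (rule isCont_o2[where g=g]) (use A g in \<open>auto intro!: continuous_intros simp: continuous_on_eq_continuous_at\<close>)
    then have "isCont ?h z" by (intro continuous_intros)
    then show ?thesis by (rule continuous_at_imp_continuous_at_within)
  qed
qed

lemma Arg2pi_cis: "0 \<le> x \<Longrightarrow> x < 2 * pi \<Longrightarrow> Arg2pi (cis x) = x"
  by (rule Arg2pi_unique[of 1]) (auto simp: cis_conv_exp)

definition trig_approximable :: "real \<Rightarrow> real \<Rightarrow> (real \<Rightarrow> complex) \<Rightarrow> bool" where
  "trig_approximable a s F \<longleftrightarrow> (\<forall>e>0. \<exists>t\<in>trig_poly a.
     L2_dist F (cut a s t) \<le> e)"

lemma trig_poly_continuous: "t \<in> trig_poly a \<Longrightarrow> continuous_on UNIV t"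
  by (induction rule: trig_poly.induct) (auto intro!: continuous_intros simp: echar_def)

lemma trig_poly_on_L2: "t \<in> trig_poly a \<Longrightarrow> cut a s t \<in> L2"
proof (induction rule: trig_poly.induct)
  case (add_term f c n)
  then show ?case
    using L2_add[OF _ L2_cmult[OF echar_on_L2[of s "s + 1/a" a n], of c]]
    by (simp add: distrib_left mult.left_commute)
qed (simp add: L2_zero)

lemma trig_approximable_limit:
  assumes "L2_tendsto G F sequentially" "\<And>k::nat. trig_approximable a s (G k)"
  shows "trig_approximable a s F"
  unfolding trig_approximable_def
proof (intro allI impI)
  fix e :: real assume e: "0 < e"
  have "\<forall>\<^sub>F k in sequentially. L2_dist (G k) F < e/2"
    using L2_tendstoD(3)[OF assms(1)] e by (intro order_tendstoD) auto
  then obtain k where k: "L2_dist (G k) F < e/2" by (auto simp: eventually_sequentially)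
  obtain t where t: "t \<in> trig_poly a" "L2_dist (G k) (cut a s t) \<le> e/2"
    using assms(2)[of k] e unfolding trig_approximable_def by (metis half_gt_zero)
  show "\<exists>t\<in>trig_poly a. L2_dist F (cut a s t) \<le> e"
    using L2_triangle_dist[OF L2_tendstoD(2)[OF assms(1)] L2_tendstoD(1)[OF assms(1), of k] trig_poly_on_L2[OF t(1), of s]]
      k t L2_norm_minus_commute[of F "G k"]
    by (intro bexI[OF _ t(1)]) linarith
qed

lemma L2_norm_indicator_le:
  assumes "f \<in> Lmeas" "\<And>x. cmod (f x) \<le> C" "a > 0"
  shows "L2_norm (cut a s f) \<le> C * sqrt (1/a)"
proof -
  have C: "0 \<le> C" using assms(2)[of 0] norm_ge_zero order_trans by blast
  have "(LINT x|lebesgue. (cmod (indicator {s..s + 1/a} x * f x))\<^sup>2)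
      \<le> (LINT x|lebesgue. C\<^sup>2 * indicator {s..s + 1/a} x)"
  proof (rule integral_mono)
    show "integrable lebesgue (\<lambda>x. (cmod (indicator {s..s + 1/a} x * f x))\<^sup>2)"
      by (rule L2_integrable[OF L2_bounded_on_interval[OF assms(1,2)]])
    show "integrable lebesgue (\<lambda>x. C\<^sup>2 * indicator {s..s + 1/a} x)"
      by (intro integrable_mult_right integrable_real_indicator) (auto simp: emeasure_lborel_Icc_eq)
    show "(cmod (indicator {s..s + 1/a} x * f x))\<^sup>2 \<le> C\<^sup>2 * indicator {s..s + 1/a} x" for x
      using assms(2)[of x] by (auto simp: indicator_def intro: power_mono)
  qed
  also have "\<dots> = C\<^sup>2 * (1/a)" using assms(3) by simp
  finally have "L2_norm (cut a s f) \<le> sqrt (C\<^sup>2 * (1/a))"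
    unfolding L2_norm_def by (rule real_sqrt_le_mono)
  then show ?thesis using C by (simp only: real_sqrt_mult real_sqrt_abs abs_of_nonneg)
qed

lemma continuous_measurable_lebesgue:
  "continuous_on UNIV f \<Longrightarrow> f \<in> Lmeas" for f :: "real \<Rightarrow> 'a::topological_space"
  by (intro measurable_completion) (auto intro: borel_measurable_continuous_onI)

text \<open>After the cutoff the function lifts to a continuous function on the circle, where
  uniform approximation is possible; a uniform error on an interval of length \<open>1/a\<close>
  costs only the factor \<open>sqrt (1/a)\<close> in norm.\<close>

lemma trig_approximable_cutoff:
  fixes g :: "real \<Rightarrow> complex"
  assumes a: "a > 0" and g: "continuous_on UNIV g" and M: "\<And>x. cmod (g x) \<le> M"
  shows "trig_approximable a s (\<lambda>x. indicator {s..s + 1/a} x *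
    (of_real (min 1 (k * cmod (cis (2 * pi * a * (x - s)) - 1))) * g x))"
  unfolding trig_approximable_def
proof (intro allI impI)
  fix e :: real assume e: "0 < e"
  define z where "z x = cis (2 * pi * a * (x - s))" for x
  define h where "h z = of_real (min 1 (k * cmod (z - 1))) * g (s + 1 / (2 * pi * a) * Arg2pi z)" for z
  have "continuous_on (sphere 0 1) h"
    unfolding h_def by (rule continuous_on_circle_cutoff[OF g M])
  moreover have "0 < e / sqrt (1/a)" using e a by simp
  ultimately obtain t where t: "t \<in> trig_poly a" "\<And>x. cmod (h (z x) - t x) < e / sqrt (1/a)"
    unfolding z_def using trig_poly_approx_continuous_periodic by metis
  define w where "w x = of_real (min 1 (k * cmod (z x - 1))) * g x" for x
  have hw: "h (z x) = w x" if x: "x \<in> {s..s + 1/a}" for x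
  proof (cases "x = s + 1/a")
    case True
    \<comment> \<open>At the right endpoint \<open>Arg2pi (z x)\<close> is 0 instead of a full turn,
      so \<open>h\<close> evaluates \<open>g\<close> at \<open>s\<close>; the cutoff factor is 0 and
      hides the mismatch.\<close>
    then have "z x = 1" using a by (simp add: z_def)
    then show ?thesis by (simp add: h_def w_def)
  next
    case False
    then have "x - s < 1/a" using x by auto
    then have "a * (x - s) < 1" using a by (simp add: pos_less_divide_eq mult.commute)
    then have "2 * pi * (a * (x - s)) < 2 * pi * 1" by (intro mult_strict_left_mono) auto
    then have "2 * pi * a * (x - s) < 2 * pi" by (simp add: mult.assoc)
    then have "Arg2pi (z x) = 2 * pi * a * (x - s)"
      unfolding z_def using x a by (intro Arg2pi_cis) auto
    then have "s + 1 / (2 * pi * a) * Arg2pi (z x) = x" using a by (simp add: field_simps)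
    then show ?thesis by (simp add: h_def w_def)
  qed
  have zc: "continuous_on UNIV z" unfolding z_def by (intro continuous_intros)
  have wc: "continuous_on UNIV w"
    unfolding w_def by (intro continuous_intros zc g)
  note tc = trig_poly_continuous[OF t(1)]
  \<comment> \<open>Setting the error to 0 off the interval makes the bound valid at every point, as
    \<open>L2_norm_indicator_le\<close> demands.\<close>
  define u where "u x = (if x \<in> {s..s + 1/a} then w x - t x else 0)" for x
  have um: "u \<in> Lmeas"
    unfolding u_def using continuous_measurable_lebesgue[OF continuous_on_diff[OF wc tc]]
    by (intro measurable_If_set) auto
  have "L2_dist (cut a s w) (cut a s t)
      = L2_norm (cut a s u)"
    by (rule arg_cong[where f=L2_norm]) (auto simp: fun_eq_iff u_def indicator_def)
  also have "\<dots> \<le> e / sqrt (1/a) * sqrt (1/a)"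
  proof (rule L2_norm_indicator_le[OF um _ a])
    show "cmod (u x) \<le> e / sqrt (1/a)" for x
      using t(2)[of x] hw[of x] e a by (auto simp: u_def)
  qed
  also have "\<dots> = e" using a by simp
  finally show "\<exists>t\<in>trig_poly a. L2_norm (\<lambda>x. indicator {s..s + 1/a} x *
    (of_real (min 1 (k * cmod (cis (2 * pi * a * (x - s)) - 1))) * g x) - indicator {s..s + 1/a} x * t x) \<le> e"
    using t(1) unfolding w_def z_def by blast
qed

lemma cis_neq_1: "0 < x \<Longrightarrow> x < 2 * pi \<Longrightarrow> cis x \<noteq> 1"
  using Arg2pi_cis[of x] Arg2pi_cis[of 0] by (auto simp del: Arg2pi_of_real)

lemma AE_lebesgue_neq: "AE x in lebesgue. x \<noteq> (c::real)"
  by (rule AE_I'[of "{c}"]) auto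

lemma cut_measurable: "f \<in> Lmeas \<Longrightarrow> cut a s f \<in> Lmeas"
  by (intro borel_measurable_times borel_measurable_indicator) auto

lemma trig_approximable_bounded_limit:
  fixes h :: "nat \<Rightarrow> real \<Rightarrow> complex"
  assumes h: "\<And>k. h k \<in> Lmeas" and f: "f \<in> Lmeas" and M: "\<And>k x. cmod (h k x) \<le> M"
    and lim: "AE x in lebesgue. x \<in> {s..s + 1/a} \<longrightarrow> (\<lambda>k. h k x) \<longlonglongrightarrow> f x"
    and app: "\<And>k. trig_approximable a s (cut a s (h k))"
  shows "trig_approximable a s (cut a s f)"
proof (rule trig_approximable_limit[OF _ app])
  have M0: "0 \<le> M" using M[of 0 0] norm_ge_zero order_trans by blast
  show "L2_tendsto (\<lambda>k. cut a s (h k)) (cut a s f) sequentially"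
  proof (rule L2_tendsto_dominated[OF cut_measurable[OF h] cut_measurable[OF f]])
    show "cut a s (\<lambda>x. of_real M) \<in> L2"
      by (rule L2_bounded_on_interval[where M=M]) (use M0 in auto)
    show "AE x in lebesgue. cmod (cut a s (h k) x) \<le> cmod (cut a s (\<lambda>x. of_real M) x)" for k
      using M M0 by (auto simp: indicator_def)
    show "AE x in lebesgue. (\<lambda>k. cut a s (h k) x) \<longlonglongrightarrow> cut a s f x"
      using lim by eventually_elim (auto simp: indicator_def)
  qed
qed

text \<open>As \<open>k\<close> grows, the cutoff factors become 1 at each interior point of the
  interval; only the two endpoints, a null set, are lost.\<close>

lemma trig_approximable_continuous:
  fixes g :: "real \<Rightarrow> complex"
  assumes a: "a > 0" and g: "continuous_on UNIV g" and M: "\<And>x. cmod (g x) \<le> M"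
  shows "trig_approximable a s (cut a s g)"
proof (rule trig_approximable_bounded_limit[where M=M])
  define z where "z x = cis (2 * pi * a * (x - s))" for x
  define w where "w k x = complex_of_real (min 1 (real k * cmod (z x - 1)))" for k x
  have zc: "continuous_on UNIV z" unfolding z_def by (intro continuous_intros)
  show "trig_approximable a s (cut a s (\<lambda>x. w k x * g x))" for k
    unfolding w_def z_def by (rule trig_approximable_cutoff[OF a g M])
  have "continuous_on UNIV (\<lambda>x. w k x * g x)" for k
    unfolding w_def by (intro continuous_intros g zc)
  then show "(\<lambda>x. w k x * g x) \<in> Lmeas" for k by (rule continuous_measurable_lebesgue)
  show "g \<in> Lmeas" by (rule continuous_measurable_lebesgue[OF g])
  show "cmod (w k x * g x) \<le> M" for k x
    using mult_mono[of "cmod (w k x)" 1 "cmod (g x)" M] M[of x] by (simp add: norm_mult w_def)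
  show "AE x in lebesgue. x \<in> {s..s + 1/a} \<longrightarrow> (\<lambda>k. w k x * g x) \<longlonglongrightarrow> g x"
    using AE_lebesgue_neq[of s] AE_lebesgue_neq[of "s + 1/a"]
  proof eventually_elim
    case (elim x)
    show ?case
    proof
      assume "x \<in> {s..s + 1/a}"
      then have x: "0 < x - s" "x - s < 1/a" using elim by auto
      then have "a * (x - s) < 1" using a by (simp add: pos_less_divide_eq mult.commute)
      then have "2 * pi * (a * (x - s)) < 2 * pi * 1" by (intro mult_strict_left_mono) auto
      then have "z x \<noteq> 1" unfolding z_def using x a by (intro cis_neq_1) (auto simp: mult.assoc)
      then have pos: "0 < cmod (z x - 1)" by simp
      obtain n :: nat where n: "1 / cmod (z x - 1) \<le> real n" using real_arch_simple by blast
      have "w k x = 1" if "k \<ge> n" for k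
      proof -
        have "1 / cmod (z x - 1) \<le> real k" using n that by linarith
        then have "1 \<le> real k * cmod (z x - 1)" using pos by (simp add: pos_divide_le_eq)
        then show ?thesis by (simp add: w_def)
      qed
      then have "\<forall>\<^sub>F k in sequentially. g x = w k x * g x"
        by (intro eventually_sequentiallyI[of n]) auto
      then show "(\<lambda>k. w k x * g x) \<longlonglongrightarrow> g x" by (rule Lim_transform_eventually[OF tendsto_const])
    qed
  qed
qed

text \<open>A Lebesgue measurable function is an almost everywhere limit of continuous ones. These
  must be made uniformly bounded before dominated convergence can be used.\<close>

lemma trig_approximable_bounded:
  fixes f :: "real \<Rightarrow> complex"
  assumes a: "a > 0" and f: "f \<in> Lmeas" and M: "\<And>x. cmod (f x) \<le> M"
  shows "trig_approximable a s (cut a s f)"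
proof -
  have "f measurable_on UNIV"
    using f by (intro lebesgue_measurable_imp_measurable_on) auto
  then obtain N g where N: "negligible N" and g: "\<And>n. continuous_on UNIV (g n)"
    and lim: "\<And>x. x \<notin> N \<Longrightarrow> (\<lambda>n. g n x) \<longlonglongrightarrow> f x"
    unfolding measurable_on_def by auto
  define K where "K = max 1 M"
  have K: "K > 0" "\<And>x. cmod (f x) \<le> K" using M by (auto simp: K_def intro: max.coboundedI2)
  \<comment> \<open>Radial clipping to the disc of radius \<open>K\<close> is continuous and fixes
    the values of \<open>f\<close>. Taking \<open>K\<close> at least 1 keeps the division
    legitimate.\<close>
  define r where "r n x = g n x / of_real (max 1 (cmod (g n x) / K))" for n x
  have rc: "continuous_on UNIV (r n)" for n
    unfolding r_def using K by (intro continuous_intros g) auto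
  have rb: "cmod (r n x) \<le> K" for n x
    using K by (auto simp: r_def norm_divide field_simps max_def)
  have rlim: "(\<lambda>n. r n x) \<longlonglongrightarrow> f x" if "x \<notin> N" for x
  proof -
    have "(\<lambda>n. r n x) \<longlonglongrightarrow> f x / of_real (max 1 (cmod (f x) / K))"
      unfolding r_def using K by (intro tendsto_intros lim that) auto
    moreover have "max 1 (cmod (f x) / K) = 1"
      using K(1) K(2)[of x] by (auto simp: max_def)
    ultimately show ?thesis by simp
  qed
  have "AE x in lebesgue. x \<notin> N" using N by (simp add: negligible_iff_null_sets AE_not_in)
  then have "AE x in lebesgue. x \<in> {s..s + 1/a} \<longrightarrow> (\<lambda>k. r k x) \<longlonglongrightarrow> f x"
    by eventually_elim (use rlim in blast)
  from trig_approximable_bounded_limit[OF continuous_measurable_lebesgue[OF rc] f rb this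
      trig_approximable_continuous[OF a rc rb]]
  show ?thesis .
qed

text \<open>Values of modulus above \<open>k\<close> are replaced by 0; the truncations are bounded
  and dominated by \<open>F\<close> itself.\<close>

lemma trig_approximable_L2:
  assumes a: "a > 0" and F: "F \<in> L2" and supp: "vanishes_off {s..s + 1/a} F"
  shows "trig_approximable a s F"
proof (rule trig_approximable_limit)
  define G where "G k x = (if cmod (F x) \<le> real k then F x else 0)" for k x
  note [measurable] = L2_measurable[OF F]
  have G[measurable]: "G k \<in> Lmeas" for k
    unfolding G_def by measurable
  show "trig_approximable a s (cut a s (G k))" for k
    by (rule trig_approximable_bounded[OF a G, of _ "real k"]) (simp add: G_def)
  show "L2_tendsto (\<lambda>k. cut a s (G k)) F sequentially"
  proof (rule L2_tendsto_dominated[OF _ _ F])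
    show "AE x in lebesgue. (\<lambda>k. cut a s (G k) x) \<longlonglongrightarrow> F x"
      using supp
    proof eventually_elim
      case (elim x)
      obtain n :: nat where "cmod (F x) \<le> real n" using real_arch_simple by blast
      then have "\<forall>\<^sub>F k in sequentially. F x = cut a s (G k) x"
        using elim by (intro eventually_sequentiallyI[of n]) (auto simp: G_def indicator_def)
      then show ?case by (rule Lim_transform_eventually[OF tendsto_const])
    qed
    show "cut a s (G k) \<in> Lmeas" for k
      by (rule cut_measurable[OF G])
    show "F \<in> Lmeas" by (rule L2_measurable[OF F])
    show "AE x in lebesgue. cmod (cut a s (G k) x) \<le> cmod (F x)" for k
      by (auto simp: G_def indicator_def)
  qed
qed

theorem Fourier_series_Parseval:
  assumes a: "a > 0" and F: "F \<in> L2" and supp: "vanishes_off {s..s + 1/a} F"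
  shows "(NNSUM n. esq (LINT x|lebesgue. F x * echar a n x))
    = ennreal ((L2_norm F)\<^sup>2 / a)"
proof -
  define E where "E n x = indicator {s..s + 1/a} x * echar a n x" for n x
  define c where "c n = L2_inner F (E n)" for n
  note id = L2_norm_diff_trig_poly[OF a F, of _ _ s, folded E_def, folded c_def]
  have E: "E n \<in> L2" for n unfolding E_def by (rule echar_on_L2)
  \<comment> \<open>The integral is linear in the character and \<open>c\<close> conjugates it,
    hence the reflected index; the reflection is undone at the end by reindexing.\<close>
  have ceq: "(LINT x|lebesgue. F x * echar a n x) = c (- n)" for n
    unfolding c_def L2_inner_def
  proof (rule integral_cong_AE)
    show "(\<lambda>x. F x * cnj (E (- n) x)) \<in> Lmeas"
      using L2_integrable_cnj_mult[OF F E] by (rule borel_measurable_integrable)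
    show "(\<lambda>x. F x * echar a n x) \<in> Lmeas"
      by (intro borel_measurable_times L2_measurable F echar_measurable)
    show "AE x in lebesgue. F x * echar a n x = F x * cnj (E (- n) x)"
      using supp by eventually_elim (auto simp: E_def indicator_def cnj_echar)
  qed
  \<comment> \<open>Bessel's inequality: the coefficients \<open>of_real a * c n\<close> make the
    last sum of \<open>id\<close> vanish.\<close>
  have le: "(\<Sum>n\<in>S. (cmod (c n))\<^sup>2) \<le> (L2_norm F)\<^sup>2 / a" if S: "finite S" for S
  proof -
    have "0 \<le> (L2_norm (\<lambda>x. F x - (\<Sum>n\<in>S. of_real a * c n * E n x)))\<^sup>2" by simp
    also have "\<dots> = (L2_norm F)\<^sup>2 - a * (\<Sum>n\<in>S. (cmod (c n))\<^sup>2)"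
      unfolding id[OF S] by simp
    finally show ?thesis using a by (simp add: pos_le_divide_eq mult.commute)
  qed
  let ?T = "NNSUM n. esq (c n)"
  have "?T = (L2_norm F)\<^sup>2 / a"
  proof (rule antisym)
    show "?T \<le> ennreal ((L2_norm F)\<^sup>2 / a)"
      by (rule nn_integral_count_space_int_le) (simp add: sum_ennreal ennreal_leI le)
    show "ennreal ((L2_norm F)\<^sup>2 / a) \<le> ?T"
    proof (rule ennreal_le_epsilon)
      fix e :: real assume e: "0 < e"
      have "0 < sqrt (a * e)" using a e by simp
      then obtain t where t: "t \<in> trig_poly a"
        "L2_dist F (cut a s t) \<le> sqrt (a * e)"
        using trig_approximable_L2[OF a F supp] unfolding trig_approximable_def by blast
      obtain S p where S: "finite S" "\<And>x. t x = (\<Sum>n\<in>S. p n * echar a n x)"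
        using trig_poly_sum[OF t(1)] by metis
      have "(\<lambda>x. F x - indicator {s..s + 1/a} x * t x) = (\<lambda>x. F x - (\<Sum>n\<in>S. p n * E n x))"
        by (simp add: S(2) E_def sum_distrib_left mult.left_commute)
      then have "(L2_norm (\<lambda>x. F x - (\<Sum>n\<in>S. p n * E n x)))\<^sup>2 \<le> (sqrt (a * e))\<^sup>2"
        using t(2) by (intro power_mono) (simp_all add: L2_norm_nonneg)
      \<comment> \<open>The last sum in \<open>id\<close> is nonnegative and is dropped, so the
        actual coefficients \<open>p\<close> of the approximating polynomial do not matter.\<close>
      then have "(L2_norm F)\<^sup>2 - a * (\<Sum>n\<in>S. (cmod (c n))\<^sup>2) \<le> a * e"
        unfolding id[OF S(1)] using a e
        by (smt (verit) divide_nonneg_pos real_sqrt_pow2 sum_nonneg zero_le_power2 mult_pos_pos)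
      then have "(L2_norm F)\<^sup>2 / a \<le> (\<Sum>n\<in>S. (cmod (c n))\<^sup>2) + e"
        using a by (simp add: field_simps)
      then have "ennreal ((L2_norm F)\<^sup>2 / a) \<le> ennreal ((\<Sum>n\<in>S. (cmod (c n))\<^sup>2) + e)" by (rule ennreal_leI)
      also have "\<dots> = (\<Sum>n\<in>S. esq (c n)) + ennreal e"
        using e by (simp add: sum_nonneg sum_ennreal)
      also have "\<dots> \<le> ?T + ennreal e"
        by (intro add_right_mono nn_integral_count_space_ge_sum S(1))
      finally show "ennreal ((L2_norm F)\<^sup>2 / a) \<le> ?T + ennreal e" .
    qed
  qed
  moreover have "?T = (NNSUM n. esq (c (- n)))"
    by (rule nn_integral_bij_count_space[symmetric]) (rule bij_uminus)
  ultimately show ?thesis by (simp add: ceq)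
qed

subsection \<open>Plancherel's theorem\<close>

lemma nn_integral_tiles:
  fixes f :: "real \<Rightarrow> ennreal"
  assumes l: "l > 0" and f[measurable]: "f \<in> Lmeas"
  shows "(\<integral>\<^sup>+x. f x \<partial>lebesgue)
    = (NNSUM k. \<integral>\<^sup>+x. f x * indicator {of_int k * l..<(of_int k + 1) * l} x \<partial>lebesgue)"
proof -
  have "(NNSUM k. f x * indicator {of_int k * l..<(of_int k + 1) * l} x) = f x" for x
  proof -
    have *: "x \<in> {of_int k * l..<(of_int k + 1) * l} \<longleftrightarrow> k = \<lfloor>x / l\<rfloor>" for k
    proof -
      have "x \<in> {of_int k * l..<(of_int k + 1) * l} \<longleftrightarrow> of_int k \<le> x / l \<and> x / l < of_int k + 1"
        using l by (simp add: pos_le_divide_eq pos_divide_less_eq)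
      then show ?thesis by (simp only: floor_eq_iff eq_commute[of k])
    qed
    have "(NNSUM k. f x * indicator {of_int k * l..<(of_int k + 1) * l} x)
       = (\<Sum>k\<in>{\<lfloor>x / l\<rfloor>}. f x * indicator {of_int k * l..<(of_int k + 1) * l} x)"
      by (rule nn_integral_count_space') (use * in \<open>auto simp: indicator_def\<close>)
    also have "\<dots> = f x" using *[of "\<lfloor>x / l\<rfloor>"] by (simp add: indicator_def)
    finally show ?thesis .
  qed
  then have "(\<integral>\<^sup>+x. f x \<partial>lebesgue)
    = (\<integral>\<^sup>+x. (NNSUM k. f x * indicator {of_int k * l..<(of_int k + 1) * l} x) \<partial>lebesgue)"
    by simp
  also have "\<dots> = (NNSUM k. \<integral>\<^sup>+x. f x * indicator {of_int k * l..<(of_int k + 1) * l} x \<partial>lebesgue)"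
    by (rule nn_integral_count_space_nn_integral) (auto intro!: borel_measurable_times_ennreal borel_measurable_indicator)
  finally show ?thesis .
qed

lemma measurable_lebesgue_affine: "c \<noteq> 0 \<Longrightarrow> (\<lambda>x. t + c * x) \<in> lebesgue \<rightarrow>\<^sub>M (lebesgue :: real measure)"
  using lebesgue_affine_measurable[where c="\<lambda>x::real. c" and t=t] by simp

lemma nn_integral_lebesgue_shift:
  fixes f :: "real \<Rightarrow> ennreal"
  assumes f: "f \<in> Lmeas"
  shows "(\<integral>\<^sup>+x. f x \<partial>lebesgue) = (\<integral>\<^sup>+x. f (t + x) \<partial>lebesgue)"
proof -
  have "lebesgue = distr lebesgue lebesgue ((+) t)"
    using lebesgue_real_affine[of 1 t] by (simp add: density_1)
  then have "(\<integral>\<^sup>+x. f x \<partial>lebesgue) = (\<integral>\<^sup>+x. f x \<partial>distr lebesgue lebesgue ((+) t))"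
    by (rule arg_cong[where f="\<lambda>M. integral\<^sup>N M f"])
  also have "\<dots> = (\<integral>\<^sup>+x. f (t + x) \<partial>lebesgue)"
    using measurable_lebesgue_affine[of 1 t] f by (intro nn_integral_distr) auto
  finally show ?thesis .
qed

lemma L2_affine:
  assumes "f \<in> L2" "\<bar>c\<bar> = 1"
  shows "(\<lambda>x. f (t + c * x)) \<in> L2" "L2_norm (\<lambda>x. f (t + c * x)) = L2_norm f"
proof -
  have c: "c \<noteq> 0" using assms by auto
  have "integrable lebesgue (\<lambda>x. (cmod (f (t + c * x)))\<^sup>2)"
    using lebesgue_integrable_real_affine[OF L2_integrable[OF assms(1)] c] .
  then show "(\<lambda>x. f (t + c * x)) \<in> L2"
    using measurable_compose[OF measurable_lebesgue_affine[OF c] L2_measurable[OF assms(1)]]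
    by (simp add: L2_def)
  show "L2_norm (\<lambda>x. f (t + c * x)) = L2_norm f"
    using lebesgue_integral_real_affine[OF c, of "\<lambda>x. (cmod (f x))\<^sup>2" t] assms(2) by (simp add: L2_norm_def)
qed

section \<open>The Fourier integral of integrable functions\<close>

lemma fourier_eq_cis: "fourier f y = (LINT t|lebesgue. f t * cis (- 2 * pi * t * y))"
  unfolding fourier_def cis_conv_exp by (simp add: mult_ac)

lemma cis_measurable [measurable]: "(\<lambda>t. cis (c * t)) \<in> Lmeas"
  by (intro continuous_measurable_lebesgue continuous_intros)

lemma integrable_mult_cis:
  assumes "integrable lebesgue f"
  shows "integrable lebesgue (\<lambda>t. f t * cis (c * t))"
proof (rule Bochner_Integration.integrable_bound[OF assms])
  show "(\<lambda>t. f t * cis (c * t)) \<in> Lmeas"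
    by (intro borel_measurable_times borel_measurable_integrable[OF assms] cis_measurable)
qed (simp add: norm_mult)

lemma integrable_fourier_kernel:
  assumes "integrable lebesgue f"
  shows "integrable lebesgue (\<lambda>t. f t * cis (- 2 * pi * t * y))"
  using integrable_mult_cis[OF assms, of "- 2 * pi * y"] by (simp add: mult_ac)

lemma fourier_add:
  "integrable lebesgue f \<Longrightarrow> integrable lebesgue g \<Longrightarrow> fourier (\<lambda>x. f x + g x) = (\<lambda>y. fourier f y + fourier g y)"
  using integrable_fourier_kernel[of f] integrable_fourier_kernel[of g]
  by (simp add: fun_eq_iff fourier_eq_cis distrib_right)

lemma fourier_cmult: "fourier (\<lambda>x. c * f x) = (\<lambda>y. c * fourier f y)"
  by (simp add: fun_eq_iff fourier_eq_cis mult.assoc)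

lemma fourier_diff:
  "integrable lebesgue f \<Longrightarrow> integrable lebesgue g \<Longrightarrow> fourier (\<lambda>x. f x - g x) = (\<lambda>y. fourier f y - fourier g y)"
  using integrable_fourier_kernel[of f] integrable_fourier_kernel[of g]
  by (simp add: fun_eq_iff fourier_eq_cis left_diff_distrib)

lemma fourier_tendsto_dominated:
  fixes h :: "nat \<Rightarrow> real \<Rightarrow> complex"
  assumes f: "integrable lebesgue f" and h: "\<And>k. h k \<in> Lmeas"
    and le: "\<And>k x. cmod (h k x) \<le> cmod (f x)" and lim: "\<And>x. (\<lambda>k. h k x) \<longlonglongrightarrow> f x"
    and u: "u \<longlonglongrightarrow> y"
  shows "(\<lambda>k. fourier (h k) (u k)) \<longlonglongrightarrow> fourier f y"
  unfolding fourier_eq_cis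
proof (rule integral_dominated_convergence[where w="\<lambda>x. cmod (f x)"])
  have c: "(\<lambda>t. cis (- 2 * pi * t * z)) \<in> Lmeas" for z
    using cis_measurable[of "- 2 * pi * z"] by (simp add: mult_ac)
  show "(\<lambda>t. f t * cis (- 2 * pi * t * y)) \<in> Lmeas"
    by (intro borel_measurable_times c borel_measurable_integrable[OF f])
  show "(\<lambda>t. h k t * cis (- 2 * pi * t * u k)) \<in> Lmeas" for k
    by (intro borel_measurable_times c h)
  show "AE t in lebesgue. (\<lambda>k. h k t * cis (- 2 * pi * t * u k)) \<longlonglongrightarrow> f t * cis (- 2 * pi * t * y)"
    by (intro AE_I2 tendsto_intros lim u)
qed (use f le in \<open>auto simp: norm_mult\<close>)

lemma fourier_continuous:
  assumes f: "integrable lebesgue f"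
  shows "continuous_on UNIV (fourier f)"
proof (rule continuous_on_sequentiallyI)
  fix u y assume "u \<longlonglongrightarrow> (y::real)"
  then show "(\<lambda>n. fourier f (u n)) \<longlonglongrightarrow> fourier f y"
    by (intro fourier_tendsto_dominated[OF f]) (use f in auto)
qed

lemma fourier_measurable: "integrable lebesgue f \<Longrightarrow> fourier f \<in> Lmeas"
  by (intro continuous_measurable_lebesgue fourier_continuous)

lemma indicator_Icc_L2: "(\<lambda>x. indicator {s..t::real} x) \<in> L2"
  using L2_bounded_on_interval[of "\<lambda>x. 1" 1 s t] by simp

lemma L2_compact_integrable:
  assumes F: "F \<in> L2" and supp: "vanishes_off {s..t} F"
  shows "integrable lebesgue F"
  by (rule integrable_cong_AE_imp[OF L2_integrable_mult[OF F indicator_Icc_L2[of s t]]])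
     (use L2_measurable[OF F] supp in \<open>auto simp: indicator_def\<close>)

text \<open>The line of frequencies is cut into cells of length \<open>a\<close>. For each offset
  \<open>y\<close> in one cell, the values of the transform on the lattice \<open>y + k * a\<close>
  are Fourier coefficients of a modulation of \<open>F\<close>, so their squares sum to a constant,
  and integrating it over the cell cancels the factor \<open>1/a\<close>.\<close>

lemma nn_integral_fourier_compact:
  assumes a: "a > 0" and F: "F \<in> L2" and supp: "vanishes_off {s..s + 1/a} F"
  shows "(\<integral>\<^sup>+y. esq (fourier F y) \<partial>lebesgue) = ennreal ((L2_norm F)\<^sup>2)"
proof -
  have int: "integrable lebesgue F" by (rule L2_compact_integrable[OF F supp])
  let ?G = "\<lambda>y. esq (fourier F y)"
  have G[measurable]: "?G \<in> Lmeas"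
    using fourier_measurable[OF int] by measurable
  let ?I = "\<lambda>y. indicator {0..<a} y :: ennreal"
  have ind: "?I \<in> Lmeas" by (rule borel_measurable_indicator) auto
  have shift: "(\<integral>\<^sup>+y. ?G y * indicator {of_int k * a..<(of_int k + 1) * a} y \<partial>lebesgue)
      = (\<integral>\<^sup>+y. ?I y * ?G (of_int k * a + y) \<partial>lebesgue)" for k :: int
  proof -
    have "(\<integral>\<^sup>+y. ?G y * indicator {of_int k * a..<(of_int k + 1) * a} y \<partial>lebesgue)
       = (\<integral>\<^sup>+y. ?G (of_int k * a + y) * indicator {of_int k * a..<(of_int k + 1) * a} (of_int k * a + y) \<partial>lebesgue)"
      by (rule nn_integral_lebesgue_shift)
         (auto intro!: borel_measurable_times_ennreal borel_measurable_indicator G)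
    also have "\<dots> = (\<integral>\<^sup>+y. ?I y * ?G (of_int k * a + y) \<partial>lebesgue)"
      by (intro nn_integral_cong) (auto simp: indicator_def distrib_right)
    finally show ?thesis .
  qed
  \<comment> \<open>The modulation \<open>H\<close> moves the offset \<open>y\<close> into the
    function without changing its support or norm.\<close>
  have pars: "(NNSUM k. ?G (of_int k * a + y)) = ennreal ((L2_norm F)\<^sup>2 / a)" for y
  proof -
    define H where "H t = cis (- 2 * pi * y * t) * F t" for t
    have H: "H \<in> L2" unfolding H_def
      by (rule L2_bounded_mult[OF F cis_measurable, where C=1]) simp
    have nH: "L2_norm H = L2_norm F" by (simp add: L2_norm_def H_def norm_mult)
    have coeff: "fourier F (of_int (- k) * a + y) = (LINT t|lebesgue. H t * echar a k t)" for k
      unfolding fourier_eq_cis H_def echar_def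
      by (intro Bochner_Integration.integral_cong) (auto simp: cis_mult algebra_simps)
    have "(NNSUM k. ?G (of_int k * a + y))
      = (NNSUM k. ?G (of_int (- k) * a + y))"
      by (rule nn_integral_bij_count_space[symmetric]) (rule bij_uminus)
    also have "\<dots> = (NNSUM k. esq (LINT t|lebesgue. H t * echar a k t))"
      by (intro nn_integral_cong) (simp only: coeff)
    also have "\<dots> = ennreal ((L2_norm H)\<^sup>2 / a)"
      by (rule Fourier_series_Parseval[OF a H, of s]) (use supp in \<open>auto simp: H_def\<close>)
    finally show ?thesis by (simp add: nH)
  qed
  have "(\<integral>\<^sup>+y. ?G y \<partial>lebesgue) = (NNSUM k. \<integral>\<^sup>+y. ?I y * ?G (of_int k * a + y) \<partial>lebesgue)"
    unfolding nn_integral_tiles[OF a G] shift ..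
  also have "\<dots> = (\<integral>\<^sup>+y. (NNSUM k. ?I y * ?G (of_int k * a + y)) \<partial>lebesgue)"
  proof (rule nn_integral_count_space_nn_integral[symmetric])
    show "(\<lambda>y. ?I y * ?G (of_int k * a + y)) \<in> Lmeas" for k :: int
      using measurable_compose[OF measurable_lebesgue_affine[of 1 "of_int k * a"] G]
      by (intro borel_measurable_times_ennreal ind) simp
  qed auto
  also have "\<dots> = (\<integral>\<^sup>+y. ennreal ((L2_norm F)\<^sup>2 / a) * ?I y \<partial>lebesgue)"
    by (intro nn_integral_cong, simp add: nn_integral_cmult pars) (simp add: mult.commute)
  also have "\<dots> = ennreal ((L2_norm F)\<^sup>2 / a) * ennreal a"
    using a by (subst nn_integral_cmult_indicator) auto
  also have "\<dots> = ennreal ((L2_norm F)\<^sup>2)"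
    using a by (simp flip: ennreal_mult)
  finally show ?thesis .
qed

lemma Plancherel_compact:
  assumes F: "F \<in> L2" and supp: "vanishes_off {- r..r} F"
  shows "fourier F \<in> L2" "L2_norm (fourier F) = L2_norm F"
proof -
  \<comment> \<open>The period \<open>1/a\<close> is the length of
    \<open>{- max 1 r..max 1 r}\<close>; the maximum keeps it positive when \<open>r\<close> is
    not.\<close>
  define a where "a = 1 / (2 * max 1 r)"
  have a: "a > 0" by (simp add: a_def max_def)
  have sub: "{- r..r} \<subseteq> {- max 1 r..- max 1 r + 1 / a}" by (auto simp: a_def)
  then have supp': "vanishes_off {- max 1 r..- max 1 r + 1 / a} F"
    using supp by eventually_elim (use sub in auto)
  note eq = nn_integral_fourier_compact[OF a F supp']
  show L: "fourier F \<in> L2"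
    unfolding L2_iff_nn eq using fourier_measurable[OF L2_compact_integrable[OF F supp]] by simp
  have "(L2_norm (fourier F))\<^sup>2 = (L2_norm F)\<^sup>2"
    using eq unfolding nn_eq_L2_norm[OF L] by simp
  then show "L2_norm (fourier F) = L2_norm F"
    using L2_norm_nonneg power2_eq_imp_eq by blast
qed

lemma L2_norm_mono:
  assumes "f \<in> L2" "g \<in> L2" "AE x in lebesgue. cmod (f x) \<le> cmod (g x)"
  shows "L2_norm f \<le> L2_norm g"
  unfolding L2_norm_def
proof (intro real_sqrt_le_mono integral_mono_AE L2_integrable assms)
  show "AE x in lebesgue. (cmod (f x))\<^sup>2 \<le> (cmod (g x))\<^sup>2"
    using assms(3) by eventually_elim (intro power_mono, auto)
qed

lemma truncate_L2:
  assumes "f \<in> L2"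
  shows "(\<lambda>x. indicator {s..t::real} x * f x) \<in> L2"
  using L2_measurable[OF indicator_Icc_L2[of s t]]
  by (intro L2_bounded_mult[OF assms, where C=1]) (auto simp: indicator_def)


lemma integrable_truncate:
  assumes "f \<in> L2"
  shows "integrable lebesgue (\<lambda>x. indicator {s..t::real} x * f x)"
  by (rule L2_integrable_mult[OF indicator_Icc_L2 assms])

lemma fourier_truncate_dist_le:
  assumes f: "f \<in> L2" and jk: "j \<le> k"
  shows "L2_dist (fourier (trunc k f)) (fourier (trunc j f)) \<le> L2_dist f (trunc j f)"
proof -
  have d: "(\<lambda>x. trunc k f x - trunc j f x) \<in> L2" by (intro L2_diff truncate_L2 f)
  have "L2_dist (fourier (trunc k f)) (fourier (trunc j f)) = L2_norm (fourier (\<lambda>x. trunc k f x - trunc j f x))"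
    unfolding fourier_diff[OF integrable_truncate[OF f] integrable_truncate[OF f]] ..
  also have "\<dots> = L2_dist (trunc k f) (trunc j f)"
    by (rule Plancherel_compact(2)[OF d, where r="real k"]) (use jk in \<open>auto simp: indicator_def\<close>)
  also have "\<dots> \<le> L2_dist f (trunc j f)"
    by (rule L2_norm_mono[OF d L2_diff[OF f truncate_L2[OF f]]]) (use jk in \<open>auto simp: indicator_def\<close>)
  finally show ?thesis .
qed

text \<open>Integrability of \<open>f\<close> makes the transforms of the truncations converge
  pointwise, and Plancherel for compact supports bounds their mutual distances. Fatou's lemma
  combines the two and identifies the \<open>L2\<close> limit as the Fourier integral.\<close>

lemma fourier_truncate_tendsto:
  assumes f: "f \<in> L2" "integrable lebesgue f"
  shows "L2_tendsto (\<lambda>k::nat. fourier (trunc k f)) (fourier f) sequentially"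
proof -
  define F where "F k = trunc k f" for k :: nat
  have F: "F k \<in> L2" for k unfolding F_def by (rule truncate_L2[OF f(1)])
  have FF: "fourier (F k) \<in> L2" for k
    by (rule Plancherel_compact(1)[OF F, where r="real k"]) (auto simp: F_def indicator_def)
  have lim: "(\<lambda>k. fourier (F k) y) \<longlonglongrightarrow> fourier f y" for y
  proof (rule fourier_tendsto_dominated[OF f(2)])
    show "F k \<in> Lmeas" for k by (rule L2_measurable[OF F])
    show "cmod (F k x) \<le> cmod (f x)" for k x by (auto simp: F_def indicator_def)
    show "(\<lambda>k. F k x) \<longlonglongrightarrow> f x" for x unfolding F_def by (rule trunc_tendsto)
  qed auto
  have key: "fourier f \<in> L2 \<and> L2_dist (fourier f) (fourier (F j)) \<le> L2_dist f (F j)" for j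
  proof -
    have "L2_dist (fourier (F k)) (fourier (F j)) \<le> L2_dist f (F j)" if "k \<ge> j" for k
      unfolding F_def by (rule fourier_truncate_dist_le[OF f(1) that])
    from L2_Fatou[OF FF fourier_measurable[OF f(2)] FF AE_I2[OF lim] this] show ?thesis by blast
  qed
  have le: "L2_dist (fourier (F k)) (fourier f) \<le> L2_dist (F k) f" for k
    using key[of k] L2_norm_minus_commute[of "fourier f" "fourier (F k)"] L2_norm_minus_commute[of f "F k"]
    by simp
  have "(\<lambda>k. L2_dist (F k) f) \<longlonglongrightarrow> 0"
    using L2_tendstoD(3)[OF L2_truncate[OF f(1)]] by (simp add: F_def)
  from L2_tendsto_if_dist_le[OF FF key[THEN conjunct1] this always_eventually[OF allI[OF le]]]
  show ?thesis by (simp add: F_def)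
qed

lemma Plancherel_L1_L2:
  assumes f: "f \<in> L2" "integrable lebesgue f"
  shows "fourier f \<in> L2" "L2_norm (fourier f) = L2_norm f"
proof -
  note t = fourier_truncate_tendsto[OF f]
  show "fourier f \<in> L2" by (rule L2_tendstoD(2)[OF t])
  have "L2_norm (fourier (trunc k f))
      = L2_norm (trunc k f)" for k
    by (rule Plancherel_compact(2)[OF truncate_L2[OF f(1)], where r="real k"]) (auto simp: indicator_def)
  then show "L2_norm (fourier f) = L2_norm f"
    using L2_tendsto_norm[OF t] L2_tendsto_norm[OF L2_truncate[OF f(1)]]
    by (intro LIMSEQ_unique) simp_all
qed

section \<open>The Fourier transform as a relation on \<open>L2\<close>\<close>

lemma has_fourier_L2D:
  assumes "has_fourier_L2 f g"
  shows "f \<in> L2" "g \<in> L2"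
  using assms L2_tendstoD(2) unfolding has_fourier_L2_def by blast+

definition fourier_seq :: "(real \<Rightarrow> complex) \<Rightarrow> (real \<Rightarrow> complex) \<Rightarrow> nat \<Rightarrow> real \<Rightarrow> complex" where
  "fourier_seq f g = (SOME h. (\<forall>k. integrable lebesgue (h k)) \<and>
     L2_tendsto h f sequentially \<and> L2_tendsto (\<lambda>k. fourier (h k)) g sequentially)"

lemma fourier_seq:
  assumes "has_fourier_L2 f g"
  shows "integrable lebesgue (fourier_seq f g k)" "L2_tendsto (fourier_seq f g) f sequentially"
    "L2_tendsto (\<lambda>k. fourier (fourier_seq f g k)) g sequentially"
  using someI_ex[OF assms[unfolded has_fourier_L2_def]] unfolding fourier_seq_def by blast+

lemma has_fourier_L2_norm:
  assumes "has_fourier_L2 f g"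
  shows "L2_norm g = L2_norm f"
proof -
  note h = fourier_seq[OF assms]
  have "L2_norm (fourier (fourier_seq f g k)) = L2_norm (fourier_seq f g k)" for k
    by (intro Plancherel_L1_L2 L2_tendstoD(1)[OF h(2)] h(1))
  then show ?thesis
    using L2_tendsto_norm[OF h(3)] L2_tendsto_norm[OF h(2)] by (intro LIMSEQ_unique) simp_all
qed

lemma has_fourier_L2_add:
  assumes "has_fourier_L2 f g" "has_fourier_L2 f' g'"
  shows "has_fourier_L2 (\<lambda>x. f x + f' x) (\<lambda>x. g x + g' x)"
proof -
  note h = fourier_seq[OF assms(1)] and h' = fourier_seq[OF assms(2)]
  show ?thesis
    unfolding has_fourier_L2_def
    using L2_tendsto_add[OF h(2) h'(2)] L2_tendsto_add[OF h(3) h'(3)] h(1) h'(1)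
    by (intro exI[of _ "\<lambda>k x. fourier_seq f g k x + fourier_seq f' g' k x"]) (simp add: fourier_add)
qed

lemma has_fourier_L2_cmult:
  assumes "has_fourier_L2 f g"
  shows "has_fourier_L2 (\<lambda>x. c * f x) (\<lambda>x. c * g x)"
proof -
  note h = fourier_seq[OF assms]
  show ?thesis
    unfolding has_fourier_L2_def
    using L2_tendsto_cmult[OF h(2)] L2_tendsto_cmult[OF h(3)] h(1)
    by (intro exI[of _ "\<lambda>k x. c * fourier_seq f g k x"]) (simp add: fourier_cmult)
qed

lemma has_fourier_L2_diff:
  assumes "has_fourier_L2 f g" "has_fourier_L2 f' g'"
  shows "has_fourier_L2 (\<lambda>x. f x - f' x) (\<lambda>x. g x - g' x)"
  using has_fourier_L2_add[OF assms(1) has_fourier_L2_cmult[OF assms(2), of "-1"]] by simp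

lemma has_fourier_L2_cong_right:
  assumes "has_fourier_L2 f g" "AE x in lebesgue. g x = g' x"
  shows "has_fourier_L2 f g'"
  using assms L2_tendsto_cong_AE[OF _ assms(2)] unfolding has_fourier_L2_def by blast

text \<open>Isometry applied to the difference: one direction says that the transform is well
  defined, the other that it is injective.\<close>

lemma has_fourier_L2_AE_iff:
  assumes "has_fourier_L2 f g" "has_fourier_L2 f' g'"
  shows "(AE x in lebesgue. g x = g' x) \<longleftrightarrow> (AE x in lebesgue. f x = f' x)"
  using has_fourier_L2_norm[OF has_fourier_L2_diff[OF assms]] has_fourier_L2D[OF assms(1)] has_fourier_L2D[OF assms(2)]
  by (simp flip: L2_dist_eq_0_iff)

text \<open>Preservation of norms gives equality of real parts; replacing \<open>f'\<close> by
  \<open>\<i>\<close> times \<open>f'\<close> turns the imaginary part into a real part.\<close>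

lemma has_fourier_L2_inner:
  assumes "has_fourier_L2 f g" "has_fourier_L2 f' g'"
  shows "L2_inner g g' = L2_inner f f'"
proof -
  have re: "Re (L2_inner g h) = Re (L2_inner f k)" if "has_fourier_L2 k h" for h k
    using L2_norm_diff_sq[OF has_fourier_L2D(2)[OF assms(1)] has_fourier_L2D(2)[OF that]]
      L2_norm_diff_sq[OF has_fourier_L2D(1)[OF assms(1)] has_fourier_L2D(1)[OF that]]
      has_fourier_L2_norm[OF has_fourier_L2_diff[OF assms(1) that]]
      has_fourier_L2_norm[OF that] has_fourier_L2_norm[OF assms(1)]
    by simp
  have "Im (L2_inner g g') = Im (L2_inner f f')"
    using re[OF has_fourier_L2_cmult[OF assms(2), of \<i>]] by (simp add: L2_inner_cmult_right)
  then show ?thesis using re[OF assms(2)] by (simp add: complex_eq_iff)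
qed

lemma fourier_translate: "fourier (translate x f) y = cis (- 2 * pi * x * y) * fourier f y"
proof -
  have "fourier (translate x f) y = (LINT t|lebesgue. f t * cis (- 2 * pi * (x + t) * y))"
    unfolding fourier_eq_cis translate_def
    using lebesgue_integral_real_affine[of 1 "\<lambda>t. f (t - x) * cis (- 2 * pi * t * y)" x] by simp
  also have "\<dots> = (LINT t|lebesgue. cis (- 2 * pi * x * y) * (f t * cis (- 2 * pi * t * y)))"
    by (intro Bochner_Integration.integral_cong) (auto simp: cis_mult algebra_simps)
  finally show ?thesis by (simp add: fourier_eq_cis)
qed

lemma translate_L2: "f \<in> L2 \<Longrightarrow> translate x f \<in> L2" "f \<in> L2 \<Longrightarrow> L2_norm (translate x f) = L2_norm f"
  using L2_affine[of f 1 "- x"] by (simp_all add: translate_def)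

lemma has_fourier_L2_translate:
  assumes "has_fourier_L2 f g"
  shows "has_fourier_L2 (translate x f) (\<lambda>y. cis (- 2 * pi * x * y) * g y)"
proof -
  define h where "h = fourier_seq f g"
  note h = fourier_seq[OF assms, folded h_def]
  have cm: "(\<lambda>y. cis (- 2 * pi * x * y) * u y) \<in> L2" if "u \<in> L2" for u
    by (rule L2_bounded_mult[OF that cis_measurable, where C=1]) simp
  have "L2_norm (\<lambda>t. translate x (h k) t - translate x f t) = L2_dist (h k) f" for k
    using translate_L2(2)[OF L2_diff[OF L2_tendstoD(1,2)[OF h(2)]], of x k] by (simp add: translate_def)
  then have "L2_tendsto (\<lambda>k. translate x (h k)) (translate x f) sequentially"
    using h(2) by (simp add: L2_tendsto_def translate_L2)
  moreover have "L2_norm (\<lambda>y. cis (- 2 * pi * x * y) * fourier (h k) y - cis (- 2 * pi * x * y) * g y)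
     = L2_dist (fourier (h k)) g" for k
    unfolding right_diff_distrib[symmetric] L2_norm_def norm_mult norm_cis by simp
  then have "L2_tendsto (\<lambda>k. fourier (translate x (h k))) (\<lambda>y. cis (- 2 * pi * x * y) * g y) sequentially"
    unfolding fourier_translate[abs_def] using h(3) cm unfolding L2_tendsto_def by simp
  moreover have "integrable lebesgue (translate x (h k))" for k
    using lebesgue_integrable_real_affine[OF h(1), of 1 k "- x"] by (simp add: translate_def)
  ultimately show ?thesis
    unfolding has_fourier_L2_def by (intro exI[of _ "\<lambda>k. translate x (h k)"]) simp
qed

text \<open>Fubini's theorem is used over the product of two copies of \<open>lborel\<close>, where
  the integrand has to be Borel measurable; passing to an almost everywhere equal version changes no
  integral.\<close>

lemma integrable_lebesgue_borel_version:
  fixes f :: "real \<Rightarrow> complex"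
  assumes "integrable lebesgue f"
  obtains f' where "f' \<in> borel_measurable borel" "integrable lborel f'" "AE x in lebesgue. f x = f' x"
proof -
  have Re: "(\<lambda>x. Re (f x)) \<in> Lmeas" and Im: "(\<lambda>x. Im (f x)) \<in> Lmeas"
    using borel_measurable_integrable[OF assms] by simp_all
  obtain u where u: "u \<in> borel_measurable lborel" "AE x in lborel. Re (f x) = u x"
    using completion_ex_borel_measurable_real[OF Re] by blast
  obtain v where v: "v \<in> borel_measurable lborel" "AE x in lborel. Im (f x) = v x"
    using completion_ex_borel_measurable_real[OF Im] by blast
  define f' where "f' x = Complex (u x) (v x)" for x
  have f'eq: "f' = (\<lambda>x. of_real (u x) + \<i> * of_real (v x))"
    by (auto simp: f'_def fun_eq_iff complex_eq_iff)
  have m: "f' \<in> borel_measurable lborel"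
    unfolding f'eq using u(1) v(1) by measurable
  have ae: "AE x in lebesgue. f x = f' x"
    using AE_completion[OF u(2)] AE_completion[OF v(2)]
    by eventually_elim (simp add: f'_def complex_eq_iff)
  have "integrable lebesgue f'"
    by (rule integrable_cong_AE_imp[OF assms measurable_completion[OF m]]) (use ae in auto)
  then have "integrable lborel f'" using integrable_completion[OF m] by simp
  with m ae show thesis by (intro that[of f']) auto
qed

lemma fourier_cong_AE:
  assumes "integrable lebesgue f" "AE x in lebesgue. f x = f' x"
  shows "fourier f = fourier f'"
proof
  fix y
  have f': "f' \<in> Lmeas"
    by (rule borel_measurable_AE[OF borel_measurable_integrable[OF assms(1)] assms(2)])
  have c: "(\<lambda>t. cis (- 2 * pi * t * y)) \<in> Lmeas"
    using cis_measurable[of "- 2 * pi * y"] by (simp add: mult_ac)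
  show "fourier f y = fourier f' y"
    unfolding fourier_eq_cis
    by (intro integral_cong_AE borel_measurable_times c f' borel_measurable_integrable[OF assms(1)])
       (use assms(2) in auto)
qed

text \<open>Fubini's theorem for the absolutely integrable kernel
  \<open>f' t * g' y * cis (- 2 * pi * t * y)\<close>, whose exponential is symmetric in the two
  variables.\<close>

lemma fourier_multiplication_formula:
  assumes f: "integrable lebesgue f" and g: "integrable lebesgue g"
  shows "(LINT y|lebesgue. fourier f y * g y) = (LINT t|lebesgue. f t * fourier g t)"
proof -
  obtain f' where f': "f' \<in> borel_measurable borel" "integrable lborel f'" "AE x in lebesgue. f x = f' x"
    using integrable_lebesgue_borel_version[OF f] by blast
  obtain g' where g': "g' \<in> borel_measurable borel" "integrable lborel g'" "AE x in lebesgue. g x = g' x"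
    using integrable_lebesgue_borel_version[OF g] by blast
  note [measurable] = f'(1) g'(1)
  have fe: "fourier f = fourier f'" by (rule fourier_cong_AE[OF f f'(3)])
  have ge: "fourier g = fourier g'" by (rule fourier_cong_AE[OF g g'(3)])
  have cism: "(\<lambda>x. cis (- 2 * pi * fst x * snd x)) \<in> borel_measurable (borel \<Otimes>\<^sub>M borel)"
    unfolding borel_prod by (intro borel_measurable_continuous_onI continuous_intros)
  have cis1: "(\<lambda>t. cis (- 2 * pi * t * y)) \<in> borel_measurable borel" for y
    by (intro borel_measurable_continuous_onI continuous_intros)
  have F1: "fourier f' y = (LINT t|lborel. f' t * cis (- 2 * pi * t * y))" for y
    unfolding fourier_eq_cis by (rule integral_completion) (use cis1 in measurable)
  have F2: "fourier g' t = (LINT y|lborel. g' y * cis (- 2 * pi * t * y))" for t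
    unfolding fourier_eq_cis using cis1[of t]
    by (subst integral_completion) (auto simp: mult_ac)
  let ?K = "\<lambda>(t, y). f' t * g' y * cis (- 2 * pi * t * y)"
  have Km: "?K \<in> borel_measurable (lborel \<Otimes>\<^sub>M lborel)"
    using cism unfolding split_beta by measurable
  have int: "integrable (lborel \<Otimes>\<^sub>M lborel) ?K"
  proof (rule lborel_pair.Fubini_integrable[OF Km])
    have "(\<lambda>t. LINT y|lborel. norm (?K (t, y))) = (\<lambda>t. cmod (f' t) * (LINT y|lborel. cmod (g' y)))"
      by (simp add: norm_mult)
    then show "integrable lborel (\<lambda>t. LINT y|lborel. norm (?K (t, y)))"
      using f'(2) by simp
    show "AE t in lborel. integrable lborel (\<lambda>y. ?K (t, y))"
    proof (rule AE_I2, simp only: prod.case)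
      fix t
      show "integrable lborel (\<lambda>y. f' t * g' y * cis (- 2 * pi * t * y))"
      proof (rule Bochner_Integration.integrable_bound)
        show "integrable lborel (\<lambda>y. cmod (f' t) * cmod (g' y))" using g'(2) by simp
        have "(\<lambda>y. cis (- 2 * pi * t * y)) \<in> borel_measurable borel"
          by (intro borel_measurable_continuous_onI continuous_intros)
        then show "(\<lambda>y. f' t * g' y * cis (- 2 * pi * t * y)) \<in> borel_measurable lborel"
          by measurable
      qed (simp add: norm_mult)
    qed
  qed
  have gm: "g' \<in> Lmeas" "f' \<in> Lmeas"
    by (auto intro: measurable_completion)
  have if': "integrable lebesgue f'" "integrable lebesgue g'"
    using f'(2) g'(2) by (simp_all add: integrable_completion)
  have "(LINT y|lebesgue. fourier f y * g y) = (LINT y|lebesgue. fourier f' y * g' y)"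
    unfolding fe
    by (intro integral_cong_AE borel_measurable_times fourier_measurable if' gm borel_measurable_integrable[OF g])
       (use g'(3) in auto)
  also have "\<dots> = (LINT y|lborel. fourier f' y * g' y)"
    using borel_measurable_continuous_onI[OF fourier_continuous[OF if'(1)]] g'(1)
    by (intro integral_completion) (simp add: borel_measurable_times)
  also have "\<dots> = (LINT y|lborel. LINT t|lborel. f' t * g' y * cis (- 2 * pi * t * y))"
    unfolding F1 by (simp add: mult_ac flip: Bochner_Integration.integral_mult_right_zero)
  also have "\<dots> = (LINT t|lborel. LINT y|lborel. f' t * g' y * cis (- 2 * pi * t * y))"
    by (rule lborel_pair.Fubini_integral[OF int])
  also have "\<dots> = (LINT t|lborel. f' t * fourier g' t)"
    unfolding F2 by (simp add: mult.assoc)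
  also have "\<dots> = (LINT t|lebesgue. f' t * fourier g' t)"
    using borel_measurable_continuous_onI[OF fourier_continuous[OF if'(2)]] f'(1)
    by (intro integral_completion[symmetric]) (simp add: borel_measurable_times)
  also have "\<dots> = (LINT t|lebesgue. f t * fourier g t)"
    unfolding ge
    by (intro integral_cong_AE borel_measurable_times fourier_measurable if' gm borel_measurable_integrable[OF f])
       (use f'(3) in auto)
  finally show ?thesis .
qed

lemma fourier_cnj:
  assumes "integrable lebesgue g"
  shows "fourier (\<lambda>x. cnj (g x)) y = cnj (fourier g (- y))"
  unfolding fourier_eq_cis
  by (subst Bochner_Integration.integral_cnj [symmetric]) (simp add: cis_cnj)

text \<open>The candidate for the inverse transform is \<open>x \<mapsto> fourier g (- x)\<close>; its truncations have
  the right transform in the limit because \<open>\<parallel>fourier (1\<^sub>K f) - g\<parallel> = \<parallel>1\<^sub>K f - f\<parallel>\<close>, as one sees by expanding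
  both squares.\<close>

lemma has_fourier_L2_inverse_compact:
  assumes g: "g \<in> L2" and supp: "vanishes_off {- r..r} g"
  shows "has_fourier_L2 (\<lambda>x. fourier g (- x)) g"
proof -
  define f where "f x = fourier g (- x)" for x
  have gi: "integrable lebesgue g" by (rule L2_compact_integrable[OF g supp])
  have fL: "f \<in> L2" and nf: "L2_norm f = L2_norm g"
    using L2_affine[OF Plancherel_L1_L2(1)[OF g gi], of "-1" 0] Plancherel_L1_L2(2)[OF g gi]
    by (simp_all add: f_def[abs_def])
  define F where "F k = trunc k f" for k :: nat
  have F: "F k \<in> L2" for k unfolding F_def by (rule truncate_L2[OF fL])
  have Fi: "integrable lebesgue (F k)" for k unfolding F_def by (rule integrable_truncate[OF fL])
  note FF = Plancherel_L1_L2[OF F Fi]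
  \<comment> \<open>The multiplication formula shifts the transform from \<open>F k\<close> to the
    conjugate of \<open>g\<close>, whose transform is the conjugate of \<open>f\<close>; this
    matches the cross terms of the two squares.\<close>
  have "L2_inner (fourier (F k)) g = L2_inner (F k) f" for k
    unfolding L2_inner_def
    using fourier_multiplication_formula[OF Fi, of "\<lambda>x. cnj (g x)" k] gi
    by (simp add: fourier_cnj[OF gi] f_def)
  then have "(L2_dist (fourier (F k)) g)\<^sup>2 = (L2_dist (F k) f)\<^sup>2" for k
    unfolding L2_norm_diff_sq[OF FF(1) g] L2_norm_diff_sq[OF F fL] FF(2) nf by simp
  then have eq: "L2_dist (fourier (F k)) g = L2_dist (F k) f" for k
    using L2_norm_nonneg power2_eq_imp_eq by blast
  have t: "L2_tendsto F f sequentially"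
    unfolding F_def by (rule L2_truncate[OF fL])
  then have "L2_tendsto (\<lambda>k. fourier (F k)) g sequentially"
    using FF(1) g by (simp add: L2_tendsto_def eq)
  then show ?thesis
    unfolding has_fourier_L2_def f_def[symmetric] using t Fi by blast
qed

text \<open>A diagonal choice: from the approximating sequence of each pair one integrable function
  is taken that is within \<open>inverse (real (Suc k))\<close> on both sides of the
  transform.\<close>

lemma has_fourier_L2_closed:
  fixes f g :: "nat \<Rightarrow> real \<Rightarrow> complex"
  assumes fg: "\<And>k. has_fourier_L2 (f k) (g k)"
    and f: "L2_tendsto f F sequentially" and g: "L2_tendsto g G sequentially"
  shows "has_fourier_L2 F G"
proof -
  have "\<exists>h. integrable lebesgue h \<and> h \<in> L2 \<and> fourier h \<in> L2 \<and> L2_dist h (f k) \<le> inverse (real (Suc k))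
      \<and> L2_dist (fourier h) (g k) \<le> inverse (real (Suc k))" for k
  proof -
    define h where "h = fourier_seq (f k) (g k)"
    note h = fourier_seq[OF fg[of k], folded h_def]
    have "\<forall>\<^sub>F j in sequentially. L2_dist (h j) (f k) < inverse (real (Suc k))
        \<and> L2_dist (fourier (h j)) (g k) < inverse (real (Suc k))"
      by (intro eventually_conj order_tendstoD(2)[OF L2_tendstoD(3)[OF h(2)]]
          order_tendstoD(2)[OF L2_tendstoD(3)[OF h(3)]]) simp_all
    then obtain j where "L2_dist (h j) (f k) < inverse (real (Suc k))
        \<and> L2_dist (fourier (h j)) (g k) < inverse (real (Suc k))"
      by (auto simp: eventually_sequentially)
    then show ?thesis
      using h(1) L2_tendstoD(1)[OF h(2)] L2_tendstoD(1)[OF h(3)] by (intro exI[of _ "h j"]) auto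
  qed
  then obtain h where h: "\<And>k. integrable lebesgue (h k)" "\<And>k. h k \<in> L2" "\<And>k. fourier (h k) \<in> L2"
    "\<And>k. L2_dist (h k) (f k) \<le> inverse (real (Suc k))"
    "\<And>k. L2_dist (fourier (h k)) (g k) \<le> inverse (real (Suc k))"
    by metis
  have lim: "L2_tendsto u U sequentially"
    if u: "\<And>k. u k \<in> L2" and w: "L2_tendsto w U sequentially"
      and le: "\<And>k. L2_dist (u k) (w k) \<le> inverse (real (Suc k))" for u w :: "nat \<Rightarrow> real \<Rightarrow> complex" and U
  proof (rule L2_tendsto_if_dist_le[OF u L2_tendstoD(2)[OF w] _ always_eventually[OF allI]])
    show "(\<lambda>k. inverse (real (Suc k)) + L2_dist (w k) U) \<longlonglongrightarrow> 0"
      by (rule tendsto_add_zero[OF LIMSEQ_inverse_real_of_nat L2_tendstoD(3)[OF w]])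
    show "L2_dist (u k) U \<le> inverse (real (Suc k)) + L2_dist (w k) U" for k
      using L2_triangle_dist[OF u L2_tendstoD(1)[OF w] L2_tendstoD(2)[OF w], of k k] le[of k] by linarith
  qed
  show ?thesis
    unfolding has_fourier_L2_def
    using h(1) lim[OF h(2) f h(4)] lim[OF h(3) g h(5)] by blast
qed

text \<open>Truncations of \<open>g\<close> are inverted explicitly. By isometry these inverses form
  a Cauchy sequence; completeness provides a limit and closedness of the graph identifies its
  transform.\<close>

theorem has_fourier_L2_surjective:
  assumes g: "g \<in> L2"
  shows "\<exists>f. has_fourier_L2 f g"
proof -
  define G where "G k = trunc k g" for k :: nat
  have GL: "G k \<in> L2" for k unfolding G_def by (rule truncate_L2[OF g])
  define f where "f k = (\<lambda>x. fourier (G k) (- x))" for k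
  have fG: "has_fourier_L2 (f k) (G k)" for k
    unfolding f_def by (rule has_fourier_L2_inverse_compact[OF GL, where r="real k"]) (auto simp: G_def indicator_def)
  have Gt: "L2_tendsto G g sequentially" unfolding G_def by (rule L2_truncate[OF g])
  have "\<exists>F. L2_tendsto f F sequentially"
  proof (rule L2_complete)
    show "f k \<in> L2" for k by (rule has_fourier_L2D(1)[OF fG])
    fix e :: real assume e: "0 < e"
    have "\<forall>\<^sub>F k in sequentially. L2_dist (G k) g < e/2"
      using e by (intro order_tendstoD(2)[OF L2_tendstoD(3)[OF Gt]]) simp
    then obtain N where N: "\<And>k. k \<ge> N \<Longrightarrow> L2_dist (G k) g < e/2"
      by (auto simp: eventually_sequentially)
    have "L2_dist (f m) (f n) \<le> e" if "m \<ge> N" "n \<ge> N" for m n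
      using has_fourier_L2_norm[OF has_fourier_L2_diff[OF fG fG], of m n]
        L2_triangle_dist[OF GL g GL, of m n] N[OF that(1)] N[OF that(2)] L2_norm_minus_commute[of g "G n"]
      by linarith
    then show "\<exists>N. \<forall>m\<ge>N. \<forall>n\<ge>N. L2_dist (f m) (f n) \<le> e" by blast
  qed
  then obtain F where "L2_tendsto f F sequentially" by blast
  from has_fourier_L2_closed[OF fG this Gt] show ?thesis by blast
qed

lemma has_fourier_inv_fourier_L2: "g \<in> L2 \<Longrightarrow> has_fourier_L2 (inv_fourier_L2 g) g"
  unfolding inv_fourier_L2_def by (rule someI_ex[OF has_fourier_L2_surjective])

subsection \<open>Warping functions\<close>

lemma AE_lebesgue_iff_negligible: "(AE x in lebesgue. P x) \<longleftrightarrow> negligible {x. \<not> P x}"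
  for P :: "real \<Rightarrow> bool"
proof
  assume "AE x in lebesgue. P x"
  then obtain N where "N \<in> null_sets lebesgue" "{x \<in> space lebesgue. \<not> P x} \<subseteq> N"
    by (auto simp: eventually_ae_filter)
  then show "negligible {x. \<not> P x}"
    using negligible_subset[of N "{x. \<not> P x}"] by (simp add: negligible_iff_null_sets)
next
  assume "negligible {x. \<not> P x}"
  then show "AE x in lebesgue. P x"
    by (intro AE_I'[of "{x. \<not> P x}"]) (auto simp: negligible_iff_null_sets)
qed

locale warping =
  fixes D :: "real set" and \<Phi> v :: "real \<Rightarrow> real"
  assumes warping_function: "warping_function D \<Phi> v"
begin

abbreviation "\<Psi> \<equiv> inv_into D \<Phi>"
abbreviation "w \<equiv> warp_weight D \<Phi>"

lemma bij: "bij_betw \<Phi> D UNIV"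
  using warping_function by (simp add: warping_function_def)

lemma \<Phi>_\<Psi> [simp]: "\<Phi> (\<Psi> t) = t"
  using bij by (simp add: bij_betw_def f_inv_into_f)

lemma \<Psi>_in_D [simp]: "\<Psi> t \<in> D"
  using bij by (simp add: bij_betw_def inv_into_into)

lemma \<Psi>_\<Phi> [simp]: "y \<in> D \<Longrightarrow> \<Psi> (\<Phi> y) = y"
  using bij by (simp add: bij_betw_def inv_into_f_f)

lemma range_\<Psi>: "range \<Psi> = D"
  by (metis \<Psi>_\<Phi> \<Psi>_in_D image_subsetI rangeI subsetI subset_antisym)

lemma inj_\<Psi>: "inj \<Psi>"
  by (metis \<Phi>_\<Psi> injI)

lemma \<Psi>_differentiable: "\<Psi> differentiable_on UNIV"
  using warping_function by (simp add: warping_function_def C1_diff_imp_diff)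

lemma \<Phi>_differentiable: "\<Phi> differentiable_on D"
  using warping_function by (simp add: warping_function_def C1_diff_imp_diff)

lemma D_sets [measurable]: "D \<in> sets lebesgue"
  using warping_function by (auto simp: warping_function_def)

lemma w_weight: "continuous_on UNIV w" "0 < w t"
  using warping_function by (auto simp: warping_function_def moderate_def weight_def)

lemma v_weight: "continuous_on UNIV v" "0 < v t"
  using warping_function by (auto simp: warping_function_def submultiplicative_def weight_def)

lemma w_moderate: "w (x + y) \<le> v x * w y"
  using warping_function by (auto simp: warping_function_def moderate_def)

lemma \<Psi>_has_derivative: "(\<Psi> has_real_derivative w t) (at t)"
proof -
  have "\<Psi> differentiable (at t)"
    using \<Psi>_differentiable by (simp add: differentiable_on_def)
  then have "\<Psi> field_differentiable (at t)"
    by (metis field_differentiable_def real_differentiableE)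
  then show ?thesis
    unfolding warp_weight_def by (simp add: field_differentiable_derivI)
qed

lemma \<Psi>_mono: "x \<le> y \<Longrightarrow> \<Psi> x \<le> \<Psi> y"
  by (rule DERIV_nonneg_imp_nondecreasing) (use \<Psi>_has_derivative w_weight(2) in \<open>auto intro: less_imp_le\<close>)

lemma \<Phi>_in_Icc: "y \<in> D \<Longrightarrow> \<Phi> y \<in> {c..d} \<Longrightarrow> y \<in> {\<Psi> c..\<Psi> d}"
  using \<Psi>_mono[of c "\<Phi> y"] \<Psi>_mono[of "\<Phi> y" d] by auto

text \<open>The exceptional set on one side is contained in the image of the exceptional set on the
  other, and differentiable maps of the line send negligible sets to negligible sets.\<close>

lemma AE_transfer: "(AE y in lebesgue. y \<in> D \<longrightarrow> P (\<Phi> y)) \<longleftrightarrow> (AE t in lebesgue. P t)"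
proof
  assume "AE t in lebesgue. P t"
  then have "negligible (\<Psi> ` {t. \<not> P t})"
    unfolding AE_lebesgue_iff_negligible
    by (intro negligible_differentiable_image_negligible differentiable_on_subset[OF \<Psi>_differentiable]) auto
  moreover have "{y. \<not> (y \<in> D \<longrightarrow> P (\<Phi> y))} \<subseteq> \<Psi> ` {t. \<not> P t}"
    by (auto intro!: image_eqI[where x="\<Phi> _"])
  ultimately show "AE y in lebesgue. y \<in> D \<longrightarrow> P (\<Phi> y)"
    unfolding AE_lebesgue_iff_negligible by (rule negligible_subset)
next
  assume "AE y in lebesgue. y \<in> D \<longrightarrow> P (\<Phi> y)"
  then have "negligible (\<Phi> ` {y. \<not> (y \<in> D \<longrightarrow> P (\<Phi> y))})"
    unfolding AE_lebesgue_iff_negligible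
    by (intro negligible_differentiable_image_negligible differentiable_on_subset[OF \<Phi>_differentiable]) auto
  moreover have "{t. \<not> P t} \<subseteq> \<Phi> ` {y. \<not> (y \<in> D \<longrightarrow> P (\<Phi> y))}"
    by (auto intro!: image_eqI[where x="\<Psi> _"])
  ultimately show "AE t in lebesgue. P t"
    unfolding AE_lebesgue_iff_negligible by (rule negligible_subset)
qed

text \<open>Preimages of Lebesgue sets under \<open>\<Phi>\<close> are images under its inverse, and
  differentiable images of Lebesgue sets are Lebesgue sets.\<close>

lemma \<Phi>_measurable: "\<Phi> \<in> lebesgue_on D \<rightarrow>\<^sub>M lebesgue"
proof (rule measurableI)
  fix A :: "real set" assume A: "A \<in> sets lebesgue"
  have "\<Phi> -` A \<inter> D = \<Psi> ` A"
    by (auto intro!: image_eqI[where x="\<Phi> _"])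
  moreover have "\<Psi> ` A \<in> sets lebesgue"
    by (rule differentiable_image_in_sets_lebesgue[OF A]) (auto intro: differentiable_on_subset[OF \<Psi>_differentiable])
  ultimately show "\<Phi> -` A \<inter> space (lebesgue_on D) \<in> sets (lebesgue_on D)"
    by (auto simp: sets_restrict_space_iff space_restrict_space)
qed (auto simp: space_restrict_space)

lemma pullback_measurable:
  assumes "f \<in> Lmeas"
  shows "(\<lambda>y. if y \<in> D then f (\<Phi> y) else c) \<in> Lmeas"
  using measurable_compose[OF \<Phi>_measurable assms]
  by (subst measurable_If_restrict_space_iff) (auto simp: restrict_space_def)

lemma pullback_set:
  assumes "A \<in> sets lebesgue"
  shows "{y \<in> D. \<Phi> y \<in> A} \<in> sets lebesgue"
proof -
  have "{y \<in> D. \<Phi> y \<in> A} = \<Psi> ` A"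
    by (auto intro!: image_eqI[where x="\<Phi> _"])
  then show ?thesis
    using differentiable_image_in_sets_lebesgue[OF assms, of \<Psi>]
    by (auto intro: differentiable_on_subset[OF \<Psi>_differentiable])
qed

text \<open>The change of variables from \<open>y\<close> to \<open>\<Psi> t\<close>, with Jacobian
  \<open>w\<close>. The integrability premise is what allows the theorem on absolutely integrable
  functions to be applied.\<close>

lemma nn_integral_pullback:
  fixes f :: "real \<Rightarrow> real"
  assumes f: "f \<in> Lmeas" "\<And>t. 0 \<le> f t"
    and i: "integrable lebesgue (\<lambda>t. w t * f t)"
  shows "(\<integral>\<^sup>+y. ennreal (if y \<in> D then f (\<Phi> y) else 0) \<partial>lebesgue) = (\<integral>\<^sup>+t. ennreal (w t * f t) \<partial>lebesgue)"
proof -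
  have w0: "0 \<le> w t" for t using w_weight(2)[of t] by simp
  have si: "(\<lambda>t. \<bar>w t\<bar> * f (\<Phi> (\<Psi> t))) absolutely_integrable_on UNIV"
    using i w0 by (simp add: set_integrable_def abs_of_nonneg)
  have "(\<lambda>y. f (\<Phi> y)) absolutely_integrable_on range \<Psi> \<and>
      integral (range \<Psi>) (\<lambda>y. f (\<Phi> y)) = integral UNIV (\<lambda>t. \<bar>w t\<bar> * f (\<Phi> (\<Psi> t)))"
    using si has_absolute_integral_change_of_variables_1'[of UNIV \<Psi> w "\<lambda>y. f (\<Phi> y)"
        "integral UNIV (\<lambda>t. \<bar>w t\<bar> * f (\<Phi> (\<Psi> t)))"] \<Psi>_has_derivative inj_\<Psi>
    by auto
  then have ai: "(\<lambda>y. f (\<Phi> y)) absolutely_integrable_on D"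
    and eq: "integral D (\<lambda>y. f (\<Phi> y)) = integral UNIV (\<lambda>t. \<bar>w t\<bar> * f (\<Phi> (\<Psi> t)))"
    by (simp_all add: range_\<Psi>)
  have e: "(\<lambda>y. if y \<in> D then f (\<Phi> y) else 0) = (\<lambda>y. indicator D y *\<^sub>R f (\<Phi> y))"
    by (auto simp: fun_eq_iff)
  have "(\<integral>\<^sup>+y. ennreal (if y \<in> D then f (\<Phi> y) else 0) \<partial>lebesgue) = ennreal (LINT y|lebesgue. indicator D y *\<^sub>R f (\<Phi> y))"
    unfolding e[THEN fun_cong]
    by (rule nn_integral_eq_integral) (use ai f(2) in \<open>auto simp: set_integrable_def\<close>)
  also have "(LINT y|lebesgue. indicator D y *\<^sub>R f (\<Phi> y)) = integral D (\<lambda>y. f (\<Phi> y))"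
    using set_lebesgue_integral_eq_integral(2)[OF ai] by (simp add: set_lebesgue_integral_def)
  also have "\<dots> = (LINT t|lebesgue. w t * f t)"
    unfolding eq using set_lebesgue_integral_eq_integral(2)[OF si] w0 
    by (simp add: set_lebesgue_integral_def)
  also have "ennreal \<dots> = (\<integral>\<^sup>+t. ennreal (w t * f t) \<partial>lebesgue)"
    by (rule nn_integral_eq_integral[symmetric, OF i]) (use f(2) w0 in auto)
  finally show ?thesis .
qed

end

locale warped_prototype = warping +
  fixes \<theta> :: "real \<Rightarrow> complex"
  assumes \<theta>: "\<theta> \<in> L2_weighted (\<lambda>x. sqrt (v x))"
begin

lemma \<theta>_measurable: "\<theta> \<in> Lmeas"
proof -
  have "(\<lambda>x. complex_of_real (1 / sqrt (v x)) * (complex_of_real (sqrt (v x)) * \<theta> x)) \<in> Lmeas"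
  proof (rule borel_measurable_times)
    have "continuous_on UNIV (\<lambda>x. complex_of_real (1 / sqrt (v x)))"
      using v_weight by (intro continuous_intros) (auto simp: less_imp_neq[symmetric])
    then show "(\<lambda>x. complex_of_real (1 / sqrt (v x))) \<in> Lmeas"
      by (rule continuous_measurable_lebesgue)
    show "(\<lambda>x. complex_of_real (sqrt (v x)) * \<theta> x) \<in> Lmeas"
      using \<theta> L2_measurable by (simp add: L2_weighted_def)
  qed
  moreover have "(\<lambda>x. complex_of_real (1 / sqrt (v x)) * (complex_of_real (sqrt (v x)) * \<theta> x)) = \<theta>"
    using v_weight(2) by (auto simp: fun_eq_iff less_imp_neq[symmetric] simp flip: of_real_mult)
  ultimately show ?thesis by simp
qed

lemma \<theta>_shift_measurable: "(\<lambda>t. \<theta> (t - c)) \<in> Lmeas"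
  using measurable_compose[OF measurable_lebesgue_affine[of 1 "- c"] \<theta>_measurable] by simp

lemma v_\<theta>_integrable: "integrable lebesgue (\<lambda>t. v t * (cmod (\<theta> t))\<^sup>2)"
proof -
  have "(\<lambda>t. v t * (cmod (\<theta> t))\<^sup>2) = (\<lambda>t. (cmod (complex_of_real (sqrt (v t)) * \<theta> t))\<^sup>2)"
    using v_weight(2) by (auto simp: fun_eq_iff norm_mult power_mult_distrib less_imp_le)
  then show ?thesis using \<theta> L2_integrable by (simp add: L2_weighted_def)
qed

text \<open>Moderateness for the splitting of \<open>t\<close> into \<open>t - c\<close> and
  \<open>c\<close>: the weight at \<open>t\<close> is traded for a constant times the
  submultiplicative weight at the argument of the prototype, where square integrability is
  known.\<close>

lemma w_shift_le: "w t * (cmod (\<theta> (t - c)))\<^sup>2 \<le> w c * (v (t - c) * (cmod (\<theta> (t - c)))\<^sup>2)"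
  using mult_right_mono[OF w_moderate[of "t - c" c], of "(cmod (\<theta> (t - c)))\<^sup>2"] by (simp add: mult_ac)

lemma w_\<theta>_integrable: "integrable lebesgue (\<lambda>t. w t * (cmod (\<theta> (t - c)))\<^sup>2)"
proof (rule Bochner_Integration.integrable_bound)
  show "integrable lebesgue (\<lambda>t. w c * (v (t - c) * (cmod (\<theta> (t - c)))\<^sup>2))"
    using lebesgue_integrable_real_affine[OF v_\<theta>_integrable, of 1 "- c"] by simp
  show "(\<lambda>t. w t * (cmod (\<theta> (t - c)))\<^sup>2) \<in> Lmeas"
    using \<theta>_shift_measurable continuous_measurable_lebesgue[OF w_weight(1)] by measurable
  show "AE t in lebesgue. norm (w t * (cmod (\<theta> (t - c)))\<^sup>2) \<le> norm (w c * (v (t - c) * (cmod (\<theta> (t - c)))\<^sup>2))"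
    using w_shift_le v_weight(2) w_weight(2) by (intro AE_I2) (simp add: less_imp_le abs_mult)
qed

text \<open>The filter without its factor \<open>sqrt (a m)\<close>; the square of that factor
  cancels the \<open>1 / a m\<close> of Parseval's identity.\<close>

definition atom :: "int \<Rightarrow> real \<Rightarrow> complex" where
  "atom m y = (if y \<in> D then \<theta> (\<Phi> y - of_int m) else 0)"

lemma atom_measurable: "atom m \<in> Lmeas"
  unfolding atom_def[abs_def] by (rule pullback_measurable[OF \<theta>_shift_measurable])

lemma nn_integral_atom:
  assumes A: "A \<in> sets lebesgue"
  shows "(\<integral>\<^sup>+y. esq (atom m y) * indicator {y \<in> D. \<Phi> y \<in> A} y \<partial>lebesgue)
    = (\<integral>\<^sup>+t. ennreal (w t * (cmod (\<theta> (t - of_int m)))\<^sup>2) * indicator A t \<partial>lebesgue)"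
proof -
  define f where "f t = (cmod (\<theta> (t - of_int m)))\<^sup>2 * indicator A t" for t
  have fm: "f \<in> Lmeas"
    unfolding f_def[abs_def] using \<theta>_shift_measurable A by measurable
  have "integrable lebesgue (\<lambda>t. (w t * (cmod (\<theta> (t - of_int m)))\<^sup>2) * indicator A t)"
    by (rule integrable_real_mult_indicator[OF A w_\<theta>_integrable])
  then have "integrable lebesgue (\<lambda>t. w t * f t)" by (simp add: f_def mult.assoc)
  from nn_integral_pullback[OF fm _ this]
  have "(\<integral>\<^sup>+y. ennreal (if y \<in> D then f (\<Phi> y) else 0) \<partial>lebesgue) = (\<integral>\<^sup>+t. ennreal (w t * f t) \<partial>lebesgue)"
    by (simp add: f_def)
  moreover have "ennreal (if y \<in> D then f (\<Phi> y) else 0) = esq (atom m y) * indicator {y \<in> D. \<Phi> y \<in> A} y" for y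
    by (auto simp: f_def atom_def indicator_def)
  moreover have "ennreal (w t * f t) = ennreal (w t * (cmod (\<theta> (t - of_int m)))\<^sup>2) * indicator A t" for t
    by (auto simp: f_def indicator_def)
  ultimately show ?thesis by simp
qed

abbreviation "weighted_mass F m \<equiv> \<integral>\<^sup>+y. ennreal ((cmod (F y))\<^sup>2 * (cmod (atom m y))\<^sup>2) \<partial>lebesgue"
abbreviation "mass m E \<equiv> \<integral>\<^sup>+y. esq (atom m y) * indicator E y \<partial>lebesgue"

lemma atom_L2: "atom m \<in> L2"
proof -
  have "(\<integral>\<^sup>+y. esq (atom m y) \<partial>lebesgue)
      = (\<integral>\<^sup>+y. esq (atom m y) * indicator {y \<in> D. \<Phi> y \<in> UNIV} y \<partial>lebesgue)"
    by (intro nn_integral_cong) (auto simp: atom_def indicator_def)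
  also have "\<dots> = (\<integral>\<^sup>+t. ennreal (w t * (cmod (\<theta> (t - of_int m)))\<^sup>2) \<partial>lebesgue)"
    by (subst nn_integral_atom) auto
  also have "\<dots> < \<infinity>"
    using nn_integral_eq_integral[OF w_\<theta>_integrable[of "of_int m"]] w_weight(2) by (simp add: less_imp_le)
  finally show ?thesis using atom_measurable by (simp add: L2_iff_nn)
qed

text \<open>On the slab \<open>\<Phi>\<^sup>-\<^sup>1[j, j + 1)\<close>, moderateness turns the \<open>m\<close>-th term into the \<open>L\<^sup>2\<^sub>v\<close>-mass of \<open>\<theta>\<close> on
  \<open>[j - m, j - m + 1)\<close>; these intervals tile the line.\<close>

lemma sum_atoms_on_slab:
  assumes a: "\<And>m. 0 < a m" and C: "\<And>m. a m * w (of_int m) \<le> C"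
  shows "(NNSUM m. ennreal (a m) * (\<integral>\<^sup>+y. esq (atom m y)
      * indicator {y \<in> D. \<Phi> y \<in> {of_int j..<of_int j + 1}} y \<partial>lebesgue))
    \<le> ennreal C * (\<integral>\<^sup>+t. ennreal (v t * (cmod (\<theta> t))\<^sup>2) \<partial>lebesgue)"
proof -
  have C0: "0 \<le> C" using C[of 0] a[of 0] w_weight(2)[of 0] by (smt (verit) mult_pos_pos of_int_0)
  let ?V = "\<lambda>t. ennreal (v t * (cmod (\<theta> t))\<^sup>2)"
  let ?t = "\<lambda>k::int. \<integral>\<^sup>+t. ?V t * indicator {of_int k * 1..<(of_int k + 1) * 1} t \<partial>lebesgue"
  have V[measurable]: "?V \<in> Lmeas"
    using borel_measurable_integrable[OF v_\<theta>_integrable] by measurable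
  have "ennreal (a m) * (\<integral>\<^sup>+y. esq (atom m y)
      * indicator {y \<in> D. \<Phi> y \<in> {of_int j..<of_int j + 1}} y \<partial>lebesgue) \<le> ennreal C * ?t (j - m)" for m
  proof -
    let ?A = "{of_int j..<of_int j + 1} :: real set"
    have "(\<integral>\<^sup>+y. esq (atom m y) * indicator {y \<in> D. \<Phi> y \<in> ?A} y \<partial>lebesgue)
      = (\<integral>\<^sup>+t. ennreal (w t * (cmod (\<theta> (t - of_int m)))\<^sup>2) * indicator ?A t \<partial>lebesgue)"
      by (rule nn_integral_atom) auto
    also have "\<dots> \<le> (\<integral>\<^sup>+t. ennreal (w (of_int m)) * (?V (t - of_int m) * indicator ?A t) \<partial>lebesgue)"
    proof (rule nn_integral_mono)
      fix t
      have "ennreal (w t * (cmod (\<theta> (t - of_int m)))\<^sup>2) \<le> ennreal (w (of_int m)) * ?V (t - of_int m)"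
        using w_shift_le[of t "of_int m"] w_weight(2)[of "of_int m"] v_weight(2)[of "t - of_int m"]
        by (subst ennreal_mult[symmetric]) (auto intro: ennreal_leI)
      then show "ennreal (w t * (cmod (\<theta> (t - of_int m)))\<^sup>2) * indicator ?A t
          \<le> ennreal (w (of_int m)) * (?V (t - of_int m) * indicator ?A t)"
        by (auto simp: indicator_def)
    qed
    also have "\<dots> = ennreal (w (of_int m)) * (\<integral>\<^sup>+t. ?V (t - of_int m) * indicator ?A t \<partial>lebesgue)"
    proof (rule nn_integral_cmult)
      show "(\<lambda>t. ?V (t - of_int m) * indicator ?A t) \<in> Lmeas"
        using measurable_compose[OF measurable_lebesgue_affine[of 1 "- of_int m"] V]
        by (intro borel_measurable_times_ennreal borel_measurable_indicator) auto
    qed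
    also have "(\<integral>\<^sup>+t. ?V (t - of_int m) * indicator ?A t \<partial>lebesgue) = ?t (j - m)"
    proof -
      have "?t (j - m) = (\<integral>\<^sup>+t. ?V (- of_int m + t)
          * indicator {of_int (j - m) * 1..<(of_int (j - m) + 1) * 1} (- of_int m + t) \<partial>lebesgue)"
        by (rule nn_integral_lebesgue_shift)
           (auto intro!: borel_measurable_times_ennreal borel_measurable_indicator V)
      also have "\<dots> = (\<integral>\<^sup>+t. ?V (t - of_int m) * indicator ?A t \<partial>lebesgue)"
        by (simp, intro nn_integral_cong) (auto simp: indicator_def)
      finally show ?thesis ..
    qed
    finally have "ennreal (a m) * (\<integral>\<^sup>+y. esq (atom m y) * indicator {y \<in> D. \<Phi> y \<in> ?A} y \<partial>lebesgue)
        \<le> ennreal (a m) * (ennreal (w (of_int m)) * ?t (j - m))"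
      by (rule mult_left_mono) simp
    also have "\<dots> = ennreal (a m * w (of_int m)) * ?t (j - m)"
      using a[of m] w_weight(2)[of "of_int m"] by (simp add: ennreal_mult mult.assoc)
    also have "\<dots> \<le> ennreal C * ?t (j - m)"
      by (intro mult_right_mono ennreal_leI C) simp
    finally show ?thesis .
  qed
  then have "(NNSUM m. ennreal (a m) * (\<integral>\<^sup>+y. esq (atom m y)
      * indicator {y \<in> D. \<Phi> y \<in> {of_int j..<of_int j + 1}} y \<partial>lebesgue))
    \<le> (NNSUM m. ennreal C * ?t (j - m))"
    by (intro nn_integral_mono)
  also have "\<dots> = ennreal C * (NNSUM m. ?t (j - m))"
    by (rule nn_integral_cmult) simp
  also have "(NNSUM m. ?t (j - m)) = (NNSUM k. ?t k)"
    by (rule nn_integral_bij_count_space) (rule bij_betw_byWitness[where f'="\<lambda>m. j - m"], auto)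
  also have "\<dots> = (\<integral>\<^sup>+t. ?V t \<partial>lebesgue)"
    by (rule nn_integral_tiles[symmetric]) auto
  finally show ?thesis .
qed

end

subsection \<open>Frame coefficients and the necessary conditions\<close>

definition coeff_energy :: "real \<Rightarrow> (real \<Rightarrow> complex) \<Rightarrow> ennreal" where
  "coeff_energy a H = (NNSUM n. esq (LINT x|lebesgue. H x * echar a n x))"

lemma coeff_energy_eq:
  assumes "a > 0" "H \<in> L2" "vanishes_off {s..s + 1/a} H"
  shows "coeff_energy a H = ennreal ((L2_norm H)\<^sup>2 / a)"
  unfolding coeff_energy_def by (rule Fourier_series_Parseval[OF assms])

lemma cmod_sum_sq_le:
  fixes c :: "'i \<Rightarrow> complex"
  shows "(cmod (\<Sum>j\<in>J. c j))\<^sup>2 \<le> real (card J) * (\<Sum>j\<in>J. (cmod (c j))\<^sup>2)"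
proof -
  have "(cmod (\<Sum>j\<in>J. c j))\<^sup>2 \<le> (\<Sum>j\<in>J. 1 * cmod (c j))\<^sup>2"
    by (intro power_mono) (auto intro: norm_sum)
  also have "\<dots> \<le> (\<Sum>j\<in>J. 1\<^sup>2) * (\<Sum>j\<in>J. (cmod (c j))\<^sup>2)"
    by (rule Cauchy_Schwarz_ineq_sum)
  finally show ?thesis by simp
qed

text \<open>An interval of length \<open>l\<close> is cut into \<open>\<lceil>l a\<rceil>\<close> pieces of length at most \<open>1/a\<close>, to each of which
  Parseval's identity applies.\<close>

lemma coeff_energy_le:
  assumes a: "a > 0" and H: "H \<in> L2" and l: "l \<ge> 0" and supp: "\<And>x. x \<notin> {s..<s + l} \<Longrightarrow> H x = 0"
  shows "coeff_energy a H \<le> ennreal ((1 + l * a) / a * (L2_norm H)\<^sup>2)"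
proof -
  define N where "N = nat \<lceil>l * a\<rceil>"
  have "real N = of_int \<lceil>l * a\<rceil>" using l a by (simp add: N_def)
  then have N: "l * a \<le> real N" "real N \<le> 1 + l * a"
    using ceiling_correct[of "l * a"] by linarith+
  define I where "I j = {s + real j / a..<s + real (Suc j) / a}" for j
  define Hj where "Hj j x = (if x \<in> I j then H x else 0)" for j x
  have HjL: "Hj j \<in> L2" for j
  proof (rule L2_dominated[OF H, where C=1])
    show "Hj j \<in> Lmeas"
      unfolding Hj_def[abs_def] I_def using L2_measurable[OF H] by (intro measurable_If_set) auto
  qed (auto simp: Hj_def)
  have Hsum: "H x = (\<Sum>j<N. Hj j x)" and Hsq: "(cmod (H x))\<^sup>2 = (\<Sum>j<N. (cmod (Hj j x))\<^sup>2)" for x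
  proof -
    \<comment> \<open>\<open>k\<close> numbers the only piece that can contain \<open>x\<close>;
      half-open pieces make it unique.\<close>
    define k where "k = nat \<lfloor>(x - s) * a\<rfloor>"
    have *: "H x = 0 \<or> (k < N \<and> (\<forall>j. x \<in> I j \<longleftrightarrow> j = k))"
    proof (cases "x \<in> {s..<s + l}")
      case True
      have p: "0 \<le> (x - s) * a" using True a by simp
      have j: "x \<in> I j \<longleftrightarrow> j = k" for j
      proof -
        have "x \<in> I j \<longleftrightarrow> real j \<le> (x - s) * a \<and> (x - s) * a < real (Suc j)"
          using a by (auto simp: I_def field_simps)
        also have "\<dots> \<longleftrightarrow> \<lfloor>(x - s) * a\<rfloor> = int j" by (simp add: floor_eq_iff add.commute)
        also have "\<dots> \<longleftrightarrow> j = k" using p unfolding k_def by auto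
        finally show ?thesis .
      qed
      have "real k \<le> (x - s) * a" using p by (simp add: k_def)
      also have "\<dots> < l * a" using True a by (intro mult_strict_right_mono) auto
      finally have "real k < real N" using N by linarith
      with j show ?thesis by simp
    qed (use supp in auto)
    have z: "(\<Sum>j<N. if j = k then y else 0) = (if k < N then y else 0)" for y :: "'z::comm_monoid_add"
      by simp
    show "H x = (\<Sum>j<N. Hj j x)"
      using * z[of "H x"] by (cases "H x = 0") (auto simp: Hj_def cong: if_cong)
    show "(cmod (H x))\<^sup>2 = (\<Sum>j<N. (cmod (Hj j x))\<^sup>2)"
    proof (cases "H x = 0")
      case False
      then have "(cmod (Hj j x))\<^sup>2 = (if j = k then (cmod (H x))\<^sup>2 else 0)" for j
        using * by (simp add: Hj_def)
      then show ?thesis using * False by simp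
    qed (simp add: Hj_def cong: if_cong)
  qed
  have Eint: "integrable lebesgue (\<lambda>x. Hj j x * echar a n x)" for j n
  proof (rule Bochner_Integration.integrable_bound)
    show "integrable lebesgue (Hj j)"
      by (rule L2_compact_integrable[OF HjL, of "s + real j / a" "s + real (Suc j) / a"]) (auto simp: Hj_def I_def)
    show "(\<lambda>x. Hj j x * echar a n x) \<in> Lmeas"
      by (intro borel_measurable_times L2_measurable[OF HjL] echar_measurable)
  qed (simp add: norm_mult)
  \<comment> \<open>Coefficients of different pieces may interfere. Cauchy-Schwarz bounds this by
    the number \<open>N\<close> of pieces, which is where the factor \<open>1 + l * a\<close> comes
    from.\<close>
  have "coeff_energy a H \<le> (NNSUM n. ennreal (real N) * (\<Sum>j<N. esq (LINT x|lebesgue. Hj j x * echar a n x)))"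
    unfolding coeff_energy_def
  proof (rule nn_integral_mono)
    fix n
    have "(LINT x|lebesgue. H x * echar a n x) = (\<Sum>j<N. LINT x|lebesgue. Hj j x * echar a n x)"
      unfolding Hsum sum_distrib_right by (rule Bochner_Integration.integral_sum) (rule Eint)
    then have "(cmod (LINT x|lebesgue. H x * echar a n x))\<^sup>2
        \<le> real N * (\<Sum>j<N. (cmod (LINT x|lebesgue. Hj j x * echar a n x))\<^sup>2)"
      using cmod_sum_sq_le[of "\<lambda>j. LINT x|lebesgue. Hj j x * echar a n x" "{..<N}"] by simp
    then show "esq (LINT x|lebesgue. H x * echar a n x)
        \<le> ennreal (real N) * (\<Sum>j<N. esq (LINT x|lebesgue. Hj j x * echar a n x))"
      by (simp add: sum_ennreal sum_nonneg ennreal_leI flip: ennreal_mult)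
  qed
  also have "\<dots> = ennreal (real N) * (\<Sum>j<N. coeff_energy a (Hj j))"
    unfolding coeff_energy_def by (subst nn_integral_cmult) (simp_all add: nn_integral_sum del: sum_ennreal)
  also have "(\<Sum>j<N. coeff_energy a (Hj j)) = (\<Sum>j<N. ennreal ((L2_norm (Hj j))\<^sup>2 / a))"
  proof (rule sum.cong[OF refl])
    fix j
    show "coeff_energy a (Hj j) = ennreal ((L2_norm (Hj j))\<^sup>2 / a)"
      using a by (intro coeff_energy_eq[OF a HjL, of "s + real j / a"])
        (auto simp: Hj_def I_def add_divide_distrib)
  qed
  also have "\<dots> = ennreal ((L2_norm H)\<^sup>2 / a)"
  proof -
    have "(L2_norm H)\<^sup>2 = (\<Sum>j<N. (L2_norm (Hj j))\<^sup>2)"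
      unfolding L2_norm_sq Hsq by (rule Bochner_Integration.integral_sum) (rule L2_integrable[OF HjL])
    then show ?thesis using a by (simp add: sum_ennreal sum_divide_distrib)
  qed
  also have "ennreal (real N) * \<dots> = ennreal (real N * ((L2_norm H)\<^sup>2 / a))"
    by (rule ennreal_mult[symmetric]) (use a in simp_all)
  also have "\<dots> \<le> ennreal ((1 + l * a) / a * (L2_norm H)\<^sup>2)"
    using mult_right_mono[OF N(2), of "(L2_norm H)\<^sup>2 / a"] a by (intro ennreal_leI) simp
  finally show ?thesis .
qed

text \<open>The hypothesis is tested on the set \<open>E\<close> where the inequality fails. There
  the integral of \<open>u - w\<close> must vanish although the integrand is positive, so
  \<open>E\<close> is null; finiteness is required to cancel the integral of
  \<open>w\<close>.\<close>

lemma AE_le_if_integrals_le: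
  fixes u w :: "real \<Rightarrow> ennreal"
  assumes [measurable]: "u \<in> Lmeas" "w \<in> Lmeas"
    and S: "S \<in> sets lebesgue"
    and fin: "(\<integral>\<^sup>+x. u x * indicator S x \<partial>lebesgue) < top \<or> (\<integral>\<^sup>+x. w x * indicator S x \<partial>lebesgue) < top"
    and le: "\<And>E. E \<in> sets lebesgue \<Longrightarrow> E \<subseteq> S \<Longrightarrow>
      (\<integral>\<^sup>+x. u x * indicator E x \<partial>lebesgue) \<le> (\<integral>\<^sup>+x. w x * indicator E x \<partial>lebesgue)"
  shows "AE x in lebesgue. x \<in> S \<longrightarrow> u x \<le> w x"
proof -
  define E where "E = {x \<in> space lebesgue. w x < u x} \<inter> S"
  have E[measurable]: "E \<in> sets lebesgue" unfolding E_def using S by measurable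
  have ES: "E \<subseteq> S" by (simp add: E_def)
  let ?I = "\<lambda>f X. \<integral>\<^sup>+x. f x * indicator X x \<partial>lebesgue"
  \<comment> \<open>Since \<open>w < u\<close> on \<open>E\<close>, finiteness of either integral
    over \<open>S\<close> makes that of \<open>w\<close> over \<open>E\<close> finite.\<close>
  have "?I w E \<le> ?I w S" "?I w E \<le> ?I u S"
    by (intro nn_integral_mono; auto simp: E_def indicator_def)+
  then have wfin: "?I w E \<noteq> \<infinity>" using fin by (auto simp: top_unique)
  have "?I w E + ?I (\<lambda>x. u x - w x) E = (\<integral>\<^sup>+x. w x * indicator E x + (u x - w x) * indicator E x \<partial>lebesgue)"
    by (subst nn_integral_add) auto
  also have "\<dots> = ?I u E"
    by (intro nn_integral_cong) (auto simp: E_def indicator_def intro!: add_diff_inverse_ennreal less_imp_le)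
  also have "\<dots> \<le> ?I w E + 0" using le[OF E ES] by simp
  finally have "?I (\<lambda>x. u x - w x) E \<le> 0"
    using wfin ennreal_add_left_cancel_le by blast
  then have "AE x in lebesgue. (u x - w x) * indicator E x = 0"
    by (subst (asm) le_zero_eq, subst (asm) nn_integral_0_iff_AE) auto
  then show ?thesis
  proof eventually_elim
    case (elim x)
    show ?case
    proof (rule impI, rule ccontr)
      assume x: "x \<in> S" "\<not> u x \<le> w x"
      then have "x \<in> E" by (simp add: E_def)
      with elim x show False by (simp add: diff_eq_0_iff_ennreal not_le)
    qed
  qed
qed

lemma borel_measurable_nn_integral_int [measurable]:
  fixes f :: "int \<Rightarrow> 'a \<Rightarrow> ennreal"
  assumes "\<And>m. f m \<in> borel_measurable M"
  shows "(\<lambda>x. NNSUM m. f m x) \<in> borel_measurable M"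
proof -
  have b: "bij_betw (from_nat_into (UNIV :: int set)) UNIV UNIV"
    by (intro bij_betw_from_nat_into) (auto simp: infinite_UNIV_int)
  have "(NNSUM m. f m x) = (\<Sum>n. f (from_nat_into UNIV n) x)" for x
    by (simp add: nn_integral_bij_count_space[OF b, symmetric] nn_integral_count_space_nat)
  then show ?thesis using assms by simp
qed

lemma shift_sum_eq: "shift_sum \<theta> t = (NNSUM m. esq (\<theta> (t - of_int m)))"
  by (simp add: shift_sum_def translate_def infsum_ennreal_eq_nn_integral infinite_UNIV_int)

lemma infinite_UNIV_int_prod: "infinite (UNIV :: (int \<times> int) set)"
  by (simp add: finite_prod infinite_UNIV_int)

lemma nn_integral_count_space_prod_int:
  fixes f :: "int \<times> int \<Rightarrow> ennreal"
  shows "(\<Sum>\<^sub>\<infinity>i. f i) = (NNSUM m. NNSUM n. f (m, n))"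
  by (simp add: infsum_ennreal_eq_nn_integral[OF infinite_UNIV_int_prod] nn_integral_fst_count_space)

lemma (in warped_prototype) atom_sq_measurable: "(\<lambda>y. esq (atom m y)) \<in> Lmeas"
  using atom_measurable[of m] by measurable

section \<open>Coefficients of a warped filter bank on the Fourier side\<close>

locale filter_bank = warped_prototype +
  fixes a :: "int \<Rightarrow> real"
  assumes a_pos: "0 < a m"
begin

abbreviation "G \<equiv> warped_filter_bank D \<Phi> \<theta> a"
abbreviation "g \<equiv> warped_filter D \<Phi> \<theta> a"
abbreviation "demod F m \<equiv> \<lambda>y. F y * cnj (g m y)"

lemma filter_eq: "g m y = of_real (sqrt (a m)) * atom m y"
  by (simp add: warped_filter_def atom_def)

lemma filter_L2: "g m \<in> L2"
  unfolding filter_eq[abs_def] by (rule L2_cmult[OF atom_L2])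

lemma filter_norm_sq: "(cmod (g m y))\<^sup>2 = a m * (cmod (atom m y))\<^sup>2"
  using a_pos[of m] by (simp add: filter_eq norm_mult power_mult_distrib less_imp_le)

lemma filter_bank_has_fourier:
  "has_fourier_L2 (G (m, n)) (\<lambda>y. cis (- 2 * pi * (of_int n * a m) * y) * g m y)"
  unfolding warped_filter_bank_def prod.case
  by (rule has_fourier_L2_translate[OF has_fourier_inv_fourier_L2[OF filter_L2]])

lemma band_space_fourier:
  assumes "f \<in> band_space D"
  obtains F where "F \<in> L2" "vanishes_off D F" "has_fourier_L2 f F"
  using assms by (auto simp: band_space_def L2_on_def)

lemma band_spaceI:
  assumes "has_fourier_L2 f F" "vanishes_off D F"
  shows "f \<in> band_space D"
  using assms has_fourier_L2D[OF assms(1)] by (auto simp: band_space_def L2_on_def)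

lemma inner_filter_bank:
  assumes "has_fourier_L2 f F"
  shows "L2_inner f (G (m, n)) = (LINT y|lebesgue. (F y * cnj (g m y)) * echar (a m) n y)"
proof -
  have "L2_inner f (G (m, n)) = L2_inner F (\<lambda>y. cis (- 2 * pi * (of_int n * a m) * y) * g m y)"
    by (rule has_fourier_L2_inner[OF assms filter_bank_has_fourier, symmetric])
  also have "\<dots> = (LINT y|lebesgue. (F y * cnj (g m y)) * echar (a m) n y)"
    unfolding L2_inner_def echar_def
    by (intro Bochner_Integration.integral_cong) (auto simp: cis_cnj mult_ac)
  finally show ?thesis .
qed

lemma coeff_sum_eq:
  assumes "has_fourier_L2 f F"
  shows "coeff_sum G f = (NNSUM m. coeff_energy (a m) (demod F m))"
  unfolding coeff_sum_def nn_integral_count_space_prod_int coeff_energy_def inner_filter_bank[OF assms] ..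

text \<open>The free constant serves two purposes: \<open>c = 1\<close> for Parseval's identity and
  \<open>c = 1 + l * a m\<close> for the estimate on an interval of length \<open>l\<close>.\<close>

lemma L2_norm_demod:
  assumes L: "demod F m \<in> L2" and F: "F \<in> Lmeas" and c: "0 \<le> c"
  shows "ennreal (c / a m * (L2_norm (demod F m))\<^sup>2)
    = ennreal c * weighted_mass F m"
proof -
  note [measurable] = F atom_measurable
  have c': "0 \<le> c / a m" using c a_pos[of m] by simp
  have "ennreal (c / a m * (L2_norm (demod F m))\<^sup>2) = ennreal (c / a m) * (\<integral>\<^sup>+y. esq (demod F m y) \<partial>lebesgue)"
    unfolding nn_eq_L2_norm[OF L] by (rule ennreal_mult[OF c']) simp
  also have "\<dots> = (\<integral>\<^sup>+y. ennreal (c / a m) * esq (demod F m y) \<partial>lebesgue)"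
    using L2_measurable[OF L] by (intro nn_integral_cmult[symmetric]) simp
  also have "\<dots> = (\<integral>\<^sup>+y. ennreal c * ennreal ((cmod (F y))\<^sup>2 * (cmod (atom m y))\<^sup>2) \<partial>lebesgue)"
    using c c' a_pos[of m]
    by (intro nn_integral_cong) (simp add: norm_mult power_mult_distrib filter_norm_sq flip: ennreal_mult)
  also have "\<dots> = ennreal c * weighted_mass F m"
    by (rule nn_integral_cmult) simp
  finally show ?thesis .
qed

lemma coeff_energy_atom:
  assumes L: "demod F m \<in> L2" and F: "F \<in> Lmeas"
    and supp: "vanishes_off {s..s + 1 / a m} (demod F m)"
  shows "coeff_energy (a m) (demod F m)
    = weighted_mass F m"
  using coeff_energy_eq[OF a_pos L supp] L2_norm_demod[OF L F, of 1] by simp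

lemma indicator_mult_filter_L2:
  assumes "E \<in> sets lebesgue"
  shows "demod (indicator E) m \<in> L2"
  by (rule L2_bounded_mult[OF L2_cnj[OF filter_L2] borel_measurable_indicator[OF assms], where C=1])
     (simp add: indicator_def)

lemma indicator_mult_atom:
  "ennreal ((cmod (indicator E y :: complex))\<^sup>2 * (cmod (atom m y))\<^sup>2) = esq (atom m y) * indicator E y"
  by (simp add: indicator_def)

lemma coeff_energy_indicator:
  assumes E: "E \<in> sets lebesgue" and supp: "vanishes_off {s..s + 1 / a m} (demod (indicator E) m)"
  shows "coeff_energy (a m) (demod (indicator E) m) = mass m E"
  by (subst coeff_energy_atom[OF indicator_mult_filter_L2[OF E] borel_measurable_indicator[OF E] supp])
     (simp add: indicator_mult_atom)

lemma coeff_energy_indicator_le: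
  assumes E: "E \<in> sets lebesgue" "E \<subseteq> {s..<s + l}" and l: "l \<ge> 0"
  shows "coeff_energy (a m) (demod (indicator E) m) \<le> ennreal (1 + l * a m) * mass m E"
proof -
  have c: "0 \<le> 1 + l * a m" using l a_pos[of m] by simp
  have "demod (indicator E) m x = 0" if "x \<notin> {s..<s + l}" for x
    using E(2) that by (auto simp: indicator_def)
  then have "coeff_energy (a m) (demod (indicator E) m)
      \<le> ennreal ((1 + l * a m) / a m * (L2_norm (demod (indicator E) m))\<^sup>2)"
    by (rule coeff_energy_le[OF a_pos indicator_mult_filter_L2[OF E(1)] l])
  then show ?thesis
    unfolding L2_norm_demod[OF indicator_mult_filter_L2[OF E(1)] borel_measurable_indicator[OF E(1)] c]
      indicator_mult_atom .
qed

text \<open>Surjectivity of the transform supplies a band-limited function with prescribed indicator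
  transform, and isometry converts its squared norm into the measure of \<open>E\<close>.\<close>

lemma test_function:
  assumes E: "E \<in> sets lebesgue" "E \<subseteq> D" "emeasure lebesgue E < \<infinity>"
  obtains f where "f \<in> band_space D" "has_fourier_L2 f (indicator E)"
    "ennreal ((L2_norm f)\<^sup>2) = emeasure lebesgue E"
proof -
  have sq: "(cmod (indicator E x :: complex))\<^sup>2 = indicat_real E x" for x by (simp add: indicator_def)
  have L: "(indicator E :: real \<Rightarrow> complex) \<in> L2"
    using E(1) integrable_real_indicator[OF E(1,3)] by (simp add: L2_def sq borel_measurable_indicator)
  obtain f where f: "has_fourier_L2 f (indicator E)"
    using has_fourier_L2_surjective[OF L] by blast
  have "ennreal ((L2_norm f)\<^sup>2) = (\<integral>\<^sup>+x. esq (indicator E x :: complex) \<partial>lebesgue)"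
    using nn_eq_L2_norm[OF L] has_fourier_L2_norm[OF f] by simp
  also have "\<dots> = emeasure lebesgue E"
    unfolding sq ennreal_indicator by (rule nn_integral_indicator[OF E(1)])
  finally show thesis
    using f E(2) by (intro that[of f] band_spaceI[OF f]) (auto simp: indicator_def)
qed

definition energy :: "real \<Rightarrow> ennreal" where
  "energy y = (NNSUM m. esq (atom m y))"

lemma energy_measurable: "energy \<in> Lmeas"
  unfolding energy_def[abs_def] by (intro borel_measurable_nn_integral_int atom_sq_measurable)

lemma shift_sum_pullback: "y \<in> D \<Longrightarrow> shift_sum \<theta> (\<Phi> y) = energy y"
  by (simp add: energy_def shift_sum_eq atom_def)

text \<open>Only finitely many channels are treated at a time: for a finite set \<open>M\<close>
  there is a positive length on which Parseval's identity is exact for all channels of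
  \<open>M\<close> simultaneously, while the periods of all channels together may have infimum
  0.\<close>

theorem bessel_imp_shift_sum_le:
  assumes bessel: "bessel_sequence (band_space D) G B"
  shows "AE t in lebesgue. shift_sum \<theta> t \<le> ennreal B"
proof -
  note [measurable] = atom_measurable
  have fin: "AE y in lebesgue. y \<in> D \<longrightarrow> (\<Sum>m\<in>M. esq (atom m y)) \<le> ennreal B" if M: "finite M" for M
  proof -
    \<comment> \<open>Inserting 1 gives the minimum a meaning when \<open>M\<close> is
      empty.\<close>
    define \<delta> where "\<delta> = Min (insert 1 ((\<lambda>m. 1 / a m) ` M))"
    have \<delta>: "\<delta> > 0" using M a_pos by (simp add: \<delta>_def)
    have \<delta>a: "\<delta> \<le> 1 / a m" if "m \<in> M" for m
      unfolding \<delta>_def using M that by (intro Min_le) auto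
    have "AE y in lebesgue. y \<in> D \<inter> {of_int k * \<delta>..<(of_int k + 1) * \<delta>} \<longrightarrow>
        (\<Sum>m\<in>M. esq (atom m y)) \<le> ennreal B" for k :: int
    proof (rule AE_le_if_integrals_le)
      let ?S = "D \<inter> {of_int k * \<delta>..<(of_int k + 1) * \<delta>}"
      show "(\<lambda>y. \<Sum>m\<in>M. esq (atom m y)) \<in> Lmeas"
        by (intro borel_measurable_sum atom_sq_measurable)
      show "(\<lambda>y. ennreal B) \<in> Lmeas" by simp
      show S: "?S \<in> sets lebesgue" by (intro sets.Int D_sets) auto
      have "emeasure lebesgue ?S \<le> emeasure lebesgue {of_int k * \<delta>..<(of_int k + 1) * \<delta>}"
        by (rule emeasure_mono) auto
      also have "\<dots> < \<infinity>" using \<delta> by (simp add: emeasure_lborel_Ico)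
      finally have Sfin: "emeasure lebesgue ?S < \<infinity>" .
      then show "(\<integral>\<^sup>+x. (\<Sum>m\<in>M. esq (atom m x)) * indicator ?S x \<partial>lebesgue) < top
          \<or> (\<integral>\<^sup>+x. ennreal B * indicator ?S x \<partial>lebesgue) < top"
        using S by (simp add: nn_integral_cmult_indicator ennreal_mult_less_top)
      fix E assume E: "E \<in> sets lebesgue" "E \<subseteq> ?S"
      have "emeasure lebesgue E < \<infinity>" using emeasure_mono[OF E(2) S] Sfin by (rule le_less_trans)
      then obtain f where f: "f \<in> band_space D" "has_fourier_L2 f (indicator E)"
        "ennreal ((L2_norm f)\<^sup>2) = emeasure lebesgue E"
        using test_function[of E] E by auto
      have "(\<integral>\<^sup>+x. (\<Sum>m\<in>M. esq (atom m x)) * indicator E x \<partial>lebesgue)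
        = (\<Sum>m\<in>M. mass m E)"
        unfolding sum_distrib_right 
        by (intro nn_integral_sum borel_measurable_times_ennreal atom_sq_measurable borel_measurable_indicator E(1))
      also have "\<dots> = (\<Sum>m\<in>M. coeff_energy (a m) (demod (indicator E) m))"
      proof (rule sum.cong[OF refl], rule coeff_energy_indicator[symmetric, OF E(1)])
        fix m assume m: "m \<in> M"
        have "E \<subseteq> {of_int k * \<delta>..of_int k * \<delta> + 1 / a m}"
          using E(2) \<delta>a[OF m] by (force simp: distrib_right)
        then show "AE x in lebesgue. x \<notin> {of_int k * \<delta>..of_int k * \<delta> + 1 / a m} \<longrightarrow> indicator E x * cnj (g m x) = 0"
          by (intro AE_I2) (auto simp: indicator_def)
      qed
      also have "\<dots> \<le> coeff_sum G f"
        unfolding coeff_sum_eq[OF f(2)] by (rule nn_integral_count_space_ge_sum[OF M])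
      also have "\<dots> \<le> ennreal (B * (L2_norm f)\<^sup>2)"
        using bessel f(1) by (simp add: bessel_sequence_def)
      also have "\<dots> = (\<integral>\<^sup>+x. ennreal B * indicator E x \<partial>lebesgue)"
        using bessel E(1) by (simp add: bessel_sequence_def ennreal_mult f(3) nn_integral_cmult_indicator)
      finally show "(\<integral>\<^sup>+x. (\<Sum>m\<in>M. esq (atom m x)) * indicator E x \<partial>lebesgue)
        \<le> (\<integral>\<^sup>+x. ennreal B * indicator E x \<partial>lebesgue)" .
    qed
    then have "AE y in lebesgue. \<forall>k::int. y \<in> D \<inter> {of_int k * \<delta>..<(of_int k + 1) * \<delta>} \<longrightarrow>
        (\<Sum>m\<in>M. esq (atom m y)) \<le> ennreal B"
      by (intro AE_all_countable[THEN iffD2] allI)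
    then show ?thesis
    proof eventually_elim
      case (elim y)
      have "of_int \<lfloor>y / \<delta>\<rfloor> \<le> y / \<delta>" "y / \<delta> < of_int \<lfloor>y / \<delta>\<rfloor> + 1" by linarith+
      then have "y \<in> {of_int \<lfloor>y / \<delta>\<rfloor> * \<delta>..<(of_int \<lfloor>y / \<delta>\<rfloor> + 1) * \<delta>}"
        by (simp add: pos_le_divide_eq[OF \<delta>, symmetric] pos_divide_less_eq[OF \<delta>, symmetric])
      with elim show ?case by blast
    qed
  qed
  \<comment> \<open>There are only countably many finite sets of integers, so one exceptional null
    set serves all of them.\<close>
  have "AE y in lebesgue. \<forall>M\<in>Collect finite. y \<in> D \<longrightarrow> (\<Sum>m\<in>M. esq (atom m y)) \<le> ennreal B"
    by (subst AE_ball_countable[OF countable_Collect_finite]) (intro ballI fin, simp)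
  then have "AE y in lebesgue. y \<in> D \<longrightarrow> shift_sum \<theta> (\<Phi> y) \<le> ennreal B"
    by eventually_elim (auto simp: shift_sum_pullback energy_def intro!: nn_integral_count_space_int_le)
  then show ?thesis by (rule AE_transfer[THEN iffD1])
qed

section \<open>The lower bound, localized to slabs of finite measure\<close>

definition slab :: "int \<Rightarrow> real set" where
  "slab j = {y \<in> D. \<Phi> y \<in> {of_int j..<of_int j + 1}}"

lemma slab_sets: "slab j \<in> sets lebesgue"
  unfolding slab_def by (rule pullback_set) auto

lemma slab_finite: "emeasure lebesgue (slab j) < \<infinity>"
proof -
  have "slab j \<subseteq> {\<Psi> (of_int j)..\<Psi> (of_int j + 1)}"
  proof
    fix y assume "y \<in> slab j"
    then show "y \<in> {\<Psi> (of_int j)..\<Psi> (of_int j + 1)}" by (intro \<Phi>_in_Icc) (auto simp: slab_def)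
  qed
  then have "emeasure lebesgue (slab j) \<le> emeasure lebesgue {\<Psi> (of_int j)..\<Psi> (of_int j + 1)}"
    by (rule emeasure_mono) auto
  also have "\<dots> < \<infinity>" by (simp add: emeasure_lborel_Icc_eq)
  finally show ?thesis .
qed

lemma nn_integral_energy:
  assumes "E \<in> sets lebesgue"
  shows "(\<integral>\<^sup>+y. energy y * indicator E y \<partial>lebesgue) = (NNSUM m. mass m E)"
proof -
  note [measurable] = atom_measurable assms
  have "(\<integral>\<^sup>+y. energy y * indicator E y \<partial>lebesgue)
    = (\<integral>\<^sup>+y. (NNSUM m. esq (atom m y) * indicator E y) \<partial>lebesgue)"
    by (simp add: energy_def nn_integral_multc)
  also have "\<dots> = (NNSUM m. mass m E)"
    by (rule nn_integral_count_space_nn_integral) auto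
  finally show ?thesis .
qed

text \<open>Slabs have finite measure, so the constant \<open>A\<close> has a finite integral on
  each and the comparison of averages becomes pointwise; countably many of them cover
  \<open>D\<close>.\<close>

lemma shift_sum_ge_if_slab_averages:
  assumes "\<And>j E. E \<in> sets lebesgue \<Longrightarrow> E \<subseteq> slab j \<Longrightarrow> ennreal A * emeasure lebesgue E \<le> (NNSUM m. mass m E)"
  shows "AE t in lebesgue. ennreal A \<le> shift_sum \<theta> t"
proof -
  have "AE y in lebesgue. y \<in> slab j \<longrightarrow> ennreal A \<le> energy y" for j
    by (rule AE_le_if_integrals_le[OF _ energy_measurable slab_sets])
       (use assms slab_finite[of j] slab_sets[of j] in
         \<open>simp_all add: nn_integral_cmult_indicator ennreal_mult_less_top nn_integral_energy\<close>)
  then have "AE y in lebesgue. \<forall>j. y \<in> slab j \<longrightarrow> ennreal A \<le> energy y"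
    by (intro AE_all_countable[THEN iffD2] allI)
  then have "AE y in lebesgue. y \<in> D \<longrightarrow> ennreal A \<le> shift_sum \<theta> (\<Phi> y)"
  proof eventually_elim
    case (elim y)
    then show ?case using elim[rule_format, of "\<lfloor>\<Phi> y\<rfloor>"] by (simp add: slab_def shift_sum_pullback)
  qed
  then show ?thesis by (rule AE_transfer[THEN iffD1])
qed

theorem frame_imp_shift_sum_ge:
  assumes frame: "frame (band_space D) G A B"
    and bdd: "bdd_above (range (\<lambda>m. a m * w (of_int m)))"
  shows "AE t in lebesgue. ennreal A \<le> shift_sum \<theta> t"
proof (rule shift_sum_ge_if_slab_averages)
  note [measurable] = atom_measurable
  obtain C where C: "\<And>m. a m * w (of_int m) \<le> C" using bdd by (auto simp: bdd_above_def)
  have A0: "0 \<le> A" using frame by (simp add: frame_def)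
  fix j E assume E[measurable]: "E \<in> sets lebesgue" and ES: "E \<subseteq> slab j"
  have ED: "E \<subseteq> D" using ES by (auto simp: slab_def)
  have Efin: "emeasure lebesgue E < \<infinity>"
    using emeasure_mono[OF ES slab_sets] slab_finite by (rule le_less_trans)
  \<comment> \<open>The total error of the tile estimate per unit of tile length;
    \<open>sum_atoms_on_slab\<close> makes it finite because \<open>E\<close> lies in one
    slab.\<close>
  define \<kappa> where "\<kappa> = (NNSUM m. ennreal (a m) * mass m E)"
  have "\<kappa> \<le> (NNSUM m. ennreal (a m) * mass m (slab j))"
    unfolding \<kappa>_def using ES
    by (intro nn_integral_mono mult_left_mono) (auto simp: indicator_def)
  also have "\<dots> \<le> ennreal C * (\<integral>\<^sup>+t. ennreal (v t * (cmod (\<theta> t))\<^sup>2) \<partial>lebesgue)"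
    unfolding slab_def by (rule sum_atoms_on_slab[OF a_pos C])
  also have "\<dots> < top"
    using nn_integral_eq_integral[OF v_\<theta>_integrable] v_weight(2)
    by (simp add: less_imp_le ennreal_mult_less_top)
  finally have \<kappa>: "\<kappa> < top" .
  \<comment> \<open>Each tile is tested separately and the results are added. The masses over the
    tiles reassemble to the mass of \<open>E\<close>, so the number of tiles does not enter the
    error.\<close>
  have main: "ennreal A * emeasure lebesgue E \<le> (NNSUM m. mass m E) + ennreal l * \<kappa>" if l: "l > 0" for l
  proof -
    define T where "T k = {of_int k * l..<(of_int k + 1) * l}" for k :: int
    have T[measurable]: "T k \<in> sets lebesgue" for k by (simp add: T_def)
    have tile: "ennreal A * emeasure lebesgue (E \<inter> T k) \<le> (NNSUM m. ennreal (1 + l * a m) * mass m (E \<inter> T k))" for k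
    proof -
      have ETfin: "emeasure lebesgue (E \<inter> T k) < \<infinity>"
        using emeasure_mono[of "E \<inter> T k" E lebesgue] Efin by (auto intro: le_less_trans)
      obtain f where f: "f \<in> band_space D" "has_fourier_L2 f (indicator (E \<inter> T k))"
        "ennreal ((L2_norm f)\<^sup>2) = emeasure lebesgue (E \<inter> T k)"
        using test_function[OF sets.Int[OF E T] _ ETfin] ED by blast
      have "ennreal A * emeasure lebesgue (E \<inter> T k) = ennreal (A * (L2_norm f)\<^sup>2)"
        using A0 by (simp add: ennreal_mult f(3))
      also have "\<dots> \<le> coeff_sum G f" using frame f(1) by (simp add: frame_def)
      also have "\<dots> \<le> (NNSUM m. ennreal (1 + l * a m) * mass m (E \<inter> T k))"
        unfolding coeff_sum_eq[OF f(2)]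
        using l by (intro nn_integral_mono coeff_energy_indicator_le[where s="of_int k * l"])
          (auto simp: T_def distrib_right)
      finally show ?thesis .
    qed
    have "ennreal A * emeasure lebesgue E = (\<integral>\<^sup>+x. ennreal A * indicator E x \<partial>lebesgue)"
      by (simp add: nn_integral_cmult_indicator)
    also have "\<dots> = (NNSUM k. \<integral>\<^sup>+x. ennreal A * indicator E x * indicator (T k) x \<partial>lebesgue)"
      unfolding T_def by (rule nn_integral_tiles[OF l]) measurable
    also have "\<dots> = (NNSUM k. ennreal A * emeasure lebesgue (E \<inter> T k))"
    proof (rule nn_integral_cong)
      fix k
      have "(\<integral>\<^sup>+x. ennreal A * indicator E x * indicator (T k) x \<partial>lebesgue) = (\<integral>\<^sup>+x. ennreal A * indicator (E \<inter> T k) x \<partial>lebesgue)"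
        by (intro nn_integral_cong) (auto simp: indicator_def)
      then show "(\<integral>\<^sup>+x. ennreal A * indicator E x * indicator (T k) x \<partial>lebesgue) = ennreal A * emeasure lebesgue (E \<inter> T k)"
        by (simp add: nn_integral_cmult_indicator)
    qed
    also have "\<dots> \<le> (NNSUM k. (NNSUM m. ennreal (1 + l * a m) * mass m (E \<inter> T k)))"
      by (intro nn_integral_mono tile)
    also have "\<dots> = (NNSUM m. (NNSUM k. ennreal (1 + l * a m) * mass m (E \<inter> T k)))"
      by (rule nn_integral_count_space_nn_integral) auto
    also have "\<dots> = (NNSUM m. ennreal (1 + l * a m) * mass m E)"
    proof (rule nn_integral_cong)
      fix m
      have "mass m E = (NNSUM k. \<integral>\<^sup>+x. esq (atom m x) * indicator E x * indicator (T k) x \<partial>lebesgue)"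
        unfolding T_def by (rule nn_integral_tiles[OF l]) measurable
      also have "\<dots> = (NNSUM k. mass m (E \<inter> T k))"
        by (intro nn_integral_cong) (auto simp: indicator_def)
      finally show "(NNSUM k. ennreal (1 + l * a m) * mass m (E \<inter> T k)) = ennreal (1 + l * a m) * mass m E"
        by (simp add: nn_integral_cmult)
    qed
    also have "\<dots> = (NNSUM m. mass m E + ennreal l * (ennreal (a m) * mass m E))"
    proof (rule nn_integral_cong)
      fix m
      have "ennreal (1 + l * a m) = 1 + ennreal l * ennreal (a m)"
        using l a_pos[of m] by (simp add: ennreal_mult less_imp_le)
      then show "ennreal (1 + l * a m) * mass m E = mass m E + ennreal l * (ennreal (a m) * mass m E)"
        by (simp add: distrib_right mult.assoc)
    qed
    also have "\<dots> = (NNSUM m. mass m E) + ennreal l * \<kappa>"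
      unfolding \<kappa>_def by (subst nn_integral_add) (auto simp: nn_integral_cmult)
    finally show ?thesis .
  qed
  show "ennreal A * emeasure lebesgue E \<le> (NNSUM m. mass m E)"
  proof (rule ennreal_le_epsilon)
    fix e :: real assume e: "0 < e"
    obtain k where k: "\<kappa> = ennreal k" "0 \<le> k" using \<kappa> by (cases \<kappa>) auto
    \<comment> \<open>The summand 1 covers the case \<open>k = 0\<close> and still gives
      \<open>l * k \<le> e\<close>.\<close>
    define l where "l = e / (k + 1)"
    have l: "l > 0" using e k by (simp add: l_def)
    have "l * k \<le> e" using e k by (simp add: l_def field_simps)
    then have "ennreal l * \<kappa> \<le> ennreal e" using l k by (simp add: ennreal_leI flip: ennreal_mult)
    then show "ennreal A * emeasure lebesgue E \<le> (NNSUM m. mass m E) + ennreal e"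
      using main[OF l] by (meson add_left_mono order_trans)
  qed
qed

end

subsection \<open>The painless case and its canonical dual\<close>

text \<open>The complement of the support is a possibly uncountable union of open sets on which
  \<open>f\<close> vanishes almost everywhere; by Lindelof's theorem countably many of them
  suffice.\<close>

lemma ess_supp_AE:
  assumes "ess_supp f \<subseteq> {c..d}"
  shows "vanishes_off {c..d} f"
proof -
  define \<F> where "\<F> = {U. open U \<and> (AE x in lebesgue. x \<in> U \<longrightarrow> f x = 0)}"
  obtain \<F>' where F': "\<F>' \<subseteq> \<F>" "countable \<F>'" "\<Union>\<F>' = \<Union>\<F>"
    using Lindelof[of \<F>] by (auto simp: \<F>_def)
  have "AE x in lebesgue. \<forall>U\<in>\<F>'. x \<in> U \<longrightarrow> f x = 0"
    using F'(1) by (subst AE_ball_countable[OF F'(2)]) (auto simp: \<F>_def)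
  then show ?thesis
  proof eventually_elim
    case (elim x)
    show ?case
    proof
      assume "x \<notin> {c..d}"
      then have "x \<notin> ess_supp f" using assms by blast
      then have "x \<in> \<Union>\<F>'" unfolding F'(3) by (auto simp: ess_supp_def \<F>_def)
      then show "f x = 0" using elim by blast
    qed
  qed
qed

lemma AE_lebesgue_shift:
  fixes c :: real
  assumes "AE x in lebesgue. P x"
  shows "AE x in lebesgue. P (x - c)"
proof -
  have "negligible ((+) c ` {x. \<not> P x})"
    using assms unfolding AE_lebesgue_iff_negligible by (rule negligible_translation)
  moreover have "{x. \<not> P (x - c)} \<subseteq> (+) c ` {x. \<not> P x}"
    by (auto intro!: image_eqI[where x="_ - c"])
  ultimately show ?thesis
    unfolding AE_lebesgue_iff_negligible by (rule negligible_subset)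
qed

text \<open>A finite extended sum bounds all finite partial sums, which yields real summability;
  this is the passage from \<open>coeff_sum\<close> to series that can be added and
  multiplied.\<close>

lemma has_sum_if_infsum_ennreal:
  fixes x :: "'i \<Rightarrow> real"
  assumes x: "\<And>i. 0 \<le> x i" and N: "0 \<le> N" and eq: "(\<Sum>\<^sub>\<infinity>i. ennreal (x i)) = ennreal N"
  shows "(x has_sum N) UNIV"
proof -
  have sup: "(\<Sum>\<^sub>\<infinity>i. ennreal (x i)) = (SUP F\<in>{F. finite F \<and> F \<subseteq> UNIV}. ennreal (sum x F))"
    using x by (subst nonneg_infsum_complete) (auto simp: sum_ennreal)
  have "sum x F \<le> N" if "finite F" for F
  proof -
    have "ennreal (sum x F) \<le> ennreal N"
      unfolding eq[symmetric] sup using that by (intro SUP_upper) simp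
    then show ?thesis using N by (simp add: ennreal_le_iff)
  qed
  then have s: "x summable_on UNIV"
    using x by (intro nonneg_bdd_above_summable_on) (auto intro!: bdd_aboveI2[where M=N])
  have "ennreal (infsum x UNIV) = ennreal N"
    unfolding infsum_nonneg_is_SUPREMUM_ennreal[OF s x] sup[symmetric] eq ..
  then have "infsum x UNIV = N" using N infsum_nonneg[of UNIV x] x by (simp add: ennreal_inj)
  with s show ?thesis by (metis has_sum_infsum)
qed

text \<open>Averaging \<open>z\<close> times the quadratic form over the fourth roots of unity: the
  part \<open>p + r\<close> is the same for all four and cancels, leaving the sesquilinear
  part.\<close>

lemma has_sum_polarization:
  fixes X Y :: "'i \<Rightarrow> complex" and t :: complex
  assumes q: "\<And>z. ((\<lambda>i. (cmod (X i + z * Y i))\<^sup>2) has_sum (p + (cmod z)\<^sup>2 * r + 2 * Re (cnj z * t))) UNIV"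
  shows "((\<lambda>i. X i * cnj (Y i)) has_sum t) UNIV"
proof -
  have q': "((\<lambda>i. complex_of_real ((cmod (X i + z * Y i))\<^sup>2)) has_sum of_real (p + (cmod z)\<^sup>2 * r + 2 * Re (cnj z * t))) UNIV" for z
    using q by (rule has_sum_of_real)
  have "((\<lambda>i. ((1/4) * of_real ((cmod (X i + 1 * Y i))\<^sup>2) + (-1/4) * of_real ((cmod (X i + (-1) * Y i))\<^sup>2))
      + ((\<i>/4) * of_real ((cmod (X i + \<i> * Y i))\<^sup>2) + (-\<i>/4) * of_real ((cmod (X i + (- \<i>) * Y i))\<^sup>2)))
    has_sum (((1/4) * of_real (p + (cmod (1))\<^sup>2 * r + 2 * Re (cnj (1) * t)) + (-1/4) * of_real (p + (cmod (-1))\<^sup>2 * r + 2 * Re (cnj (-1) * t)))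
      + ((\<i>/4) * of_real (p + (cmod (\<i>))\<^sup>2 * r + 2 * Re (cnj (\<i>) * t)) + (-\<i>/4) * of_real (p + (cmod (- \<i>))\<^sup>2 * r + 2 * Re (cnj (- \<i>) * t))))) UNIV"
    by (intro has_sum_add has_sum_cmult_right q')
  moreover have "((1/4) * of_real ((cmod (x + 1 * y))\<^sup>2) + (-1/4) * of_real ((cmod (x + (-1) * y))\<^sup>2))
      + ((\<i>/4) * of_real ((cmod (x + \<i> * y))\<^sup>2) + (-\<i>/4) * of_real ((cmod (x + (- \<i>) * y))\<^sup>2)) = x * cnj y" for x y
    unfolding cmod_power2 complex_eq_iff by (simp add: power2_eq_square algebra_simps)
  moreover have "((1/4) * of_real (p + (cmod (1))\<^sup>2 * r + 2 * Re (cnj (1) * t)) + (-1/4) * of_real (p + (cmod (-1))\<^sup>2 * r + 2 * Re (cnj (-1) * t)))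
      + ((\<i>/4) * of_real (p + (cmod (\<i>))\<^sup>2 * r + 2 * Re (cnj (\<i>) * t)) + (-\<i>/4) * of_real (p + (cmod (- \<i>))\<^sup>2 * r + 2 * Re (cnj (- \<i>) * t))) = t"
    by (simp add: complex_eq_iff) (simp add: field_simps)
  ultimately show ?thesis by simp
qed

text \<open>The remainder \<open>r\<close> of a partial sum over \<open>S\<close> satisfies \<open>\<parallel>r\<parallel>\<^sup>2 = \<Sum>\<^sub>i\<^sub>\<notin>\<^sub>S c\<^sub>i \<langle>g\<^sub>i, r\<rangle>\<close>, which the Bessel bound
  for \<open>r\<close> itself controls by the tail of \<open>\<Sum> |c\<^sub>i|\<^sup>2\<close>.\<close>

lemma weak_series_L2_tendsto:
  fixes G :: "'i \<Rightarrow> real \<Rightarrow> complex"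
  assumes GL: "\<And>i. G i \<in> L2" and k: "k \<in> L2" and B: "0 \<le> B"
    and c: "((\<lambda>i. (cmod (c i))\<^sup>2) has_sum R) UNIV"
    and rem: "\<And>S. finite S \<Longrightarrow> (\<lambda>x. k x - (\<Sum>i\<in>S. c i * G i x)) \<in> H"
    and bessel: "\<And>h S. h \<in> H \<Longrightarrow> finite S \<Longrightarrow> (\<Sum>i\<in>S. (cmod (L2_inner h (G i)))\<^sup>2) \<le> B * (L2_norm h)\<^sup>2"
    and weak: "\<And>h. h \<in> H \<Longrightarrow> ((\<lambda>i. c i * cnj (L2_inner h (G i))) has_sum L2_inner k h) UNIV"
  shows "L2_tendsto (\<lambda>S x. \<Sum>i\<in>S. c i * G i x) k (finite_subsets_at_top UNIV)"
proof -
  have TL: "(\<lambda>x. \<Sum>i\<in>S. c i * G i x) \<in> L2" for S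
    by (intro L2_sum L2_cmult GL)
  have le_R: "(\<Sum>i\<in>T. (cmod (c i))\<^sup>2) \<le> R" if "finite T" for T
    using finite_sum_le_has_sum[OF c that] by simp
  have est: "L2_norm (\<lambda>x. (\<Sum>i\<in>S. c i * G i x) - k x) \<le> sqrt B * sqrt (R - (\<Sum>i\<in>S. (cmod (c i))\<^sup>2))"
    if S: "finite S" for S
  proof -
    define r where "r = (\<lambda>x. k x - (\<Sum>i\<in>S. c i * G i x))"
    define d where "d i = L2_inner r (G i)" for i
    have rH: "r \<in> H" unfolding r_def by (rule rem[OF S])
    have rL: "r \<in> L2" unfolding r_def by (rule L2_diff[OF k TL])
    let ?b = "sqrt (R - (\<Sum>i\<in>S. (cmod (c i))\<^sup>2)) * (sqrt B * L2_norm r)"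
    have "L2_inner r r = L2_inner k r - L2_inner (\<lambda>x. \<Sum>i\<in>S. c i * G i x) r"
      by (subst (1) r_def) (rule L2_inner_diff_left[OF k TL rL])
    also have "L2_inner (\<lambda>x. \<Sum>i\<in>S. c i * G i x) r = (\<Sum>i\<in>S. c i * cnj (d i))"
      unfolding d_def by (subst L2_inner_sum_left) (auto intro: L2_cmult GL rL simp: L2_inner_cmult_left simp flip: L2_inner_commute)
    finally have rr: "L2_inner r r = L2_inner k r - (\<Sum>i\<in>S. c i * cnj (d i))" .
    \<comment> \<open>The weak expansion writes the squared norm of \<open>r\<close> as a limit of
      sums over \<open>T - S\<close> for growing finite \<open>T\<close> containing
      \<open>S\<close>, so a bound uniform in \<open>T\<close> suffices.\<close>
    have "((\<lambda>T. cmod ((\<Sum>i\<in>T. c i * cnj (d i)) - (\<Sum>i\<in>S. c i * cnj (d i))))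
        \<longlongrightarrow> cmod (L2_inner k r - (\<Sum>i\<in>S. c i * cnj (d i)))) (finite_subsets_at_top UNIV)"
      using weak[OF rH] unfolding has_sum_def d_def by (intro tendsto_intros)
    moreover have "\<forall>\<^sub>F T in finite_subsets_at_top UNIV. cmod ((\<Sum>i\<in>T. c i * cnj (d i)) - (\<Sum>i\<in>S. c i * cnj (d i))) \<le> ?b"
    proof (rule eventually_finite_subsets_at_top[THEN iffD2], intro exI[of _ S] conjI S subset_UNIV allI impI)
      fix T assume T: "finite T \<and> S \<subseteq> T \<and> T \<subseteq> UNIV"
      have "(\<Sum>i\<in>T. c i * cnj (d i)) - (\<Sum>i\<in>S. c i * cnj (d i)) = (\<Sum>i\<in>T - S. c i * cnj (d i))"
        using T by (simp add: sum_diff)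
      also have "cmod \<dots> \<le> (\<Sum>i\<in>T - S. cmod (c i) * cmod (d i))"
        by (rule order_trans[OF norm_sum]) (simp add: norm_mult)
      also have "\<dots> \<le> ?b"
      proof (rule power2_le_imp_le)
        have "(\<Sum>i\<in>T - S. cmod (c i) * cmod (d i))\<^sup>2 \<le> (\<Sum>i\<in>T - S. (cmod (c i))\<^sup>2) * (\<Sum>i\<in>T - S. (cmod (d i))\<^sup>2)"
          by (rule Cauchy_Schwarz_ineq_sum)
        also have "\<dots> \<le> (R - (\<Sum>i\<in>S. (cmod (c i))\<^sup>2)) * (B * (L2_norm r)\<^sup>2)"
        proof (intro mult_mono)
          show "(\<Sum>i\<in>T - S. (cmod (c i))\<^sup>2) \<le> R - (\<Sum>i\<in>S. (cmod (c i))\<^sup>2)"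
            using T le_R[of T] by (simp add: sum_diff)
          show "(\<Sum>i\<in>T - S. (cmod (d i))\<^sup>2) \<le> B * (L2_norm r)\<^sup>2"
            unfolding d_def using T by (intro bessel rH) simp
        qed (use le_R[OF S] in \<open>auto intro: sum_nonneg\<close>)
        also have "\<dots> = ?b\<^sup>2"
          using le_R[OF S] B by (simp add: power_mult_distrib)
        finally show "(\<Sum>i\<in>T - S. cmod (c i) * cmod (d i))\<^sup>2 \<le> ?b\<^sup>2" .
      qed (use le_R[OF S] B in \<open>simp add: L2_norm_nonneg\<close>)
      finally show "cmod ((\<Sum>i\<in>T. c i * cnj (d i)) - (\<Sum>i\<in>S. c i * cnj (d i))) \<le> ?b" .
    qed
    ultimately have "cmod (L2_inner r r) \<le> ?b"
      unfolding rr by (rule tendsto_upperbound) simp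
    then have le: "L2_norm r * L2_norm r \<le> ?b"
      unfolding L2_inner_self[OF rL] norm_of_real by (simp add: power2_eq_square)
    \<comment> \<open>The bound is linear in the norm of \<open>r\<close> and the left side
      quadratic, so one factor divides out; the case of norm 0 is trivial.\<close>
    have "L2_norm r \<le> sqrt B * sqrt (R - (\<Sum>i\<in>S. (cmod (c i))\<^sup>2))"
    proof (cases "L2_norm r = 0")
      case True
      then show ?thesis using B le_R[OF S] by simp
    next
      case False
      then have "0 < L2_norm r" using L2_norm_nonneg[of r] by simp
      then show ?thesis using le by (simp add: mult_ac)
    qed
    then show ?thesis
      unfolding r_def by (subst L2_norm_minus_commute)
  qed
  have "((\<lambda>S. sqrt B * sqrt (R - (\<Sum>i\<in>S. (cmod (c i))\<^sup>2))) \<longlongrightarrow> sqrt B * sqrt (R - R)) (finite_subsets_at_top UNIV)"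
    using c unfolding has_sum_def by (intro tendsto_intros)
  then show ?thesis
    by (intro L2_tendsto_if_dist_le[where b="\<lambda>S. sqrt B * sqrt (R - (\<Sum>i\<in>S. (cmod (c i))\<^sup>2))"] TL k
        eventually_finite_subsets_at_top_weakI est) simp_all
qed

context filter_bank
begin

text \<open>In the sense of the painless nonorthogonal expansions of Daubechies, Grossmann and Meyer.\<close>

definition painless :: bool where
  "painless \<longleftrightarrow> (\<forall>m. \<exists>s. vanishes_off {s..s + 1 / a m} (atom m))"

text \<open>Monotonicity of the inverse warping carries the support condition on
  \<open>{c + m..d + m}\<close> to an interval in \<open>D\<close> whose length is at most
  \<open>1 / a m\<close>.\<close>

lemma painlessI:
  assumes supp: "ess_supp \<theta> \<subseteq> {c..d}"
    and len: "\<And>m. inverse (a m) \<ge> \<Psi> (d + of_int m) - \<Psi> (c + of_int m)"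
  shows painless
  unfolding painless_def
proof (intro allI exI)
  fix m
  have "AE y in lebesgue. y \<in> D \<longrightarrow> (\<Phi> y - of_int m \<notin> {c..d} \<longrightarrow> \<theta> (\<Phi> y - of_int m) = 0)"
    by (rule AE_transfer[THEN iffD2, OF AE_lebesgue_shift[OF ess_supp_AE[OF supp]]])
  then show "vanishes_off {\<Psi> (c + of_int m)..\<Psi> (c + of_int m) + 1 / a m} (atom m)"
  proof eventually_elim
    case (elim y)
    show ?case
    proof (rule impI, rule ccontr)
      assume y: "y \<notin> {\<Psi> (c + of_int m)..\<Psi> (c + of_int m) + 1 / a m}" "atom m y \<noteq> 0"
      then have D: "y \<in> D" and "\<theta> (\<Phi> y - of_int m) \<noteq> 0" by (auto simp: atom_def split: if_splits)
      then have "\<Phi> y - of_int m \<in> {c..d}" using elim by blast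
      then have "\<Phi> y \<in> {c + of_int m..d + of_int m}" by auto
      from \<Phi>_in_Icc[OF D this] have "y \<in> {\<Psi> (c + of_int m)..\<Psi> (c + of_int m) + 1 / a m}"
        using len[of m] by (auto simp: inverse_eq_divide)
      with y show False by blast
    qed
  qed
qed

lemma painless_coeff_energy:
  assumes p: painless and F: "F \<in> Lmeas" and L: "demod F m \<in> L2"
  shows "coeff_energy (a m) (demod F m)
    = weighted_mass F m"
proof -
  obtain s where s: "vanishes_off {s..s + 1 / a m} (atom m)"
    using p unfolding painless_def by blast
  show ?thesis
    by (rule coeff_energy_atom[OF L F, of s]) (use s in eventually_elim, simp add: filter_eq)
qed

lemma painless_coeff_sum:
  assumes p: painless and F: "has_fourier_L2 f F" and L: "\<And>m. demod F m \<in> L2"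
  shows "coeff_sum G f = (\<integral>\<^sup>+y. esq (F y) * energy y \<partial>lebesgue)"
proof -
  note Fm = L2_measurable[OF has_fourier_L2D(2)[OF F]]
  note [measurable] = Fm atom_measurable
  have "coeff_sum G f = (NNSUM m. weighted_mass F m)"
    unfolding coeff_sum_eq[OF F] painless_coeff_energy[OF p Fm L] ..
  also have "\<dots> = (\<integral>\<^sup>+y. (NNSUM m. ennreal ((cmod (F y))\<^sup>2 * (cmod (atom m y))\<^sup>2)) \<partial>lebesgue)"
    by (rule nn_integral_count_space_nn_integral[symmetric]) auto
  also have "\<dots> = (\<integral>\<^sup>+y. esq (F y) * energy y \<partial>lebesgue)"
    unfolding energy_def by (simp add: ennreal_mult nn_integral_cmult)
  finally show ?thesis .
qed

text \<open>The coefficient energy of an indicator is now exactly its mass, on sets of any diameter,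
  so the tiling and its error term disappear.\<close>

lemma painless_frame_imp_shift_sum_ge:
  assumes p: painless and frame: "frame (band_space D) G A B"
  shows "AE t in lebesgue. ennreal A \<le> shift_sum \<theta> t"
proof (rule shift_sum_ge_if_slab_averages)
  have A0: "0 \<le> A" using frame by (simp add: frame_def)
  fix j E assume E: "E \<in> sets lebesgue" and ES: "E \<subseteq> slab j"
  have ED: "E \<subseteq> D" using ES by (auto simp: slab_def)
  have Efin: "emeasure lebesgue E < \<infinity>"
    using emeasure_mono[OF ES slab_sets] slab_finite by (rule le_less_trans)
  obtain f where f: "f \<in> band_space D" "has_fourier_L2 f (indicator E)"
    "ennreal ((L2_norm f)\<^sup>2) = emeasure lebesgue E"
    using test_function[OF E ED Efin] by blast
  have "ennreal A * emeasure lebesgue E = ennreal (A * (L2_norm f)\<^sup>2)"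
    using A0 by (simp add: ennreal_mult f(3))
  also have "\<dots> \<le> coeff_sum G f" using frame f(1) by (simp add: frame_def)
  also have "\<dots> = (NNSUM m. mass m E)"
    unfolding coeff_sum_eq[OF f(2)] painless_coeff_energy[OF p borel_measurable_indicator[OF E] indicator_mult_filter_L2[OF E]]
      indicator_mult_atom ..
  finally show "ennreal A * emeasure lebesgue E \<le> (NNSUM m. mass m E)" .
qed

lemma frame_imp_bessel: "frame H G A B \<Longrightarrow> bessel_sequence H G B"
  by (auto simp: frame_def bessel_sequence_def)

text \<open>A bound for the sum of all squared atoms bounds each filter, and multiplication by a
  bounded function preserves \<open>L2\<close>. This opens the exact identity to arbitrary
  transforms.\<close>

lemma bounded_mult_filter_L2:
  assumes S: "AE t in lebesgue. shift_sum \<theta> t \<le> ennreal B" and B: "0 \<le> B" and F: "F \<in> L2"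
  shows "demod F m \<in> L2"
proof -
  have "AE y in lebesgue. y \<in> D \<longrightarrow> shift_sum \<theta> (\<Phi> y) \<le> ennreal B"
    by (rule AE_transfer[THEN iffD2, OF S])
  then have "AE y in lebesgue. cmod (cnj (g m y)) \<le> sqrt (a m * B)"
  proof eventually_elim
    case (elim y)
    show ?case
    proof (cases "y \<in> D")
      case True
      have "esq (atom m y) \<le> shift_sum \<theta> (\<Phi> y)"
        using nn_integral_count_space_ge_sum[of "{m}" "\<lambda>m. esq (atom m y)"]
        by (simp add: shift_sum_pullback[OF True] energy_def)
      also have "\<dots> \<le> ennreal B" using elim True by blast
      finally have "(cmod (atom m y))\<^sup>2 \<le> B" using B by (simp add: ennreal_le_iff)
      then have "(cmod (g m y))\<^sup>2 \<le> a m * B"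
        unfolding filter_norm_sq using a_pos[of m] by simp
      then show ?thesis by (simp add: real_le_rsqrt)
    next
      case False
      then show ?thesis using B a_pos[of m] by (simp add: warped_filter_def less_imp_le)
    qed
  qed
  from L2_bounded_mult[OF F L2_measurable[OF L2_cnj[OF filter_L2]] this]
  show ?thesis by (simp add: mult.commute)
qed

theorem painless_frame_iff:
  assumes p: painless
  shows "frame (band_space D) G A B \<longleftrightarrow>
    0 < A \<and> (AE t in lebesgue. ennreal A \<le> shift_sum \<theta> t \<and> shift_sum \<theta> t \<le> ennreal B)"
proof
  assume fr: "frame (band_space D) G A B"
  show "0 < A \<and> (AE t in lebesgue. ennreal A \<le> shift_sum \<theta> t \<and> shift_sum \<theta> t \<le> ennreal B)"
    using painless_frame_imp_shift_sum_ge[OF p fr] bessel_imp_shift_sum_le[OF frame_imp_bessel[OF fr]] fr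
    by (auto simp: frame_def)
next
  assume "0 < A \<and> (AE t in lebesgue. ennreal A \<le> shift_sum \<theta> t \<and> shift_sum \<theta> t \<le> ennreal B)"
  then have A: "0 < A" and S: "AE t in lebesgue. ennreal A \<le> shift_sum \<theta> t \<and> shift_sum \<theta> t \<le> ennreal B"
    by auto
  \<comment> \<open>The ordering of the bounds is read off at a single point where both inequalities
    hold; such a point exists because the line is not a null set. Positivity of \<open>A\<close>
    excludes a negative \<open>B\<close>, which \<open>ennreal\<close> would send to 0.\<close>
  have "ae_filter (lebesgue :: real measure) \<noteq> bot" by (simp add: ae_filter_eq_bot_iff)
  from eventually_happens'[OF this S] obtain t where "ennreal A \<le> shift_sum \<theta> t" "shift_sum \<theta> t \<le> ennreal B"
    by blast
  then have "ennreal A \<le> ennreal B" by (rule order_trans)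
  then have AB: "A \<le> B" using A by (metis ennreal_le_iff2 linorder_not_le)
  have SD: "AE y in lebesgue. y \<in> D \<longrightarrow> ennreal A \<le> energy y \<and> energy y \<le> ennreal B"
    using AE_transfer[THEN iffD2, OF S] by (simp add: shift_sum_pullback cong: imp_cong)
  have SB: "AE t in lebesgue. shift_sum \<theta> t \<le> ennreal B" using S by auto
  show "frame (band_space D) G A B"
    unfolding frame_def
  proof (intro conjI ballI A AB)
    fix f assume "f \<in> band_space D"
    then obtain F where F: "F \<in> L2" "vanishes_off D F" "has_fourier_L2 f F"
      by (rule band_space_fourier)
    note [measurable] = L2_measurable[OF F(1)]
    have cs: "coeff_sum G f = (\<integral>\<^sup>+y. esq (F y) * energy y \<partial>lebesgue)"
      using A AB by (intro painless_coeff_sum[OF p F(3) bounded_mult_filter_L2[OF SB _ F(1)]]) simp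
    have n: "ennreal (K * (L2_norm f)\<^sup>2) = (\<integral>\<^sup>+y. esq (F y) * ennreal K \<partial>lebesgue)" if "0 \<le> K" for K
      using that has_fourier_L2_norm[OF F(3)]
      by (subst nn_integral_multc) (auto simp: nn_eq_L2_norm[OF F(1)] ennreal_mult mult.commute)
    show "ennreal (A * (L2_norm f)\<^sup>2) \<le> coeff_sum G f"
      unfolding cs n[OF less_imp_le[OF A]]
    proof (rule nn_integral_mono_AE, use SD F(2) in eventually_elim)
      case (elim x)
      then show ?case by (cases "x \<in> D") (auto intro: mult_left_mono)
    qed
    have B0: "0 \<le> B" using A AB by simp
    show "coeff_sum G f \<le> ennreal (B * (L2_norm f)\<^sup>2)"
      unfolding cs n[OF B0]
    proof (rule nn_integral_mono_AE, use SD F(2) in eventually_elim)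
      case (elim x)
      then show ?case by (cases "x \<in> D") (auto intro: mult_left_mono)
    qed
  qed
qed

end

text \<open>The denominator of \<open>dual_prototype\<close>. As a real infinite sum it takes the
  default value 0 where the series diverges, so it is compared with \<open>shift_sum\<close> only
  where the latter is finite.\<close>

definition shift_energy :: "(real \<Rightarrow> complex) \<Rightarrow> real \<Rightarrow> real" where
  "shift_energy \<theta> t = (\<Sum>\<^sub>\<infinity>l::int. (cmod (translate (of_int l) \<theta> t))\<^sup>2)"

lemma shift_energy_eq:
  assumes "shift_sum \<theta> t < top"
  shows "shift_energy \<theta> t = enn2real (shift_sum \<theta> t)"
proof -
  obtain N where N: "0 \<le> N" "shift_sum \<theta> t = ennreal N"
    using assms by (cases "shift_sum \<theta> t") auto
  have "((\<lambda>l::int. (cmod (translate (of_int l) \<theta> t))\<^sup>2) has_sum N) UNIV"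
    using N by (intro has_sum_if_infsum_ennreal) (auto simp: shift_sum_def)
  then show ?thesis unfolding shift_energy_def N(2) using N(1) by (simp add: infsumI)
qed

text \<open>Translation by an integer permutes the summands. This periodicity lets one denominator
  serve all channels \<open>m\<close>.\<close>

lemma shift_energy_shift: "shift_energy \<theta> (t - of_int m) = shift_energy \<theta> t"
proof -
  have "bij_betw (\<lambda>l. l - m) UNIV (UNIV :: int set)"
    by (rule bij_betw_byWitness[where f'="\<lambda>l. l + m"]) auto
  from infsum_reindex_bij_betw[OF this, of "\<lambda>l. (cmod (translate (of_int l) \<theta> (t - of_int m)))\<^sup>2"]
  show ?thesis by (simp add: shift_energy_def translate_def algebra_simps)
qed

lemma dual_prototype_eq: "dual_prototype \<theta> t = \<theta> t / of_real (shift_energy \<theta> t)"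
  by (simp add: dual_prototype_def shift_energy_def)

section \<open>The frame operator as a Fourier multiplier, and the canonical dual\<close>

context filter_bank
begin

lemma filter_bank_in_band_space: "G i \<in> band_space D"
proof (cases i)
  case (Pair m n)
  then show ?thesis
    using band_spaceI[OF filter_bank_has_fourier[of m n]] by (simp add: warped_filter_def)
qed

lemma band_space_diff: "f \<in> band_space D \<Longrightarrow> h \<in> band_space D \<Longrightarrow> (\<lambda>x. f x - h x) \<in> band_space D"
proof (elim band_space_fourier)
  fix F H assume FH: "has_fourier_L2 f F" "has_fourier_L2 h H"
  assume "vanishes_off D F" "vanishes_off D H"
  then have "AE x in lebesgue. x \<notin> D \<longrightarrow> F x - H x = 0" by eventually_elim auto
  then show ?thesis by (rule band_spaceI[OF has_fourier_L2_diff[OF FH]])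
qed

lemma band_space_cmult: "f \<in> band_space D \<Longrightarrow> (\<lambda>x. c * f x) \<in> band_space D"
proof (elim band_space_fourier)
  fix F assume F: "has_fourier_L2 f F"
  assume "vanishes_off D F"
  then have "AE x in lebesgue. x \<notin> D \<longrightarrow> c * F x = 0" by eventually_elim auto
  then show ?thesis by (rule band_spaceI[OF has_fourier_L2_cmult[OF F]])
qed

text \<open>The frame inequality is available only inside the band space, so the remainder of the
  frame series must stay there.\<close>

lemma partial_sum_remainder_in_band_space:
  assumes "finite S" "k \<in> band_space D"
  shows "(\<lambda>x. k x - (\<Sum>i\<in>S. c i * G i x)) \<in> band_space D"
  using assms(1)
proof induction
  case (insert i S)
  then show ?case
    using band_space_diff[OF insert.IH band_space_cmult[OF filter_bank_in_band_space[of i], of "c i"]]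
    by (simp add: algebra_simps)
qed (use assms in simp)

context
  fixes A B :: real
  assumes p: painless and A: "0 < A"
    and S: "AE t in lebesgue. ennreal A \<le> shift_sum \<theta> t \<and> shift_sum \<theta> t \<le> ennreal B"
begin

lemma shift_energy_bounds:
  "AE t in lebesgue. A \<le> shift_energy \<theta> t \<and> shift_energy \<theta> t \<le> B \<and> ennreal (shift_energy \<theta> t) = shift_sum \<theta> t"
  using S
proof eventually_elim
  case (elim t)
  then have fin: "shift_sum \<theta> t < top" by (auto intro: le_less_trans)
  have e: "ennreal (shift_energy \<theta> t) = shift_sum \<theta> t"
    using fin by (simp add: shift_energy_eq[OF fin])
  have nn: "0 \<le> shift_energy \<theta> t" by (simp add: shift_energy_eq[OF fin])
  have "A \<le> shift_energy \<theta> t" using elim nn unfolding e[symmetric] by (simp add: ennreal_le_iff)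
  moreover from this have "shift_energy \<theta> t \<le> B"
    using elim A unfolding e[symmetric] by (metis ennreal_le_iff2 less_le_trans linorder_not_le)
  ultimately show ?case using e by blast
qed

text \<open>The denominator is at least \<open>A\<close> almost everywhere, so division costs at
  most the factor \<open>1/A\<close>.\<close>

lemma dual_prototype_L2_weighted: "dual_prototype \<theta> \<in> L2_weighted (\<lambda>x. sqrt (v x))"
proof -
  have sm: "shift_sum \<theta> \<in> Lmeas"
    unfolding shift_sum_eq[abs_def]
  proof (rule borel_measurable_nn_integral_int)
    show "(\<lambda>t. esq (\<theta> (t - of_int m))) \<in> Lmeas" for m
      using \<theta>_shift_measurable[of "of_int m"] by measurable
  qed
  have L: "(\<lambda>x. complex_of_real (sqrt (v x)) * \<theta> x) \<in> L2"
    using \<theta> by (simp add: L2_weighted_def)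
  \<comment> \<open>Measurability is obtained for the quotient by
    \<open>enn2real (shift_sum \<theta> t)\<close> and then carried over, since both denominators
    agree almost everywhere.\<close>
  have m: "(\<lambda>t. complex_of_real (sqrt (v t)) * \<theta> t / complex_of_real (enn2real (shift_sum \<theta> t))) \<in> Lmeas"
    using L2_measurable[OF L] sm by measurable
  have dm: "(\<lambda>t. complex_of_real (sqrt (v t)) * dual_prototype \<theta> t) \<in> Lmeas"
  proof (rule borel_measurable_AE[OF m])
    show "AE t in lebesgue. complex_of_real (sqrt (v t)) * \<theta> t / complex_of_real (enn2real (shift_sum \<theta> t))
        = complex_of_real (sqrt (v t)) * dual_prototype \<theta> t"
      using S by eventually_elim
        (subst dual_prototype_eq, subst shift_energy_eq, auto intro: le_less_trans)
  qed
  show ?thesis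
    unfolding L2_weighted_def mem_Collect_eq
  proof (rule L2_dominated[OF L dm, where C="1/A"])
    show "AE t in lebesgue. cmod (complex_of_real (sqrt (v t)) * dual_prototype \<theta> t)
        \<le> 1 / A * cmod (complex_of_real (sqrt (v t)) * \<theta> t)"
      using shift_energy_bounds
    proof eventually_elim
      case (elim t)
      then have "cmod (\<theta> t) / shift_energy \<theta> t \<le> cmod (\<theta> t) / A"
        using A by (intro divide_left_mono) auto
      then have "\<bar>sqrt (v t)\<bar> * (cmod (\<theta> t) / shift_energy \<theta> t) \<le> \<bar>sqrt (v t)\<bar> * (cmod (\<theta> t) / A)"
        by (rule mult_left_mono) simp
      then show ?case
        using elim A by (simp add: dual_prototype_eq norm_mult norm_divide)
    qed
  qed
qed

text \<open>The multiplier of the frame operator on the Fourier side. It is real valued, vanishes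
  off \<open>D\<close>, and lies between \<open>A\<close> and \<open>B\<close> almost everywhere on
  \<open>D\<close>.\<close>

definition symbol :: "real \<Rightarrow> real" where
  "symbol y = enn2real (energy y)"

abbreviation "symbol_mult F \<equiv> \<lambda>y. complex_of_real (symbol y) * F y"

lemma symbol_measurable: "symbol \<in> Lmeas"
  unfolding symbol_def[abs_def] using energy_measurable by measurable

lemma symbol_bounds:
  "AE y in lebesgue. y \<in> D \<longrightarrow> A \<le> symbol y \<and> symbol y \<le> B \<and>
     ennreal (symbol y) = energy y \<and> symbol y = shift_energy \<theta> (\<Phi> y)"
proof -
  have "AE y in lebesgue. y \<in> D \<longrightarrow> A \<le> shift_energy \<theta> (\<Phi> y) \<and> shift_energy \<theta> (\<Phi> y) \<le> B
      \<and> ennreal (shift_energy \<theta> (\<Phi> y)) = shift_sum \<theta> (\<Phi> y)"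
    by (rule AE_transfer[THEN iffD2, OF shift_energy_bounds])
  then show ?thesis
  proof eventually_elim
    case (elim y)
    show ?case
    proof
      assume y: "y \<in> D"
      then have b: "A \<le> shift_energy \<theta> (\<Phi> y)" "shift_energy \<theta> (\<Phi> y) \<le> B"
        "ennreal (shift_energy \<theta> (\<Phi> y)) = energy y" using elim by (auto simp: shift_sum_pullback)
      then have "symbol y = shift_energy \<theta> (\<Phi> y)"
        unfolding symbol_def b(3)[symmetric] using A by simp
      with b show "A \<le> symbol y \<and> symbol y \<le> B \<and> ennreal (symbol y) = energy y \<and> symbol y = shift_energy \<theta> (\<Phi> y)"
        by simp
    qed
  qed
qed

lemma B_nonneg: "0 \<le> B"
proof -
  have "frame (band_space D) G A B" using painless_frame_iff[OF p] A S by blast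
  then show ?thesis using A by (simp add: frame_def)
qed

lemma symbol_mult_L2:
  assumes F: "F \<in> L2" "vanishes_off D F"
  shows "(symbol_mult F) \<in> L2"
proof (rule L2_dominated[OF F(1), where C=B])
  show "(symbol_mult F) \<in> Lmeas"
    using symbol_measurable L2_measurable[OF F(1)] by measurable
  show "AE y in lebesgue. cmod (of_real (symbol y) * F y) \<le> B * cmod (F y)"
    using symbol_bounds F(2)
  proof eventually_elim
    case (elim y)
    show ?case
    proof (cases "y \<in> D")
      case True
      then have "\<bar>symbol y\<bar> \<le> B" using elim A by auto
      then show ?thesis by (simp add: norm_mult mult_right_mono)
    qed (use elim in simp)
  qed
qed

lemma coeff_has_sum:
  assumes F: "has_fourier_L2 f F" "vanishes_off D F"
  shows "((\<lambda>i. (cmod (L2_inner f (G i)))\<^sup>2) has_sum Re (L2_inner (symbol_mult F) F)) UNIV"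
proof -
  note FL = has_fourier_L2D(2)[OF F(1)]
  have SB: "AE t in lebesgue. shift_sum \<theta> t \<le> ennreal B" using S by auto
  let ?h = "\<lambda>y. symbol y * (cmod (F y))\<^sup>2"
  have hh: "Re (of_real (symbol y) * F y * cnj (F y)) = ?h y" for y
    unfolding cmod_power2 by (simp add: power2_eq_square algebra_simps)
  note int = L2_integrable_cnj_mult[OF symbol_mult_L2[OF FL F(2)] FL]
  have hi: "integrable lebesgue ?h"
    using integrable_Re[OF int] unfolding hh .
  have Re: "Re (L2_inner (symbol_mult F) F) = (LINT y|lebesgue. ?h y)"
    unfolding L2_inner_def integral_Re[OF int, symmetric] hh ..
  have h0: "0 \<le> ?h y" for y by (simp add: symbol_def)
  have "coeff_sum G f = (\<integral>\<^sup>+y. esq (F y) * energy y \<partial>lebesgue)"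
    by (rule painless_coeff_sum[OF p F(1) bounded_mult_filter_L2[OF SB B_nonneg FL]])
  also have "\<dots> = (\<integral>\<^sup>+y. ennreal (?h y) \<partial>lebesgue)"
  proof (rule nn_integral_cong_AE, use symbol_bounds F(2) in eventually_elim)
    case (elim y)
    show ?case
    proof (cases "y \<in> D")
      case True
      then have "energy y = ennreal (symbol y)" "0 \<le> symbol y" using elim A by auto
      then show ?thesis by (simp add: ennreal_mult mult.commute)
    qed (use elim in simp)
  qed
  also have "\<dots> = ennreal (LINT y|lebesgue. ?h y)"
    by (rule nn_integral_eq_integral[OF hi]) (use h0 in auto)
  finally have "(\<Sum>\<^sub>\<infinity>i. esq (L2_inner f (G i))) = ennreal (LINT y|lebesgue. ?h y)"
    unfolding coeff_sum_def .
  then show ?thesis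
    unfolding Re using h0 by (intro has_sum_if_infsum_ennreal) (auto intro: integral_nonneg)
qed

text \<open>The quadratic identity is applied to \<open>f + z * h\<close> for every complex
  \<open>z\<close> and polarized; the cross terms combine because the symbol is real. The result is
  the weak form of the frame operator as a multiplier.\<close>

lemma coeff_has_sum_polarized:
  assumes F: "has_fourier_L2 f F" "vanishes_off D F"
    and H: "has_fourier_L2 h H" "vanishes_off D H"
  shows "((\<lambda>i. L2_inner f (G i) * cnj (L2_inner h (G i))) has_sum
      L2_inner (symbol_mult F) H) UNIV"
proof (rule has_sum_polarization)
  note FL = has_fourier_L2D(2)[OF F(1)] and HL = has_fourier_L2D(2)[OF H(1)]
  note fL = has_fourier_L2D(1)[OF F(1)] and hL = has_fourier_L2D(1)[OF H(1)]
  define PF where "PF = (symbol_mult F)"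
  define PH where "PH = (symbol_mult H)"
  have PF: "PF \<in> L2" unfolding PF_def by (rule symbol_mult_L2[OF FL F(2)])
  have PH: "PH \<in> L2" unfolding PH_def by (rule symbol_mult_L2[OF HL H(2)])
  have GL: "G i \<in> L2" for i by (cases i) (use has_fourier_L2D(1)[OF filter_bank_has_fourier] in auto)
  fix z :: complex
  have add: "L2_inner (\<lambda>x. f x + z * h x) (G i) = L2_inner f (G i) + z * L2_inner h (G i)" for i
    by (simp add: L2_inner_add_left[OF fL L2_cmult[OF hL] GL] L2_inner_cmult_left)
  have "AE x in lebesgue. x \<notin> D \<longrightarrow> F x + z * H x = 0" using F(2) H(2) by eventually_elim auto
  from coeff_has_sum[OF has_fourier_L2_add[OF F(1) has_fourier_L2_cmult[OF H(1), of z]] this]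
  have hs: "((\<lambda>i. (cmod (L2_inner f (G i) + z * L2_inner h (G i)))\<^sup>2) has_sum
      Re (L2_inner (\<lambda>y. of_real (symbol y) * (F y + z * H y)) (\<lambda>y. F y + z * H y))) UNIV"
    unfolding add .
  have right: "L2_inner K (\<lambda>y. F y + z * H y) = L2_inner K F + cnj z * L2_inner K H" if K: "K \<in> L2" for K
  proof -
    have "L2_inner (\<lambda>y. F y + z * H y) K = L2_inner F K + z * L2_inner H K"
      by (simp add: L2_inner_add_left[OF FL L2_cmult[OF HL] K] L2_inner_cmult_left)
    then show ?thesis
      by (subst (1 2 3) L2_inner_commute) simp
  qed
  have PHF: "L2_inner PH F = cnj (L2_inner PF H)"
    unfolding PH_def PF_def L2_inner_def
    by (subst Bochner_Integration.integral_cnj [symmetric]) (simp add: mult_ac)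
  have "L2_inner (\<lambda>y. of_real (symbol y) * (F y + z * H y)) (\<lambda>y. F y + z * H y)
      = L2_inner (\<lambda>y. PF y + z * PH y) (\<lambda>y. F y + z * H y)"
    by (rule arg_cong2[where f=L2_inner]) (auto simp: PF_def PH_def fun_eq_iff algebra_simps)
  also have "\<dots> = L2_inner PF F + cnj z * L2_inner PF H + z * (cnj (L2_inner PF H) + cnj z * L2_inner PH H)"
    unfolding L2_inner_add_left[OF PF L2_cmult[OF PH] L2_add[OF FL L2_cmult[OF HL]]] L2_inner_cmult_left
      right[OF PF] right[OF PH] PHF ..
  also have "Re \<dots> = Re (L2_inner PF F) + (cmod z)\<^sup>2 * Re (L2_inner PH H) + 2 * Re (cnj z * L2_inner PF H)"
    unfolding cmod_power2 by (simp add: power2_eq_square algebra_simps)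
  finally have "Re (L2_inner (\<lambda>y. of_real (symbol y) * (F y + z * H y)) (\<lambda>y. F y + z * H y))
    = Re (L2_inner PF F) + (cmod z)\<^sup>2 * Re (L2_inner PH H) + 2 * Re (cnj z * L2_inner PF H)" .
  with hs show "((\<lambda>i. (cmod (L2_inner f (G i) + z * L2_inner h (G i)))\<^sup>2) has_sum
      Re (L2_inner PF F) + (cmod z)\<^sup>2 * Re (L2_inner PH H)
      + 2 * Re (cnj z * L2_inner (symbol_mult F) H)) UNIV"
    unfolding PF_def by simp
qed

text \<open>The polarized identity says that the frame series converges weakly to \<open>k\<close>;
  the Bessel bound upgrades this to norm convergence, and uniqueness of the limit identifies the
  representative chosen by epsilon.\<close>

lemma frame_operator_eq:
  assumes F: "has_fourier_L2 f F" "vanishes_off D F"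
    and k: "has_fourier_L2 k (symbol_mult F)"
  shows "AE x in lebesgue. frame_operator G f x = k x"
proof -
  have fr: "frame (band_space D) G A B" using painless_frame_iff[OF p] A S by blast
  have kB: "k \<in> band_space D"
    by (rule band_spaceI[OF k]) (use F(2) in eventually_elim, simp)
  have "L2_tendsto (\<lambda>S x. \<Sum>i\<in>S. L2_inner f (G i) * G i x) k (finite_subsets_at_top UNIV)"
  proof (rule weak_series_L2_tendsto)
    show "G i \<in> L2" for i
      using filter_bank_in_band_space by (simp add: band_space_def)
    show "k \<in> L2" by (rule has_fourier_L2D(1)[OF k])
    show "0 \<le> B" by (rule B_nonneg)
    show "((\<lambda>i. (cmod (L2_inner f (G i)))\<^sup>2) has_sum Re (L2_inner (symbol_mult F) F)) UNIV"
      by (rule coeff_has_sum[OF F])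
    show "(\<lambda>x. k x - (\<Sum>i\<in>S. L2_inner f (G i) * G i x)) \<in> band_space D" if "finite S" for S
      by (rule partial_sum_remainder_in_band_space[OF that kB])
    fix h assume h: "h \<in> band_space D"
    then obtain H where H: "H \<in> L2" "vanishes_off D H" "has_fourier_L2 h H"
      by (rule band_space_fourier)
    show "(\<Sum>i\<in>S. (cmod (L2_inner h (G i)))\<^sup>2) \<le> B * (L2_norm h)\<^sup>2" if "finite S" for S
    proof -
      have "ennreal (\<Sum>i\<in>S. (cmod (L2_inner h (G i)))\<^sup>2) = (\<Sum>i\<in>S. esq (L2_inner h (G i)))"
        by (simp add: sum_ennreal)
      also have "\<dots> \<le> coeff_sum G h"
        unfolding coeff_sum_def infsum_ennreal_eq_nn_integral[OF infinite_UNIV_int_prod]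
        by (rule nn_integral_count_space_ge_sum[OF that])
      also have "\<dots> \<le> ennreal (B * (L2_norm h)\<^sup>2)" using fr h by (simp add: frame_def)
      finally show ?thesis using B_nonneg by (simp add: ennreal_le_iff)
    qed
    show "((\<lambda>i. L2_inner f (G i) * cnj (L2_inner h (G i))) has_sum L2_inner k h) UNIV"
      using coeff_has_sum_polarized[OF F H(3,2)] has_fourier_L2_inner[OF k H(3)] by simp
  qed
  then have "L2_tendsto (\<lambda>S x. \<Sum>i\<in>S. L2_inner f (G i) * G i x) (frame_operator G f) (finite_subsets_at_top UNIV)"
    unfolding frame_operator_def
    by (rule someI[where P="\<lambda>h. L2_tendsto (\<lambda>S x. \<Sum>i\<in>S. L2_inner f (G i) * G i x) h (finite_subsets_at_top UNIV)"])
  from L2_tendsto_unique[OF this \<open>L2_tendsto _ k _\<close>] show ?thesis by simp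
qed

text \<open>By integer periodicity the symbol times the dual filter is the original filter, so the
  dual bank consists of preimages under the frame operator. The chosen preimage must agree with them
  since the symbol is nonzero on \<open>D\<close>.\<close>

theorem canonical_dual_eq:
  "AE x in lebesgue. canonical_dual (band_space D) G i x = warped_filter_bank D \<Phi> (dual_prototype \<theta>) a i x"
proof -
  interpret dual: filter_bank D \<Phi> v "dual_prototype \<theta>" a
    by unfold_locales (rule dual_prototype_L2_weighted, rule a_pos)
  obtain m n where i: "i = (m, n)" by (cases i)
  define e where "e y = cis (- 2 * pi * (of_int n * a m) * y)" for y
  have GF: "has_fourier_L2 (G i) (\<lambda>y. e y * g m y)"
    unfolding i e_def by (rule filter_bank_has_fourier)
  have dF: "has_fourier_L2 (dual.G i) (\<lambda>y. e y * dual.g m y)"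
    unfolding i e_def by (rule dual.filter_bank_has_fourier)
  have off: "AE x in lebesgue. x \<notin> D \<longrightarrow> e x * dual.g m x = 0" by (simp add: warped_filter_def)
  have symbol_dual: "AE y in lebesgue. of_real (symbol y) * dual.g m y = g m y"
    using symbol_bounds
  proof eventually_elim
    case (elim y)
    show ?case
    proof (cases "y \<in> D")
      case True
      then have "symbol y = shift_energy \<theta> (\<Phi> y)" "symbol y \<noteq> 0" using elim A by auto
      then show ?thesis
        using True by (simp add: warped_filter_def dual_prototype_eq shift_energy_shift)
    qed (simp add: warped_filter_def)
  qed
  have "has_fourier_L2 (G i) (\<lambda>y. of_real (symbol y) * (e y * dual.g m y))"
    by (rule has_fourier_L2_cong_right[OF GF]) (use symbol_dual in eventually_elim, simp add: mult_ac)
  from frame_operator_eq[OF dF off this]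
  \<comment> \<open>Existence of one preimage is required before anything can be said about the
    preimage selected by epsilon.\<close>
  have ex: "dual.G i \<in> band_space D \<and> (AE x in lebesgue. frame_operator G (dual.G i) x = G i x)"
    using dual.filter_bank_in_band_space by blast
  define f where "f = canonical_dual (band_space D) G i"
  have f: "f \<in> band_space D \<and> (AE x in lebesgue. frame_operator G f x = G i x)"
    unfolding f_def canonical_dual_def inv_frame_operator_def
    by (rule someI[where P="\<lambda>f. f \<in> band_space D \<and> (AE x in lebesgue. frame_operator G f x = G i x)", OF ex])
  then obtain F where F: "F \<in> L2" "vanishes_off D F" "has_fourier_L2 f F"
    using band_space_fourier by blast
  obtain k where k: "has_fourier_L2 k (symbol_mult F)"
    using has_fourier_L2_surjective[OF symbol_mult_L2[OF F(1,2)]] by blast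
  have "AE x in lebesgue. k x = G i x"
    using frame_operator_eq[OF F(3,2) k] f[THEN conjunct2] by eventually_elim simp
  then have "AE y in lebesgue. of_real (symbol y) * F y = e y * g m y"
    using has_fourier_L2_AE_iff[OF k GF] by blast
  \<comment> \<open>Injectivity: on \<open>D\<close> the symbol is cancelled, off \<open>D\<close>
    both sides vanish.\<close>
  then have "AE y in lebesgue. F y = e y * dual.g m y"
    using symbol_bounds F(2) symbol_dual
  proof eventually_elim
    case (elim y)
    show ?case
    proof (cases "y \<in> D")
      case True
      then have "complex_of_real (symbol y) \<noteq> 0" using elim A by auto
      moreover have "of_real (symbol y) * F y = of_real (symbol y) * (e y * dual.g m y)"
        using elim by (metis mult.left_commute)
      ultimately show ?thesis by (metis mult_left_cancel)
    next
      case False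
      then show ?thesis using elim by (simp add: warped_filter_def)
    qed
  qed
  then show ?thesis using has_fourier_L2_AE_iff[OF F(3) dF] unfolding f_def by blast
qed

end

end

theorem theorem4p4:
  fixes D :: "real set" and \<Phi> v :: "real \<Rightarrow> real" and \<theta> :: "real \<Rightarrow> complex"
    and a :: "int \<Rightarrow> real"
  assumes "warping_function D \<Phi> v"
    and "\<theta> \<in> L2_weighted (\<lambda>x. sqrt (v x))"
    and "\<And>m. 0 < a m"
  shows "(\<forall>B. bessel_sequence (band_space D) (warped_filter_bank D \<Phi> \<theta> a) B \<longrightarrow>
            (AE \<tau> in lebesgue. shift_sum \<theta> \<tau> \<le> ennreal B))
       \<and> (\<forall>A B. frame (band_space D) (warped_filter_bank D \<Phi> \<theta> a) A B \<and>
              bdd_above (range (\<lambda>m::int. a m * warp_weight D \<Phi> (of_int m))) \<longrightarrow>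
            0 < A \<and> (AE \<tau> in lebesgue. ennreal A \<le> shift_sum \<theta> \<tau>))
       \<and> (\<forall>c d. c < d \<and> ess_supp \<theta> \<subseteq> {c..d} \<and>
              (\<forall>m::int. inverse (a m) \<ge>
                 inv_into D \<Phi> (d + of_int m) - inv_into D \<Phi> (c + of_int m)) \<longrightarrow>
            (\<forall>A B. frame (band_space D) (warped_filter_bank D \<Phi> \<theta> a) A B \<longleftrightarrow>
               0 < A \<and> (AE \<tau> in lebesgue. ennreal A \<le> shift_sum \<theta> \<tau> \<and> shift_sum \<theta> \<tau> \<le> ennreal B))
          \<and> ((\<exists>A B. frame (band_space D) (warped_filter_bank D \<Phi> \<theta> a) A B) \<longrightarrow>
               dual_prototype \<theta> \<in> L2_weighted (\<lambda>x. sqrt (v x)) \<and>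
               (\<forall>i. AE x in lebesgue.
                  canonical_dual (band_space D) (warped_filter_bank D \<Phi> \<theta> a) i x =
                  warped_filter_bank D \<Phi> (dual_prototype \<theta>) a i x)))"
proof -
  interpret filter_bank D \<Phi> v \<theta> a
    using assms by unfold_locales
  show ?thesis
  proof (intro conjI allI impI)
    fix B assume "bessel_sequence (band_space D) G B"
    then show "AE \<tau> in lebesgue. shift_sum \<theta> \<tau> \<le> ennreal B" by (rule bessel_imp_shift_sum_le)
  next
    fix A B assume "frame (band_space D) G A B \<and> bdd_above (range (\<lambda>m::int. a m * warp_weight D \<Phi> (of_int m)))"
    then show "0 < A" "AE \<tau> in lebesgue. ennreal A \<le> shift_sum \<theta> \<tau>"
      using frame_imp_shift_sum_ge by (auto simp: frame_def)
  next
    fix c d A B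
    assume "c < d \<and> ess_supp \<theta> \<subseteq> {c..d} \<and>
      (\<forall>m::int. inverse (a m) \<ge> inv_into D \<Phi> (d + of_int m) - inv_into D \<Phi> (c + of_int m))"
    then have "painless" by (intro painlessI) auto
    then show "frame (band_space D) G A B \<longleftrightarrow>
        0 < A \<and> (AE \<tau> in lebesgue. ennreal A \<le> shift_sum \<theta> \<tau> \<and> shift_sum \<theta> \<tau> \<le> ennreal B)"
      by (rule painless_frame_iff)
  next
    fix c d
    assume "c < d \<and> ess_supp \<theta> \<subseteq> {c..d} \<and>
      (\<forall>m::int. inverse (a m) \<ge> inv_into D \<Phi> (d + of_int m) - inv_into D \<Phi> (c + of_int m))"
    then have p: "painless" by (intro painlessI) auto
    assume "\<exists>A B. frame (band_space D) G A B"
    then obtain A B where "frame (band_space D) G A B" by blast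
    \<comment> \<open>The equivalence just shown converts the frame bounds into pointwise bounds,
      the form in which the results on the dual are stated.\<close>
    then have AB: "0 < A" "AE \<tau> in lebesgue. ennreal A \<le> shift_sum \<theta> \<tau> \<and> shift_sum \<theta> \<tau> \<le> ennreal B"
      using painless_frame_iff[OF p] by blast+
    show "dual_prototype \<theta> \<in> L2_weighted (\<lambda>x. sqrt (v x))"
      by (rule dual_prototype_L2_weighted[OF p AB])
    show "AE x in lebesgue. canonical_dual (band_space D) G i x = warped_filter_bank D \<Phi> (dual_prototype \<theta>) a i x" for i
      by (rule canonical_dual_eq[OF p AB])
  qed
qed

end
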